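(* Let the data set $\mathcal X=\mathcal X_1\cup\dots\cup\mathcal X_L$ of $N$ noisy length-$M$ observations be generated according to the data model described in the context, and let $G$ be the $q$-nearest neighbor graph of the observations constructed by the NNPC algorithm (see context), where $q\le \min_{\ell\in[L]}(n_\ell-1)$. If $$\min_{k,\ell\in[L]\colon k\neq \ell} d(X^{(k)},X^{(\ell)}) \;>\; 8A(B+\sigma^2)\sqrt{\frac{2\log M}{M}}+2\mu_{\max},$$ then, with probability at least $1-2N/M^2$, $G$ has no false connections, i.e., for all $\ell\in[L]$, nodes of $G$ corresponding to observations in $\mathcal X_\ell$ are connected by edges only to other nodes corresponding to observations in $\mathcal X_\ell$.
   Context: Notation: $[n]=\{1,\dots,n\}$, and $\mathrm i$ is the imaginary unit. Data model. There are $L<N$ generative models. For each $\ell\in[L]$, $X^{(\ell)}[m]$, $m\in\mathbb Z$, is a real-valued zero-mean stationary Gaussian process with autocorrelation function (ACF) $r^{(\ell)}$ satisfying $\sum_{m\in\mathbb Z}|r^{(\ell)}[m]|<\infty$ and power spectral density (PSD) $s^{(\ell)}(f)$, $f\in[0,1)$, so that $r^{(\ell)}[m]=\int_0^1 s^{(\ell)}(f)e^{\mathrm i2\pi fm}\,df$. The PSDs are normalized: $\int_0^1 s^{(\ell)}(f)\,df=1$ for all $\ell\in[L]$. Let $W^{(\ell)}$ be a zero-mean white Gaussian noise process with variance $\sigma^2$ (the same for all $\ell$), independent of $X^{(\ell)}$, and let $\tilde X^{(\ell)}[m]=X^{(\ell)}[m]+W^{(\ell)}[m]$. The set $\mathcal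 X_\ell=\{\hat x^{(\ell)}_i\}_{i=1}^{n_\ell}$ consists of $n_\ell$ contiguous length-$M$ observations of $\tilde X^{(\ell)}$, and $\sum_{\ell}n_\ell=N$. For each $\ell$, the $\hat x_i^{(\ell)}$ may either stem from independent realizations of $\tilde X^{(\ell)}$ or be different (possibly overlapping) length-$M$ segments of a given realization of $\tilde X^{(\ell)}$ (so in the latter case they need not be statistically independent). The observations in $\mathcal X$, enumerated irrespective of their generative model, are also written $\hat x_1,\dots,\hat x_N$. Window. $g[m]$, $m\in\mathbb Z$, is an even window function ($g[m]=g[-m]$) with $g[0]=1$ and with nonnegative bounded discrete-time Fourier transform $g(f)$, $0\le g(f)\le A<\infty$ for $f\in[0,1)$. PSD estimates. For an observation $\hat x_i$, the Blackman-Tukey PSD estimate is $\hat s_i(f)=\sum_{m=-M+1}^{M-1}g[m]\hat r_i[m]e^{-\mathrm i2\pi fm}$, where $\hat r_i[m]=\frac1M\sum_{n=1}^{M-|m|}\hat x_i[n+|m|]\,\hat x_i[n]$ for $|m|\le M-1$. Distances. $d(X^{(k)},X^{(\ell)})=\frac12\int_0^1|s^{(k)}(f)-s^{(\ell)}(f)|\,df$ for processes, and $d(\hat x_i,\hat x_j)=\frac12\int_0^1|\hat s_i(f)-\hat s_j(f)|\,df$ for observations. Constants. $B=\max_{\ell\in[L]}\sup_{f\in[0,1)}s^{(\ell)}(f)$. $\mu_{\max}=\max_{\ell\in[L]}\mu^{(\ell)}$ with $\mu^{(\ell)}=\sum_{m=-\infty}^{\infty}|h[m]|\,|r^{(\ell)}[m]|$,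 where $h[m]=1-g[m](1-|m|/M)$ for $|m|<M$ and $h[m]=1$ otherwise. The graph $G$ of the NNPC (nearest neighbor process clustering) algorithm. For each $i\in[N]$ let $\mathcal T_i\subset[N]\setminus\{i\}$ be a set of cardinality $q$ such that $d(\hat x_i,\hat x_j)\le d(\hat x_i,\hat x_p)$ for all $j\in\mathcal T_i$ and all $p\in[N]\setminus(\mathcal T_i\cup\{i\})$. Let $\mathbf Z\in\mathbb R^{N\times N}$ have $(i,j)$ entry $\exp(-2\,d(\hat x_i,\hat x_j))$ if $j\in\mathcal T_i$ and $0$ if $j\notin\mathcal T_i$. $G$ is the weighted undirected graph with nodes $1,\dots,N$ (node $i$ corresponding to $\hat x_i$) and adjacency matrix $\mathbf A=\mathbf Z+\mathbf Z^T$. *)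

theory Defs
  imports "HOL-Probability.Probability"
begin

(* A sequence c and its discrete-time Fourier transform S on [0,1), linked by
   c[m] = int_0^1 S(f) exp(i 2 pi f m) df.  For an absolutely summable c this holds when S is the
   sum of the Fourier series (has_dtft_of_series below), but the relation also covers sequences that
   are not absolutely summable, such as windows with a discontinuous transform. *)
definition has_dtft :: "(int \<Rightarrow> real) \<Rightarrow> (real \<Rightarrow> real) \<Rightarrow> bool" where
  "has_dtft c S \<longleftrightarrow>
     set_integrable lborel {0..<1} S \<and>
     (\<forall>m. complex_of_real (c m) =
        (LBINT f:{0..<1}. complex_of_real (S f) * exp (\<i> * of_real (2 * pi * f * of_int m))))"

lemma LBINT_exp_2pi:
  "(LBINT f:{0..<1}. exp (\<i> * of_real (2 * pi * f * of_int k))) = (if k = 0 then 1 else 0)"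
proof (cases "k = 0")
  case True
  then show ?thesis by (simp add: set_lebesgue_integral_def)
next
  case False
  define F where "F = (\<lambda>f::real. exp (\<i> * of_real (2 * pi * f * of_int k)) / (\<i> * of_real (2 * pi * of_int k)))"
  have "(LBINT f:{0..<1}. exp (\<i> * of_real (2 * pi * f * of_int k)))
      = (LBINT f:{0..1}. exp (\<i> * of_real (2 * pi * f * of_int k)))"
    unfolding set_lebesgue_integral_def
    by (rule integral_cong_AE) (use AE_lborel_singleton[of 1] in \<open>auto elim!: eventually_mono simp: indicator_def\<close>)
  also have "\<dots> = F 1 - F 0"
    unfolding set_lebesgue_integral_def
  proof (rule integral_FTC_Icc)
    show "(0::real) \<le> 1" by simp
    show "(F has_vector_derivative exp (\<i> * of_real (2 * pi * f * of_int k))) (at f within {0..1})" for f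
    proof -
      let ?w = "\<i> * complex_of_real (2 * pi * of_int k)"
      have "((\<lambda>z. exp (?w * z) / ?w) has_field_derivative exp (?w * of_real f)) (at (of_real f))"
        using False by (auto intro!: derivative_eq_intros)
      then have "((\<lambda>y. exp (?w * of_real y) / ?w) has_vector_derivative exp (?w * of_real f))
                   (at f within {0..1})"
        by (rule has_vector_derivative_real_field)
      then show ?thesis by (simp add: F_def mult_ac)
    qed
    show "continuous_on {0..1} (\<lambda>f::real. exp (\<i> * of_real (2 * pi * f * of_int k)))"
      by (intro continuous_intros)
  qed
  also have "exp (\<i> * of_real (2 * pi * 1 * of_int k)) = 1"
    by (simp add: exp_eq_1)
  then have "F 1 - F 0 = 0" by (simp add: F_def)
  finally show ?thesis using False by simp
qed

lemma has_dtft_of_series: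
  assumes c: "(\<lambda>m. \<bar>c m\<bar>) summable_on UNIV"
    and S: "\<And>f. complex_of_real (S f) = (\<Sum>\<^sub>\<infinity>m. of_real (c m) * exp (- \<i> * of_real (2 * pi * f * of_int m)))"
  shows "has_dtft c S"
proof -
  define e where "e k f = exp (\<i> * complex_of_real (2 * pi * f * of_int k))" for k :: int and f
  have e_norm: "cmod (e k f) = 1" for k f by (simp add: e_def)
  have e_meas [measurable]: "e k \<in> borel_measurable borel" for k
    unfolding e_def by measurable
  have e_add: "e k f * e l f = e (k + l) f" for k l f
    by (simp add: e_def exp_add[symmetric] ring_distribs)
  define d where "d n = c (int_decode n)" for n
  have "(\<lambda>n. \<bar>d n\<bar>) summable_on UNIV"
    unfolding d_def using c summable_on_reindex_bij_betw[OF bij_int_decode, of "\<lambda>m. \<bar>c m\<bar>"] by simp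
  then have sd: "summable (\<lambda>n. \<bar>d n\<bar>)" by (rule summable_on_imp_summable)
  have Ssums: "of_real (S f) = (\<Sum>n. of_real (d n) * e (- int_decode n) f)" for f
  proof -
    let ?a = "\<lambda>n. complex_of_real (d n) * e (- int_decode n) f"
    have "(\<lambda>n. norm (?a n)) summable_on UNIV"
      using \<open>(\<lambda>n. \<bar>d n\<bar>) summable_on UNIV\<close> by (simp add: norm_mult e_norm)
    then have "?a summable_on UNIV" by (rule abs_summable_summable)
    then have "(\<Sum>\<^sub>\<infinity>n. ?a n) = suminf ?a"
      using has_sum_imp_sums has_sum_infsum sums_unique by blast
    moreover have "(\<Sum>\<^sub>\<infinity>n. ?a n) = of_real (S f)"
      unfolding S d_def
      using infsum_reindex_bij_betw[OF bij_int_decode, of "\<lambda>m. complex_of_real (c m) * e (- m) f"]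
      by (simp add: e_def)
    ultimately show ?thesis by simp
  qed
  let ?I = "\<lambda>f. indicator {0..<1::real} f"
  define h where "h m n f = ?I f *\<^sub>R (complex_of_real (d n) * e (m - int_decode n) f)" for m n f
  have h_norm: "norm (h m n f) = \<bar>d n\<bar> * ?I f" for m n f
    by (simp add: h_def norm_mult e_norm)
  have h_int: "integrable lborel (h m n)" for m n
  proof (rule Bochner_Integration.integrable_bound)
    show "integrable lborel (\<lambda>f. \<bar>d n\<bar> * ?I f)" by simp
    show "h m n \<in> borel_measurable lborel" unfolding h_def by measurable
    show "AE f in lborel. norm (h m n f) \<le> norm (\<bar>d n\<bar> * ?I f)" by (simp add: h_norm abs_mult)
  qed
  have h_sum: "AE f in lborel. summable (\<lambda>n. norm (h m n f))" for m
    unfolding h_norm using summable_mult2[OF sd] by auto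
  have h_isum: "summable (\<lambda>n. \<integral>f. norm (h m n f) \<partial>lborel)" for m
    using sd by (simp add: h_norm)
  have h_eq: "(\<Sum>n. h m n f) = ?I f *\<^sub>R (complex_of_real (S f) * e m f)" for m f
  proof -
    have sm: "summable (\<lambda>n. complex_of_real (d n) * e (- int_decode n) f)"
      by (rule summable_norm_cancel) (use sd in \<open>simp add: norm_mult e_norm\<close>)
    have "h m n f = (?I f *\<^sub>R e m f) * (complex_of_real (d n) * e (- int_decode n) f)" for n
      using e_add[of m f "- int_decode n"] by (simp add: h_def scaleR_conv_of_real mult_ac)
    then show ?thesis
      using suminf_mult[OF sm, of "?I f *\<^sub>R e m f"] by (simp add: Ssums scaleR_conv_of_real mult_ac)
  qed
  have "integrable lborel (\<lambda>f. \<Sum>n. h 0 n f)"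
    by (rule integrable_suminf) (use h_int h_sum h_isum in auto)
  then have "integrable lborel (\<lambda>f. Re (?I f *\<^sub>R (complex_of_real (S f) * e 0 f)))"
    unfolding h_eq by (rule integrable_Re)
  then have int: "set_integrable lborel {0..<1} S"
    unfolding set_integrable_def by (simp add: e_def)
  have "complex_of_real (c m) = (LBINT f:{0..<1}. complex_of_real (S f) * e m f)" for m
  proof -
    have "(LBINT f:{0..<1}. complex_of_real (S f) * e m f) = (\<integral>f. (\<Sum>n. h m n f) \<partial>lborel)"
      unfolding set_lebesgue_integral_def h_eq ..
    also have "\<dots> = (\<Sum>n. \<integral>f. h m n f \<partial>lborel)"
      by (rule integral_suminf) (use h_int h_sum h_isum in auto)
    also have "(\<lambda>n. \<integral>f. h m n f \<partial>lborel) = (\<lambda>n. if n = int_encode m then complex_of_real (c m) else 0)"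
    proof
      fix n
      have "(\<integral>f. h m n f \<partial>lborel) = complex_of_real (d n) * (LBINT f:{0..<1}. e (m - int_decode n) f)"
        unfolding set_lebesgue_integral_def h_def by (simp add: scaleR_conv_of_real mult_ac)
      also have "\<dots> = complex_of_real (d n) * (if m - int_decode n = 0 then 1 else 0)"
        using LBINT_exp_2pi[of "m - int_decode n"] by (simp only: e_def)
      finally show "(\<integral>f. h m n f \<partial>lborel) = (if n = int_encode m then complex_of_real (c m) else 0)"
        by (auto simp: d_def)
    qed
    also have "(\<Sum>n. if n = int_encode m then complex_of_real (c m) else 0) = complex_of_real (c m)"
      using sums_single[of "int_encode m" "\<lambda>_. complex_of_real (c m)"] by (simp add: sums_iff)
    finally show ?thesis by simp
  qed
  with int show ?thesis by (simp add: has_dtft_def e_def)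
qed
definition process_law :: "'a measure \<Rightarrow> (int \<Rightarrow> 'a \<Rightarrow> real) \<Rightarrow> (int \<Rightarrow> real) measure" where
  "process_law P X = distr P (Pi\<^sub>M UNIV (\<lambda>_. borel)) (\<lambda>\<omega> m. X m \<omega>)"

(* Degenerate normal laws (sg = 0) are included. *)
definition gaussian_rv :: "'a measure \<Rightarrow> ('a \<Rightarrow> real) \<Rightarrow> bool" where
  "gaussian_rv P Y \<longleftrightarrow> Y \<in> borel_measurable P \<and>
     (\<exists>mu sg. sg \<ge> 0 \<and> distr P borel Y = distr std_normal_distribution borel (\<lambda>z. mu + sg * z))"

definition gaussian_process :: "'a measure \<Rightarrow> (int \<Rightarrow> 'a \<Rightarrow> real) \<Rightarrow> bool" where
  "gaussian_process P X \<longleftrightarrow>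
     (\<forall>J c. finite J \<longrightarrow> gaussian_rv P (\<lambda>\<omega>. \<Sum>m\<in>J. c m * X m \<omega>))"

definition stationary_process :: "'a measure \<Rightarrow> (int \<Rightarrow> 'a \<Rightarrow> real) \<Rightarrow> bool" where
  "stationary_process P X \<longleftrightarrow> (\<forall>k. process_law P (\<lambda>m. X (m + k)) = process_law P X)"

(* Zero-mean stationary Gaussian process with autocorrelation function r. *)
definition zm_stationary_gaussian ::
    "'a measure \<Rightarrow> (int \<Rightarrow> 'a \<Rightarrow> real) \<Rightarrow> (int \<Rightarrow> real) \<Rightarrow> bool" where
  "zm_stationary_gaussian P X r \<longleftrightarrow>
     gaussian_process P X \<and> stationary_process P X \<and>
     (\<forall>m. (LINT \<omega>|P. X m \<omega>) = 0) \<and>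
     (\<forall>n m. (LINT \<omega>|P. X (n + m) \<omega> * X n \<omega>) = r m)"

definition white_gaussian_noise :: "'a measure \<Rightarrow> (int \<Rightarrow> 'a \<Rightarrow> real) \<Rightarrow> real \<Rightarrow> bool" where
  "white_gaussian_noise P W v \<longleftrightarrow> zm_stationary_gaussian P W (\<lambda>m. if m = 0 then v else 0)"

definition indep_processes ::
    "'a measure \<Rightarrow> (int \<Rightarrow> 'a \<Rightarrow> real) \<Rightarrow> (int \<Rightarrow> 'a \<Rightarrow> real) \<Rightarrow> bool" where
  "indep_processes P X W \<longleftrightarrow>
     prob_space.indep_var P (Pi\<^sub>M UNIV (\<lambda>_. borel)) (\<lambda>\<omega> m. X m \<omega>)
                            (Pi\<^sub>M UNIV (\<lambda>_. borel)) (\<lambda>\<omega> m. W m \<omega>)"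

(* A realization of a process is a process with the same law. *)
definition realization ::
    "'a measure \<Rightarrow> (int \<Rightarrow> 'a \<Rightarrow> real) \<Rightarrow> (int \<Rightarrow> 'a \<Rightarrow> real) \<Rightarrow> bool" where
  "realization P Xt Y \<longleftrightarrow> (\<forall>m. Y m \<in> borel_measurable P) \<and> process_law P Y = process_law P Xt"

(* The observations x i, i in I, are contiguous length-M segments of realizations Y i of Xt, the
   segment of x i starting right after time t i.  Either the realizations are independent, or they
   all coincide and the segments sit at different places. *)
definition observations_of ::
    "'a measure \<Rightarrow> (int \<Rightarrow> 'a \<Rightarrow> real) \<Rightarrow> nat \<Rightarrow> nat set \<Rightarrow> (nat \<Rightarrow> nat \<Rightarrow> 'a \<Rightarrow> real) \<Rightarrow> bool" where
  "observations_of P Xt M I x \<longleftrightarrow>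
     (\<exists>Y t. (\<forall>i\<in>I. realization P Xt (Y i)) \<and>
        (\<forall>i\<in>I. \<forall>n\<in>{1..M}. \<forall>\<omega>\<in>space P. x i n \<omega> = Y i (t i + int n) \<omega>) \<and>
        (prob_space.indep_vars P (\<lambda>_. Pi\<^sub>M UNIV (\<lambda>_. borel)) (\<lambda>i \<omega> m. Y i m \<omega>) I
         \<or> (\<forall>i\<in>I. \<forall>j\<in>I. Y i = Y j) \<and> inj_on t I))"

definition acf_est :: "nat \<Rightarrow> (nat \<Rightarrow> real) \<Rightarrow> int \<Rightarrow> real" where
  "acf_est M x m = (1 / real M) * (\<Sum>n = 1..M - nat \<bar>m\<bar>. x (n + nat \<bar>m\<bar>) * x n)"

(* Blackman-Tukey estimate; its values are real for an even window g. *)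
definition psd_est :: "nat \<Rightarrow> (int \<Rightarrow> real) \<Rightarrow> (nat \<Rightarrow> real) \<Rightarrow> real \<Rightarrow> complex" where
  "psd_est M g x f =
     (\<Sum>m = - int M + 1..int M - 1.
        of_real (g m * acf_est M x m) * exp (- \<i> * of_real (2 * pi * f * of_int m)))"

definition process_dist :: "(real \<Rightarrow> real) \<Rightarrow> (real \<Rightarrow> real) \<Rightarrow> real" where
  "process_dist s s' = 1 / 2 * (LBINT f:{0..<1}. \<bar>s f - s' f\<bar>)"

definition obs_dist :: "nat \<Rightarrow> (int \<Rightarrow> real) \<Rightarrow> (nat \<Rightarrow> real) \<Rightarrow> (nat \<Rightarrow> real) \<Rightarrow> real" where
  "obs_dist M g x y = 1 / 2 * (LBINT f:{0..<1}. cmod (psd_est M g x f - psd_est M g y f))"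

definition bias_weight :: "nat \<Rightarrow> (int \<Rightarrow> real) \<Rightarrow> int \<Rightarrow> real" where
  "bias_weight M g m =
     (if \<bar>m\<bar> < int M then 1 - g m * (1 - of_int \<bar>m\<bar> / real M) else 1)"

definition bias_bound :: "nat \<Rightarrow> (int \<Rightarrow> real) \<Rightarrow> (int \<Rightarrow> real) \<Rightarrow> real" where
  "bias_bound M g r = (\<Sum>\<^sub>\<infinity>m. \<bar>bias_weight M g m\<bar> * \<bar>r m\<bar>)"

(* T i is a set of q nearest neighbours of i within {1..N} for the distances D; ties may be broken
   in any way, so T need not be unique. *)
definition nearest_neighbours ::
    "nat \<Rightarrow> nat \<Rightarrow> (nat \<Rightarrow> nat \<Rightarrow> real) \<Rightarrow> (nat \<Rightarrow> nat set) \<Rightarrow> bool" where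
  "nearest_neighbours N q D T \<longleftrightarrow>
     (\<forall>i\<in>{1..N}. T i \<subseteq> {1..N} - {i} \<and> card (T i) = q \<and>
        (\<forall>j\<in>T i. \<forall>p\<in>{1..N} - (T i \<union> {i}). D i j \<le> D i p))"

definition nn_weight :: "(nat \<Rightarrow> nat \<Rightarrow> real) \<Rightarrow> (nat \<Rightarrow> nat set) \<Rightarrow> nat \<Rightarrow> nat \<Rightarrow> real" where
  "nn_weight D T i j = (if j \<in> T i then exp (- 2 * D i j) else 0)"

definition nn_adjacency :: "(nat \<Rightarrow> nat \<Rightarrow> real) \<Rightarrow> (nat \<Rightarrow> nat set) \<Rightarrow> nat \<Rightarrow> nat \<Rightarrow> real" where
  "nn_adjacency D T i j = nn_weight D T i j + nn_weight D T j i"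

definition cluster :: "nat \<Rightarrow> (nat \<Rightarrow> nat) \<Rightarrow> nat \<Rightarrow> nat set" where
  "cluster N lab l = {i \<in> {1..N}. lab i = l}"

(* Adj is a weighted adjacency matrix: nodes i and j are joined by an edge iff Adj i j is nonzero. *)
definition no_false_connections ::
    "nat \<Rightarrow> nat \<Rightarrow> (nat \<Rightarrow> nat) \<Rightarrow> (nat \<Rightarrow> nat \<Rightarrow> real) \<Rightarrow> bool" where
  "no_false_connections N L lab Adj \<longleftrightarrow>
     (\<forall>l\<in>{1..L}. \<forall>i\<in>cluster N lab l. \<forall>j\<in>{1..N}.
        Adj i j \<noteq> 0 \<longrightarrow> j \<in> cluster N lab l - {i})"

end

theory Submission
  imports Defs
begin

text \<open>For a fixed frequency, \<open>M\<close> times the estimate is a quadratic form \<open>x\<^sup>T G x\<close> in the centred Gaussian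
  vector \<open>x\<close> of observations. The bounds on the window transform and on the noisy spectrum give
  \<open>0 \<le> G \<le> A\<close> and \<open>C \<le> B + \<sigma>\<^sup>2\<close> for the covariance \<open>C\<close>, while the trace of \<open>G C\<close> is at most
  \<open>M (B + \<sigma>\<^sup>2)\<close>. These facts alone bound both exponential moments of the centred form. By Jensen's
  inequality for the average over the frequency, the same bound holds for the \<open>L\<^sup>1\<close> distance between
  the estimate and its mean, so that by Markov's inequality this distance exceeds
  \<open>4 A (B + \<sigma>\<^sup>2) (2 ln M / M)\<^bsup>1/2\<^esup>\<close> with probability at most \<open>2 / M\<^sup>2\<close>. The distance of the mean
  from the true spectrum is at most \<open>mu_max\<close>, and outside the exceptional events the triangle
  inequality separates the models. The moment bound loses a constant compared with the sharp one; it
  suffices because the separation hypothesis, together with \<open>process_dist s s' \<le> B - 1\<close>, forces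
  \<open>(2 ln M / M)\<^bsup>1/2\<^esup>\<close> to be small.\<close>

section \<open>Quadratic forms\<close>

text \<open>The constants balance as follows. Put c = \<open>A * (B + \<sigma>\<^sup>2)\<close> and
  u = \<open>sqrt (2 * ln M / M)\<close>. The exponential moment at parameter u is at most 2 exp
  (u^2 M) = 2 M^2, while exceeding the threshold 4 c u costs a factor exp (- 2 u^2 M) = M^(-4); this
  leaves 2 / M^2 per observation. A moment bound of this shape uses 1 / (1 - u) \<le> 2, which is
  why u must be small. The union bound over the \<open>N\<close> observations asks for no
  independence between them, so overlapping segments are harmless. Outside the bad events two
  observations of one model are closer than 4 c u, and observations of different models are further
  apart than (8 c u + 2 mu_max) - mu_max - 4 c u.

  A further obstacle is that a spectrum is given only as an integrable function with prescribed
  Fourier coefficients, whereas the bias estimate speaks of the Fourier series of the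
  autocorrelation function. Identifying the two almost everywhere requires uniqueness of Fourier
  coefficients.\<close>

definition quad_form :: "'i set \<Rightarrow> ('i \<Rightarrow> 'i \<Rightarrow> real) \<Rightarrow> ('i \<Rightarrow> real) \<Rightarrow> real" where
  "quad_form I H v = (\<Sum>i\<in>I. \<Sum>j\<in>I. H i j * v i * v j)"

definition sq_norm :: "'i set \<Rightarrow> ('i \<Rightarrow> real) \<Rightarrow> real" where
  "sq_norm I v = (\<Sum>i\<in>I. (v i)\<^sup>2)"

lemma quad_form_cong:
  assumes "\<And>i j. i \<in> I \<Longrightarrow> j \<in> I \<Longrightarrow> H i j = H' i j" "\<And>i. i \<in> I \<Longrightarrow> v i = v' i"
  shows "quad_form I H v = quad_form I H' v'"
  using assms by (auto simp: quad_form_def intro!: sum.cong)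

lemma sq_norm_cong: "(\<And>i. i \<in> I \<Longrightarrow> v i = v' i) \<Longrightarrow> sq_norm I v = sq_norm I v'"
  by (auto simp: sq_norm_def)

lemma quad_form_insert:
  assumes "finite I" "a \<notin> I" and sym: "\<And>i. i \<in> I \<Longrightarrow> H i a = H a i"
  shows "quad_form (insert a I) H v
       = quad_form I H v + 2 * v a * (\<Sum>i\<in>I. H a i * v i) + H a a * (v a)\<^sup>2"
proof -
  have "(\<Sum>i\<in>I. H i a * v i * v a) = v a * (\<Sum>i\<in>I. H a i * v i)"
    by (simp add: sum_distrib_left sym mult_ac)
  moreover have "(\<Sum>i\<in>I. H a i * v a * v i) = v a * (\<Sum>i\<in>I. H a i * v i)"
    by (simp add: sum_distrib_left mult_ac)
  ultimately show ?thesis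
    using assms(1,2) by (simp add: quad_form_def sum.distrib power2_eq_square algebra_simps)
qed

lemma quad_form_unit:
  assumes "finite I" "i \<in> I"
  shows "quad_form I H (\<lambda>j. if j = i then 1 else 0) = H i i"
proof -
  have "quad_form I H (\<lambda>j. if j = i then 1 else 0)
      = (\<Sum>k\<in>I. if k = i then (\<Sum>j\<in>I. if j = i then H i i else 0) else 0)"
    unfolding quad_form_def by (intro sum.cong refl) (auto intro!: sum.cong)
  with assms show ?thesis by simp
qed

lemma quad_form_rank_one:
  "quad_form I (\<lambda>i j. H i j + c * b i * b j) v = quad_form I H v + c * (\<Sum>i\<in>I. b i * v i)\<^sup>2"
proof -
  have "(\<Sum>i\<in>I. b i * v i)\<^sup>2 = (\<Sum>i\<in>I. \<Sum>j\<in>I. b i * v i * (b j * v j))"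
    by (simp add: power2_eq_square sum_product)
  then show ?thesis
    by (simp add: quad_form_def sum.distrib sum_distrib_left algebra_simps)
qed

lemma quad_form_gram:
  "quad_form I (\<lambda>i j. \<Sum>k\<in>J. K k i * K k j) v = (\<Sum>k\<in>J. (\<Sum>i\<in>I. K k i * v i)\<^sup>2)"
proof -
  have "quad_form I (\<lambda>i j. \<Sum>k\<in>J. K k i * K k j) v
      = (\<Sum>i\<in>I. \<Sum>j\<in>I. \<Sum>k\<in>J. K k i * v i * (K k j * v j))"
    by (simp add: quad_form_def sum_distrib_left sum_distrib_right mult_ac)
  also have "\<dots> = (\<Sum>i\<in>I. \<Sum>k\<in>J. \<Sum>j\<in>I. K k i * v i * (K k j * v j))"
    by (rule sum.cong[OF refl], rule sum.swap)
  also have "\<dots> = (\<Sum>k\<in>J. \<Sum>i\<in>I. \<Sum>j\<in>I. K k i * v i * (K k j * v j))"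
    by (rule sum.swap)
  also have "\<dots> = (\<Sum>k\<in>J. (\<Sum>i\<in>I. K k i * v i)\<^sup>2)"
    by (simp add: power2_eq_square sum_product)
  finally show ?thesis .
qed

text \<open>Cholesky elimination: split off the pivot row of \<open>a\<close> and factor the Schur
  complement \<open>G'\<close>, which inherits symmetry and semidefiniteness.\<close>

lemma psd_gram:
  assumes "finite I" "\<And>i j. i \<in> I \<Longrightarrow> j \<in> I \<Longrightarrow> G i j = G j i" "\<And>v. 0 \<le> quad_form I G v"
  shows "\<exists>K. \<forall>i\<in>I. \<forall>j\<in>I. G i j = (\<Sum>k\<in>I. K k i * K k j)"
  using assms
proof (induction I arbitrary: G rule: finite_induct)
  case empty
  then show ?case by simp
next
  case (insert a I)
  have sym: "G i j = G j i" if "i \<in> insert a I" "j \<in> insert a I" for i j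
    using insert.prems(1)[OF that] .
  have exp: "quad_form (insert a I) G v
      = quad_form I G v + 2 * v a * (\<Sum>i\<in>I. G a i * v i) + G a a * (v a)\<^sup>2" for v
    by (rule quad_form_insert) (use insert sym in auto)
  have psd: "0 \<le> quad_form I G v + 2 * t * (\<Sum>i\<in>I. G a i * v i) + G a a * t\<^sup>2" for v t
  proof -
    have "quad_form I G (v(a := t)) = quad_form I G v"
      by (rule quad_form_cong) (use insert.hyps in auto)
    moreover have "(\<Sum>i\<in>I. G a i * (v(a := t)) i) = (\<Sum>i\<in>I. G a i * v i)"
      by (rule sum.cong) (use insert.hyps in auto)
    ultimately show ?thesis
      using insert.prems(2)[of "v(a := t)"] unfolding exp by simp
  qed
  have aa: "0 \<le> G a a"
    using psd[of "\<lambda>_. 0" 1] by (simp add: quad_form_def)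
  \<comment> \<open>For a zero pivot this is 0, since division by zero gives 0; then
    \<open>G'\<close> equals \<open>G\<close> and nothing is split off.\<close>
  define c where "c = 1 / G a a"
  \<comment> \<open>With a zero pivot the form is affine in the new coordinate, so it stays
    nonnegative only if its slope vanishes.\<close>
  have row: "G a i = 0" if "G a a = 0" "i \<in> I" for i
  proof (rule ccontr)
    assume "G a i \<noteq> 0"
    have "0 \<le> G i i + 2 * t * G a i" for t
    proof -
      have "quad_form I G (\<lambda>j. if j = i then 1 else 0) = G i i"
        using that insert.hyps by (simp add: quad_form_unit)
      then show ?thesis
        using psd[of "\<lambda>j. if j = i then 1 else 0" t] that insert.hyps
        by (simp add: if_distrib sum.delta cong: if_cong)
    qed
    from this[of "- (\<bar>G i i\<bar> + 1) / G a i"] \<open>G a i \<noteq> 0\<close> show False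
      by simp
  qed
  define G' where "G' i j = G i j + (- c) * G a i * G a j" for i j
  have "\<exists>K. \<forall>i\<in>I. \<forall>j\<in>I. G' i j = (\<Sum>k\<in>I. K k i * K k j)"
  proof (rule insert.IH)
    show "G' i j = G' j i" if "i \<in> I" "j \<in> I" for i j
      using that sym by (simp add: G'_def)
    show "0 \<le> quad_form I G' v" for v
    proof -
      let ?s = "\<Sum>i\<in>I. G a i * v i"
      have "quad_form I G' v = quad_form I G v - c * ?s\<^sup>2"
        unfolding G'_def quad_form_rank_one by simp
      \<comment> \<open>For a positive pivot, \<open>- c * ?s\<close> minimizes the quadratic
        polynomial in the new coordinate.\<close>
      moreover have "0 \<le> quad_form I G v - c * ?s\<^sup>2"
        using psd[of v "- c * ?s"] aa
        by (cases "G a a = 0") (auto simp: c_def power2_eq_square field_simps)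
      ultimately show ?thesis by simp
    qed
  qed
  then obtain K where K: "\<And>i j. i \<in> I \<Longrightarrow> j \<in> I \<Longrightarrow> G' i j = (\<Sum>k\<in>I. K k i * K k j)"
    by blast
  \<comment> \<open>The new row \<open>a\<close> is the pivot row divided by the root of the pivot;
    the old factor is padded with a zero column \<open>a\<close>.\<close>
  define L where "L k i = (if k = a then G a i * sqrt c else if i = a then 0 else K k i)" for k i
  have c0: "0 \<le> c" using aa by (simp add: c_def)
  show ?case
  proof (intro exI[of _ L] ballI)
    fix i j assume ij: "i \<in> insert a I" "j \<in> insert a I"
    have *: "(\<Sum>k\<in>insert a I. L k i * L k j) = c * G a i * G a j + (\<Sum>k\<in>I. L k i * L k j)"
      using insert.hyps c0 by (simp add: L_def mult_ac)
    have **: "(\<Sum>k\<in>I. L k i * L k j) = (if i = a \<or> j = a then 0 else G' i j)"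
    proof (cases "i = a \<or> j = a")
      case False
      then have "(\<Sum>k\<in>I. L k i * L k j) = (\<Sum>k\<in>I. K k i * K k j)"
        by (intro sum.cong) (use insert.hyps in \<open>auto simp: L_def\<close>)
      with False ij K show ?thesis by auto
    qed (use insert.hyps in \<open>auto simp: L_def intro!: sum.neutral\<close>)
    show "G i j = (\<Sum>k\<in>insert a I. L k i * L k j)"
    proof (cases "i = a \<or> j = a")
      case True
      show ?thesis
      proof (cases "G a a = 0")
        case True
        have "G a k = 0" if "k \<in> insert a I" for k
          using row[OF True] True that by auto
        then show ?thesis using ij \<open>i = a \<or> j = a\<close> sym[of i j] unfolding * ** by auto
      next
        case False
        then show ?thesis using ij \<open>i = a \<or> j = a\<close> sym[of i j] unfolding * **
          by (auto simp: c_def)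
      qed
    qed (use * ** in \<open>simp add: G'_def\<close>)
  qed
qed

text \<open>A matrix and its transpose have the same norm. With w = K^T v, the square of |w| is the
  scalar product of v and K w; the inequality 2 v y \<le> A v^2 + y^2 / A and the hypothesis on
  \<open>K\<close> bound it by (A |v|^2 + |w|^2) / 2, and the last term is absorbed.\<close>

lemma gram_transpose_bound:
  assumes "finite I" "0 < A" and K: "\<And>w. (\<Sum>k\<in>J. (\<Sum>i\<in>I. K k i * w i)\<^sup>2) \<le> A * sq_norm I w"
  shows "sq_norm I (\<lambda>i. \<Sum>k\<in>J. K k i * v k) \<le> A * sq_norm J v"
proof -
  define w where "w i = (\<Sum>k\<in>J. K k i * v k)" for i
  define y where "y k = (\<Sum>i\<in>I. K k i * w i)" for k
  have "sq_norm I w = (\<Sum>i\<in>I. \<Sum>k\<in>J. w i * (K k i * v k))"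
    by (simp add: sq_norm_def power2_eq_square w_def sum_distrib_left)
  also have "\<dots> = (\<Sum>k\<in>J. v k * y k)"
    by (subst sum.swap) (simp add: y_def sum_distrib_left mult_ac)
  also have "\<dots> \<le> (\<Sum>k\<in>J. (A * (v k)\<^sup>2 + (y k)\<^sup>2 / A) / 2)"
  proof (rule sum_mono)
    fix k
    have "0 \<le> (A * v k - y k)\<^sup>2 / A" using \<open>0 < A\<close> by simp
    also have "\<dots> = A * (v k)\<^sup>2 + (y k)\<^sup>2 / A - 2 * (v k * y k)"
      using \<open>0 < A\<close> by (simp add: power2_eq_square field_simps)
    finally show "v k * y k \<le> (A * (v k)\<^sup>2 + (y k)\<^sup>2 / A) / 2" by simp
  qed
  finally have "sq_norm I w \<le> (A * sq_norm J v + (\<Sum>k\<in>J. (y k)\<^sup>2) / A) / 2"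
    by (simp add: sq_norm_def sum.distrib sum_divide_distrib sum_distrib_left add_divide_distrib)
  moreover have "(\<Sum>k\<in>J. (y k)\<^sup>2) / A \<le> sq_norm I w"
    using K[of w] \<open>0 < A\<close> by (simp add: y_def field_simps)
  moreover have "a \<le> (b + c) / 2 \<Longrightarrow> c \<le> a \<Longrightarrow> a \<le> b" for a b c :: real by simp
  ultimately have "sq_norm I w \<le> A * sq_norm J v" by blast
  then show ?thesis by (simp add: w_def[abs_def])
qed

section \<open>Gaussian quadratic forms\<close>

text \<open>For 0 \<le> H \<le> 1 one has H^2 \<le> H, and this is a diagonal entry of it.
  Semidefiniteness is tested on e - H e for the unit vector e: the cross terms give - 2 |H e|^2, and
  contraction bounds the last term by |H e|^2.\<close>

lemma psd_contraction_column:
  assumes "finite I" "a \<in> I" and sym: "\<And>i j. i \<in> I \<Longrightarrow> j \<in> I \<Longrightarrow> H i j = H j i"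
    and psd: "\<And>v. 0 \<le> quad_form I H v" and contr: "\<And>v. quad_form I H v \<le> sq_norm I v"
  shows "(\<Sum>i\<in>I. (H a i)\<^sup>2) \<le> H a a"
proof -
  define e where "e i = (if i = a then 1 else 0 :: real)" for i
  let ?w = "\<lambda>i. H a i"
  have bilin: "(\<Sum>i\<in>I. \<Sum>j\<in>I. H i j * e i * ?w j) = sq_norm I ?w"
  proof -
    have "(\<Sum>i\<in>I. \<Sum>j\<in>I. H i j * e i * ?w j) = (\<Sum>i\<in>I. if i = a then (\<Sum>j\<in>I. H a j * ?w j) else 0)"
      by (intro sum.cong refl) (auto simp: e_def)
    then show ?thesis using assms(1,2) by (simp add: sq_norm_def power2_eq_square)
  qed
  have bilin': "(\<Sum>i\<in>I. \<Sum>j\<in>I. H i j * ?w i * e j) = sq_norm I ?w"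
    by (subst sum.swap, subst bilin[symmetric]) (auto intro!: sum.cong simp: sym)
  have "quad_form I H (\<lambda>i. e i - ?w i)
      = quad_form I H e - (\<Sum>i\<in>I. \<Sum>j\<in>I. H i j * e i * ?w j)
        - (\<Sum>i\<in>I. \<Sum>j\<in>I. H i j * ?w i * e j) + quad_form I H ?w"
    by (simp add: quad_form_def sum.distrib sum_subtractf algebra_simps)
  moreover have "quad_form I H e = H a a"
    using quad_form_unit[OF assms(1,2)] by (simp add: e_def[abs_def])
  ultimately have "0 \<le> H a a - sq_norm I ?w"
    using psd[of "\<lambda>i. e i - ?w i"] contr[of ?w] unfolding bilin bilin' by linarith
  then show ?thesis by (simp add: sq_norm_def)
qed

text \<open>Completing the square: up to the constant \<open>C\<close> the weighted integrand is the
  normal density with mean \<open>\<alpha> / p\<close> and variance \<open>1 / p\<close>, where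
  \<open>p = 1 - \<beta>\<close>.\<close>

lemma nn_integral_std_normal_exp_quadratic:
  fixes \<alpha> \<beta> :: real
  assumes "\<beta> < 1"
  shows "(\<integral>\<^sup>+t. ennreal (exp (\<alpha> * t + \<beta> * t\<^sup>2 / 2)) \<partial>std_normal_distribution)
       = ennreal (exp (\<alpha>\<^sup>2 / (2 * (1 - \<beta>))) / sqrt (1 - \<beta>))"
proof -
  define p where "p = 1 - \<beta>"
  have p: "0 < p" using assms by (simp add: p_def)
  define C where "C = exp (\<alpha>\<^sup>2 / (2 * p)) / sqrt p"
  have C: "0 \<le> C" using p by (simp add: C_def)
  have eq: "normal_density 0 1 t * exp (\<alpha> * t + \<beta> * t\<^sup>2 / 2)
          = C * normal_density (\<alpha> / p) (1 / sqrt p) t" for t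
  proof -
    have "- t\<^sup>2 / 2 + (\<alpha> * t + \<beta> * t\<^sup>2 / 2) = \<alpha>\<^sup>2 / (2 * p) + - (t - \<alpha> / p)\<^sup>2 / (2 * (1 / sqrt p)\<^sup>2)"
    proof -
      have "\<beta> = 1 - p" by (simp add: p_def)
      moreover have "(t - \<alpha> / p)\<^sup>2 / (2 * (1 / sqrt p)\<^sup>2) = p * (t - \<alpha> / p)\<^sup>2 / 2"
        using p by (simp add: power_divide)
      ultimately show ?thesis
        using p by (simp only: \<open>\<beta> = 1 - p\<close>) (simp add: field_simps power2_eq_square)
    qed
    then have "exp (- t\<^sup>2 / 2) * exp (\<alpha> * t + \<beta> * t\<^sup>2 / 2)
        = exp (\<alpha>\<^sup>2 / (2 * p)) * exp (- (t - \<alpha> / p)\<^sup>2 / (2 * (1 / sqrt p)\<^sup>2))"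
      by (simp only: exp_add[symmetric])
    moreover have "sqrt (2 * pi * (1 / sqrt p)\<^sup>2) = sqrt (2 * pi) / sqrt p"
      using p by (simp add: power_divide real_sqrt_divide)
    ultimately show ?thesis
      using p by (simp add: normal_density_def C_def field_simps)
  qed
  have "(\<integral>\<^sup>+t. ennreal (exp (\<alpha> * t + \<beta> * t\<^sup>2 / 2)) \<partial>std_normal_distribution)
      = (\<integral>\<^sup>+t. ennreal (normal_density 0 1 t * exp (\<alpha> * t + \<beta> * t\<^sup>2 / 2)) \<partial>lborel)"
    by (simp add: nn_integral_density ennreal_mult)
  also have "\<dots> = ennreal C * (\<integral>\<^sup>+t. ennreal (normal_density (\<alpha> / p) (1 / sqrt p) t) \<partial>lborel)"
    unfolding eq using C by (simp add: ennreal_mult nn_integral_cmult)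
  also have "(\<integral>\<^sup>+t. ennreal (normal_density (\<alpha> / p) (1 / sqrt p) t) \<partial>lborel) = 1"
    using p prob_space.emeasure_space_1[OF prob_space_normal_density[of "1 / sqrt p" "\<alpha> / p"]]
    by (simp add: emeasure_density)
  finally show ?thesis by (simp add: C_def p_def)
qed

abbreviation std_normal_vec :: "'i set \<Rightarrow> ('i \<Rightarrow> real) measure" where
  "std_normal_vec I \<equiv> Pi\<^sub>M I (\<lambda>_. std_normal_distribution)"

lemma product_sigma_finite_std_normal: "product_sigma_finite (\<lambda>_. std_normal_distribution)"
  by (simp add: product_sigma_finite_def prob_space_imp_sigma_finite prob_space_normal_density)

lemma quad_form_measurable [measurable]:
  "quad_form I H \<in> borel_measurable (std_normal_vec I)"
  unfolding quad_form_def by measurable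

text \<open>Gaussian elimination: integrating out one coordinate replaces the form by a Schur
  complement, which is again between 0 and the identity.\<close>

lemma nn_integral_gaussian_chaos_le:
  assumes "finite I" "\<theta> < 1" "\<And>i j. i \<in> I \<Longrightarrow> j \<in> I \<Longrightarrow> H i j = H j i"
    and "\<And>v. 0 \<le> quad_form I H v" "\<And>v. quad_form I H v \<le> sq_norm I v"
  shows "(\<integral>\<^sup>+z. ennreal (exp (\<theta> / 2 * quad_form I H z)) \<partial>std_normal_vec I)
       \<le> ennreal (exp (\<theta> * (\<Sum>i\<in>I. H i i) / (2 * (1 - \<theta>))))"
  using assms(1,3-)
proof (induction I arbitrary: H rule: finite_induct)
  case empty
  interpret product_sigma_finite "\<lambda>_. std_normal_distribution"
    by (rule product_sigma_finite_std_normal)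
  show ?case by (simp add: quad_form_def PiM_empty nn_integral_count_space_finite)
next
  case (insert x I)
  interpret product_sigma_finite "\<lambda>_. std_normal_distribution"
    by (rule product_sigma_finite_std_normal)
  define a where "a = H x x"
  define b where "b i = H x i" for i
  \<comment> \<open>Integrating out the coordinate \<open>x\<close> contributes the factor 1 / sqrt
    p and adds \<open>\<theta> / p\<close> times the squared linear term to the form in the other
    coordinates.\<close>
  define p where "p = 1 - \<theta> * a"
  define \<tau> where "\<tau> = \<theta> / p"
  define H' where "H' i j = H i j + \<tau> * b i * b j" for i j
  have sym: "H i j = H j i" if "i \<in> insert x I" "j \<in> insert x I" for i j
    using insert.prems(1)[OF that] .
  have exp: "quad_form (insert x I) H (v(x := t))
      = quad_form I H v + 2 * t * (\<Sum>i\<in>I. b i * v i) + a * t\<^sup>2" for v t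
  proof -
    have "quad_form I H (v(x := t)) = quad_form I H v"
      by (rule quad_form_cong) (use insert.hyps in auto)
    moreover have "(\<Sum>i\<in>I. H x i * (v(x := t)) i) = (\<Sum>i\<in>I. b i * v i)"
      by (rule sum.cong) (use insert.hyps in \<open>auto simp: b_def\<close>)
    ultimately show ?thesis
      by (subst quad_form_insert) (use insert sym in \<open>auto simp: a_def\<close>)
  qed
  have norm: "sq_norm (insert x I) (v(x := t)) = sq_norm I v + t\<^sup>2" for v t
    using insert.hyps sq_norm_cong[of I v "v(x := t)"] by (auto simp: sq_norm_def intro!: sum.cong)
  have col: "(\<Sum>i\<in>I. (b i)\<^sup>2) \<le> a * (1 - a)"
  proof -
    have "(\<Sum>i\<in>insert x I. (H x i)\<^sup>2) \<le> H x x"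
      by (rule psd_contraction_column[OF _ _ sym insert.prems(2,3)]) (use insert.hyps(1) in simp_all)
    then show ?thesis
      using insert.hyps by (simp add: a_def b_def power2_eq_square algebra_simps)
  qed
  have a: "0 \<le> a" "a \<le> 1"
    using insert.prems(2)[of "(\<lambda>_. 0)(x := 1)"] insert.prems(3)[of "(\<lambda>_. 0)(x := 1)"]
    unfolding exp norm by (auto simp: quad_form_def sq_norm_def)
  have p: "0 < p"
  proof (cases "\<theta> \<le> 0")
      case True
      then have "\<theta> * a \<le> 0" using a by (simp add: mult_nonpos_nonneg)
      then show ?thesis by (simp add: p_def)
    next
      case False
      then have "\<theta> * a \<le> \<theta>" using a by (simp add: mult_left_le)
      then show ?thesis using \<open>\<theta> < 1\<close> by (simp add: p_def)
  qed
  have \<tau>1: "1 + a * \<tau> = 1 / p"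
    using p by (simp add: \<tau>_def p_def field_simps)
  have \<tau>2: "(1 - a) * \<tau> \<le> 1"
    using p \<open>\<theta> < 1\<close> by (simp add: \<tau>_def p_def field_simps)
  have sgn: "0 \<le> \<theta> \<Longrightarrow> 0 \<le> \<tau>" "\<theta> \<le> 0 \<Longrightarrow> \<tau> \<le> 0"
    using p by (auto simp: \<tau>_def divide_nonpos_pos)
  have H': "quad_form I H' v = quad_form I H v + \<tau> * (\<Sum>i\<in>I. b i * v i)\<^sup>2" for v
    unfolding H'_def by (rule quad_form_rank_one)
  have IH: "(\<integral>\<^sup>+z. ennreal (exp (\<theta> / 2 * quad_form I H' z)) \<partial>std_normal_vec I)
       \<le> ennreal (exp (\<theta> * (\<Sum>i\<in>I. H' i i) / (2 * (1 - \<theta>))))"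
  proof (rule insert.IH)
    show "H' i j = H' j i" if "i \<in> I" "j \<in> I" for i j
      using that sym by (simp add: H'_def)
    fix v :: "'a \<Rightarrow> real"
    define \<beta> where "\<beta> = (\<Sum>i\<in>I. b i * v i)"
    have lo: "0 \<le> quad_form I H v + 2 * t * \<beta> + a * t\<^sup>2"
      and up: "quad_form I H v + 2 * t * \<beta> + a * t\<^sup>2 \<le> sq_norm I v + t\<^sup>2" for t
      using insert.prems(2)[of "v(x := t)"] insert.prems(3)[of "v(x := t)"]
      unfolding exp norm \<beta>_def by auto
    \<comment> \<open>At t = \<open>\<tau> * \<beta>\<close> the known inequality becomes the wanted
      one plus a term whose sign follows from that of \<open>\<theta>\<close>. This choice serves
      the lower bound for negative \<open>\<theta>\<close> and the upper bound for nonnegative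
      \<open>\<theta>\<close>; in the other cases t = 0 suffices.\<close>
    show "0 \<le> quad_form I H' v"
    proof (cases "0 \<le> \<theta>")
      case True
      then show ?thesis using lo[of 0] sgn(1) by (simp add: H' \<beta>_def)
    next
      case False
      have "0 \<le> quad_form I H v + \<tau> * \<beta>\<^sup>2 + \<tau> * (1 + a * \<tau>) * \<beta>\<^sup>2"
        using lo[of "\<tau> * \<beta>"] by (simp add: power2_eq_square algebra_simps)
      moreover have "\<tau> * (1 + a * \<tau>) * \<beta>\<^sup>2 \<le> 0"
        unfolding \<tau>1 using False sgn(2) p by (intro mult_nonpos_nonneg divide_nonpos_pos) auto
      ultimately show ?thesis by (simp add: H' \<beta>_def)
    qed
    show "quad_form I H' v \<le> sq_norm I v"
    proof (cases "0 \<le> \<theta>")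
      case True
      have "quad_form I H v + \<tau> * \<beta>\<^sup>2 + \<tau> * (1 - (1 - a) * \<tau>) * \<beta>\<^sup>2 \<le> sq_norm I v"
        using up[of "\<tau> * \<beta>"] by (simp add: power2_eq_square algebra_simps)
      moreover have "0 \<le> \<tau> * (1 - (1 - a) * \<tau>) * \<beta>\<^sup>2"
        using True sgn(1) \<tau>2 by simp
      ultimately show ?thesis by (simp add: H' \<beta>_def)
    next
      case False
      then have "\<tau> * \<beta>\<^sup>2 \<le> 0" using sgn(2) by (simp add: mult_nonpos_nonneg)
      then show ?thesis using up[of 0] by (simp add: H' \<beta>_def)
    qed
  qed
  have inner: "(\<integral>\<^sup>+t. ennreal (exp (\<theta> / 2 * quad_form (insert x I) H (z(x := t)))) \<partial>std_normal_distribution)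
      = ennreal (1 / sqrt p) * ennreal (exp (\<theta> / 2 * quad_form I H' z))" for z
  proof -
    define \<beta> where "\<beta> = (\<Sum>i\<in>I. b i * z i)"
    have "exp (\<theta> / 2 * quad_form (insert x I) H (z(x := t)))
        = exp (\<theta> / 2 * quad_form I H z) * exp (\<theta> * \<beta> * t + \<theta> * a * t\<^sup>2 / 2)" for t
      unfolding exp \<beta>_def by (simp add: exp_add[symmetric] algebra_simps)
    then have "(\<integral>\<^sup>+t. ennreal (exp (\<theta> / 2 * quad_form (insert x I) H (z(x := t)))) \<partial>std_normal_distribution)
        = ennreal (exp (\<theta> / 2 * quad_form I H z)) *
          (\<integral>\<^sup>+t. ennreal (exp (\<theta> * \<beta> * t + \<theta> * a * t\<^sup>2 / 2)) \<partial>std_normal_distribution)"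
      by (simp add: ennreal_mult nn_integral_cmult)
    also have "\<dots> = ennreal (exp (\<theta> / 2 * quad_form I H z) * (exp ((\<theta> * \<beta>)\<^sup>2 / (2 * p)) / sqrt p))"
      using p by (subst nn_integral_std_normal_exp_quadratic) (auto simp: p_def ennreal_mult[symmetric])
    also have "exp (\<theta> / 2 * quad_form I H z) * (exp ((\<theta> * \<beta>)\<^sup>2 / (2 * p)) / sqrt p)
        = 1 / sqrt p * exp (\<theta> / 2 * quad_form I H' z)"
      by (simp add: H' \<beta>_def[symmetric] \<tau>_def exp_add[symmetric] power2_eq_square algebra_simps)
    also have "ennreal \<dots> = ennreal (1 / sqrt p) * ennreal (exp (\<theta> / 2 * quad_form I H' z))"
      by (rule ennreal_mult) (use p in auto)
    finally show ?thesis .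
  qed
  have "(\<integral>\<^sup>+z. ennreal (exp (\<theta> / 2 * quad_form (insert x I) H z)) \<partial>std_normal_vec (insert x I))
      = (\<integral>\<^sup>+z. \<integral>\<^sup>+t. ennreal (exp (\<theta> / 2 * quad_form (insert x I) H (z(x := t))))
           \<partial>std_normal_distribution \<partial>std_normal_vec I)"
    by (rule product_nn_integral_insert[OF insert.hyps]) measurable
  also have "\<dots> = ennreal (1 / sqrt p) * (\<integral>\<^sup>+z. ennreal (exp (\<theta> / 2 * quad_form I H' z)) \<partial>std_normal_vec I)"
    unfolding inner by (rule nn_integral_cmult) measurable
  also have "\<dots> \<le> ennreal (1 / sqrt p) * ennreal (exp (\<theta> * (\<Sum>i\<in>I. H' i i) / (2 * (1 - \<theta>))))"
    by (rule mult_left_mono[OF IH]) simp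
  also have "\<dots> = ennreal (exp (- (ln p / 2) + \<theta> * (\<Sum>i\<in>I. H' i i) / (2 * (1 - \<theta>))))"
  proof -
    have "1 / sqrt p = exp (- (ln p / 2))"
      using p by (simp add: exp_minus ln_sqrt[symmetric] inverse_eq_divide)
    moreover have "ennreal (1 / sqrt p) * ennreal y = ennreal (1 / sqrt p * y)" if "0 \<le> y" for y
      using that p by (intro ennreal_mult[symmetric]) auto
    ultimately show ?thesis by (simp only: exp_add exp_ge_zero)
  qed
  also have "\<dots> \<le> ennreal (exp (\<theta> * (\<Sum>i\<in>insert x I. H i i) / (2 * (1 - \<theta>))))"
  proof (intro ennreal_leI, subst exp_le_cancel_iff)
    \<comment> \<open>Trace bookkeeping: the correction raises \<theta> times the trace by at most
      \<theta>^2 a (1 - a) / p, which is \<theta> a minus (1 - \<theta>) \<theta> a / p. This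
      deficit pays for the factor 1 / sqrt p through - ln p \<le> \<theta> a / p.\<close>
    have "(\<Sum>i\<in>I. H' i i) = (\<Sum>i\<in>I. H i i) + \<tau> * (\<Sum>i\<in>I. (b i)\<^sup>2)"
      by (simp add: H'_def sum.distrib sum_distrib_left power2_eq_square mult.assoc)
    then have "\<theta> * (\<Sum>i\<in>I. H' i i) = \<theta> * (\<Sum>i\<in>I. H i i) + \<theta>\<^sup>2 / p * (\<Sum>i\<in>I. (b i)\<^sup>2)"
      by (simp add: \<tau>_def power2_eq_square algebra_simps)
    also have "\<dots> \<le> \<theta> * (\<Sum>i\<in>I. H i i) + \<theta>\<^sup>2 / p * (a * (1 - a))"
      using col p by (intro add_left_mono mult_left_mono) auto
    also have "\<theta>\<^sup>2 / p * (a * (1 - a)) = \<theta> * a - (1 - \<theta>) * (\<theta> * a / p)"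
    proof -
      have "\<theta>\<^sup>2 * (a * (1 - a)) = \<theta> * a * p - (1 - \<theta>) * (\<theta> * a)"
        by (simp add: p_def power2_eq_square algebra_simps)
      then have "\<theta>\<^sup>2 * (a * (1 - a)) / p = (\<theta> * a * p - (1 - \<theta>) * (\<theta> * a)) / p"
        by simp
      then show ?thesis using p by (simp add: diff_divide_distrib)
    qed
    finally have "\<theta> * (\<Sum>i\<in>I. H' i i) \<le> \<theta> * (\<Sum>i\<in>insert x I. H i i) - (1 - \<theta>) * (\<theta> * a / p)"
      using insert.hyps by (simp add: a_def algebra_simps)
    then have "\<theta> * (\<Sum>i\<in>I. H' i i) / (1 - \<theta>)
        \<le> (\<theta> * (\<Sum>i\<in>insert x I. H i i) - (1 - \<theta>) * (\<theta> * a / p)) / (1 - \<theta>)"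
      using \<open>\<theta> < 1\<close> by (intro divide_right_mono) auto
    also have "\<dots> = \<theta> * (\<Sum>i\<in>insert x I. H i i) / (1 - \<theta>) - \<theta> * a / p"
      using \<open>\<theta> < 1\<close> by (simp add: diff_divide_distrib)
    finally have main: "\<theta> * (\<Sum>i\<in>I. H' i i) / (1 - \<theta>)
        \<le> \<theta> * (\<Sum>i\<in>insert x I. H i i) / (1 - \<theta>) - \<theta> * a / p" .
    have "- ln p \<le> \<theta> * a / p"
      using ln_le_minus_one[of "1 / p"] p \<tau>1 by (simp add: ln_div \<tau>_def mult_ac)
    moreover have "- (l / 2) + y / 2 \<le> z / 2" if "y \<le> z - c" "- l \<le> c" for l y z c :: real
      using that by simp
    moreover have "y / (2 * (1 - \<theta>)) = y / (1 - \<theta>) / 2" for y by simp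
    ultimately show "- (ln p / 2) + \<theta> * (\<Sum>i\<in>I. H' i i) / (2 * (1 - \<theta>))
        \<le> \<theta> * (\<Sum>i\<in>insert x I. H i i) / (2 * (1 - \<theta>))"
      using main by presburger
  qed
  finally show ?case .
qed

section \<open>Gaussian vectors, possibly degenerate, described by the laws of their linear
  forms\<close>

definition centered_gaussian ::
    "'a measure \<Rightarrow> 'i set \<Rightarrow> ('i \<Rightarrow> 'a \<Rightarrow> real) \<Rightarrow> ('i \<Rightarrow> 'i \<Rightarrow> real) \<Rightarrow> bool" where
  "centered_gaussian P I x C \<longleftrightarrow>
     (\<forall>i\<in>I. x i \<in> borel_measurable P) \<and>
     (\<forall>v. 0 \<le> quad_form I C v \<and>
          distr P borel (\<lambda>\<omega>. \<Sum>i\<in>I. v i * x i \<omega>)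
          = distr std_normal_distribution borel (\<lambda>z. sqrt (quad_form I C v) * z))"

lemma integral_std_normal_iexp:
  "(\<integral>z. exp (\<i> * of_real (a * z)) \<partial>std_normal_distribution) = of_real (exp (- a\<^sup>2 / 2))"
  using fun_cong[OF char_std_normal_distribution, of a] by (simp add: char_def)

lemma centered_gaussian_mgf:
  assumes "centered_gaussian P I x C"
  shows "(\<integral>\<^sup>+\<omega>. ennreal (exp (\<Sum>i\<in>I. v i * x i \<omega>)) \<partial>P) = ennreal (exp (quad_form I C v / 2))"
proof -
  have [measurable]: "\<And>i. i \<in> I \<Longrightarrow> x i \<in> borel_measurable P" and q: "0 \<le> quad_form I C v"
    and law: "distr P borel (\<lambda>\<omega>. \<Sum>i\<in>I. v i * x i \<omega>)
          = distr std_normal_distribution borel (\<lambda>z. sqrt (quad_form I C v) * z)"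
    using assms by (auto simp: centered_gaussian_def)
  have "(\<integral>\<^sup>+\<omega>. ennreal (exp (\<Sum>i\<in>I. v i * x i \<omega>)) \<partial>P)
      = (\<integral>\<^sup>+y. ennreal (exp y) \<partial>distr P borel (\<lambda>\<omega>. \<Sum>i\<in>I. v i * x i \<omega>))"
    by (subst nn_integral_distr) auto
  also have "\<dots> = (\<integral>\<^sup>+z. ennreal (exp (sqrt (quad_form I C v) * z + 0 * z\<^sup>2 / 2)) \<partial>std_normal_distribution)"
    unfolding law by (subst nn_integral_distr) auto
  also have "\<dots> = ennreal (exp (quad_form I C v / 2))"
    using q by (subst nn_integral_std_normal_exp_quadratic) auto
  finally show ?thesis .
qed

lemma centered_gaussian_char:
  assumes "centered_gaussian P I x C"
  shows "(\<integral>\<omega>. exp (\<i> * of_real (\<Sum>i\<in>I. v i * x i \<omega>)) \<partial>P) = of_real (exp (- quad_form I C v / 2))"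
proof -
  have [measurable]: "\<And>i. i \<in> I \<Longrightarrow> x i \<in> borel_measurable P" and q: "0 \<le> quad_form I C v"
    and law: "distr P borel (\<lambda>\<omega>. \<Sum>i\<in>I. v i * x i \<omega>)
          = distr std_normal_distribution borel (\<lambda>z. sqrt (quad_form I C v) * z)"
    using assms by (auto simp: centered_gaussian_def)
  have "(\<integral>\<omega>. exp (\<i> * of_real (\<Sum>i\<in>I. v i * x i \<omega>)) \<partial>P)
      = (\<integral>y. exp (\<i> * of_real y) \<partial>distr P borel (\<lambda>\<omega>. \<Sum>i\<in>I. v i * x i \<omega>))"
    by (subst integral_distr) auto
  also have "\<dots> = (\<integral>z. exp (\<i> * of_real (sqrt (quad_form I C v) * z)) \<partial>std_normal_distribution)"
    unfolding law by (subst integral_distr) auto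
  also have "\<dots> = of_real (exp (- quad_form I C v / 2))"
    unfolding integral_std_normal_iexp using q by simp
  finally show ?thesis .
qed

lemma prob_space_std_normal_vec: "prob_space (std_normal_vec I)"
  by (intro prob_space_PiM prob_space_normal_density) simp

lemma std_normal_vec_mgf:
  assumes "finite J"
  shows "(\<integral>\<^sup>+z. ennreal (exp (\<Sum>k\<in>J. a k * z k)) \<partial>std_normal_vec J) = ennreal (exp (sq_norm J a / 2))"
proof -
  interpret product_sigma_finite "\<lambda>_. std_normal_distribution"
    by (rule product_sigma_finite_std_normal)
  have "(\<integral>\<^sup>+z. ennreal (exp (\<Sum>k\<in>J. a k * z k)) \<partial>std_normal_vec J)
      = (\<integral>\<^sup>+z. (\<Prod>k\<in>J. ennreal (exp (a k * z k))) \<partial>std_normal_vec J)"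
    by (simp add: exp_sum[OF assms] prod_ennreal)
  also have "\<dots> = (\<Prod>k\<in>J. \<integral>\<^sup>+t. ennreal (exp (a k * t)) \<partial>std_normal_distribution)"
    by (rule product_nn_integral_prod[OF assms]) measurable
  also have "\<dots> = (\<Prod>k\<in>J. ennreal (exp ((a k)\<^sup>2 / 2)))"
    using nn_integral_std_normal_exp_quadratic[of 0] by simp
  also have "\<dots> = ennreal (exp (sq_norm J a / 2))"
    by (simp add: prod_ennreal exp_sum[OF assms, symmetric] sq_norm_def sum_divide_distrib)
  finally show ?thesis .
qed

lemma std_normal_vec_char:
  assumes "finite J"
  shows "(\<integral>z. exp (\<i> * of_real (\<Sum>k\<in>J. a k * z k)) \<partial>std_normal_vec J) = of_real (exp (- sq_norm J a / 2))"
proof -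
  interpret product_sigma_finite "\<lambda>_. std_normal_distribution"
    by (rule product_sigma_finite_std_normal)
  interpret N: prob_space std_normal_distribution by (rule prob_space_normal_density) simp
  have "(\<integral>z. exp (\<i> * of_real (\<Sum>k\<in>J. a k * z k)) \<partial>std_normal_vec J)
      = (\<integral>z. (\<Prod>k\<in>J. exp (\<i> * of_real (a k * z k))) \<partial>std_normal_vec J)"
    by (simp add: exp_sum[OF assms] sum_distrib_left)
  also have "\<dots> = (\<Prod>k\<in>J. \<integral>t. exp (\<i> * of_real (a k * t)) \<partial>std_normal_distribution)"
    by (rule product_integral_prod[OF assms])
       (rule N.integrable_const_bound[where B=1], auto)
  also have "\<dots> = of_real (exp (- sq_norm J a / 2))"
    unfolding integral_std_normal_iexp
    by (simp add: exp_sum[OF assms, symmetric] sq_norm_def sum_divide_distrib sum_negf[symmetric]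
          flip: of_real_prod)
  finally show ?thesis .
qed

text \<open>Only one-dimensional marginals of \<open>x\<close> are known, so its joint law cannot be diagonalized
  directly. Writing \<open>exp (c * y\<^sup>2)\<close> as a Gaussian average of exponentials of linear functions of
  \<open>y\<close> (Hubbard-Stratonovich) and exchanging the two averages transfers the problem to
  independent standard normals.\<close>

lemma centered_gaussian_chaos:
  assumes "prob_space P" and x: "centered_gaussian P I x C" and fin: "finite I" "finite J"
  shows "(\<integral>\<^sup>+\<omega>. ennreal (exp (c * (\<Sum>k\<in>J. (\<Sum>i\<in>I. K k i * x i \<omega>)\<^sup>2))) \<partial>P)
       = (\<integral>\<^sup>+z. ennreal (exp (c * quad_form I C (\<lambda>i. \<Sum>k\<in>J. K k i * z k))) \<partial>std_normal_vec J)"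
proof -
  interpret P: prob_space P by fact
  interpret N: prob_space "std_normal_vec J" by (rule prob_space_std_normal_vec)
  interpret PN: pair_prob_space P "std_normal_vec J" ..
  interpret NP: pair_prob_space "std_normal_vec J" P ..
  have xm [measurable]: "\<And>i. i \<in> I \<Longrightarrow> x i \<in> borel_measurable P" and q: "\<And>v. 0 \<le> quad_form I C v"
    using x by (auto simp: centered_gaussian_def)
  \<comment> \<open>Chosen so that averaging exp (s y z) over a standard normal z gives exp (|c|
    y^2).\<close>
  define s where "s = sqrt (2 * \<bar>c\<bar>)"
  have s2: "s\<^sup>2 = 2 * \<bar>c\<bar>" by (simp add: s_def)
  define y where "y k \<omega> = (\<Sum>i\<in>I. K k i * x i \<omega>)" for k \<omega>
  define w where "w z i = s * (\<Sum>k\<in>J. K k i * z k)" for z i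
  have [measurable]: "y k \<in> borel_measurable P" for k
    unfolding y_def by measurable
  have swap: "(\<Sum>k\<in>J. s * y k \<omega> * z k) = (\<Sum>i\<in>I. w z i * x i \<omega>)" for z \<omega>
  proof -
    have "(\<Sum>k\<in>J. s * y k \<omega> * z k) = (\<Sum>k\<in>J. \<Sum>i\<in>I. s * K k i * x i \<omega> * z k)"
      by (simp add: y_def sum_distrib_left sum_distrib_right mult_ac)
    also have "\<dots> = (\<Sum>i\<in>I. \<Sum>k\<in>J. s * K k i * x i \<omega> * z k)" by (rule sum.swap)
    also have "\<dots> = (\<Sum>i\<in>I. w z i * x i \<omega>)"
      by (simp add: w_def sum_distrib_left sum_distrib_right mult_ac)
    finally show ?thesis .
  qed
  have yq: "sq_norm J (\<lambda>k. s * y k \<omega>) / 2 = \<bar>c\<bar> * (\<Sum>k\<in>J. (y k \<omega>)\<^sup>2)" for \<omega>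
    by (simp add: sq_norm_def power_mult_distrib s2 sum_distrib_left[symmetric])
  have wq: "quad_form I C (w z) / 2 = \<bar>c\<bar> * quad_form I C (\<lambda>i. \<Sum>k\<in>J. K k i * z k)" for z
  proof -
    have "quad_form I C (w z) = s\<^sup>2 * quad_form I C (\<lambda>i. \<Sum>k\<in>J. K k i * z k)"
      unfolding quad_form_def w_def sum_distrib_left[of "s\<^sup>2"]
      by (intro sum.cong refl) (simp only: power2_eq_square mult_ac)
    then show ?thesis by (simp add: s2)
  qed
  have qm [measurable]: "(\<lambda>z. quad_form I C (\<lambda>i. \<Sum>k\<in>J. K k i * z k)) \<in> borel_measurable (std_normal_vec J)"
    unfolding quad_form_def by measurable
  show ?thesis
  proof (cases "0 \<le> c")
    case True
    have "(\<integral>\<^sup>+\<omega>. ennreal (exp (c * (\<Sum>k\<in>J. (y k \<omega>)\<^sup>2))) \<partial>P)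
        = (\<integral>\<^sup>+\<omega>. \<integral>\<^sup>+z. ennreal (exp (\<Sum>k\<in>J. s * y k \<omega> * z k)) \<partial>std_normal_vec J \<partial>P)"
      unfolding std_normal_vec_mgf[OF fin(2)] yq using True by simp
    also have "\<dots> = (\<integral>\<^sup>+z. \<integral>\<^sup>+\<omega>. ennreal (exp (\<Sum>k\<in>J. s * y k \<omega> * z k)) \<partial>P \<partial>std_normal_vec J)"
      by (rule NP.Fubini') measurable
    also have "\<dots> = (\<integral>\<^sup>+z. ennreal (exp (c * quad_form I C (\<lambda>i. \<Sum>k\<in>J. K k i * z k))) \<partial>std_normal_vec J)"
      unfolding swap centered_gaussian_mgf[OF x] wq using True by simp
    finally show ?thesis by (simp add: y_def)
  next
    case False
    \<comment> \<open>For negative \<open>c\<close> the imaginary exponentials exp (i s y z) average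
      to exp (- |c| y^2), so characteristic functions replace moment generating functions. The
      integrands are complex but bounded, which justifies the exchange.\<close>
    then have c: "c = - \<bar>c\<bar>" by simp
    let ?F = "\<lambda>\<omega> z. exp (\<i> * complex_of_real (\<Sum>k\<in>J. s * y k \<omega> * z k))"
    have "complex_of_real (\<integral>\<omega>. exp (- (\<bar>c\<bar> * (\<Sum>k\<in>J. (y k \<omega>)\<^sup>2))) \<partial>P)
        = (\<integral>\<omega>. \<integral>z. ?F \<omega> z \<partial>std_normal_vec J \<partial>P)"
      unfolding std_normal_vec_char[OF fin(2)] minus_divide_left[symmetric] yq by simp
    also have "\<dots> = (\<integral>z. \<integral>\<omega>. ?F \<omega> z \<partial>P \<partial>std_normal_vec J)"
    proof (rule PN.Fubini_integral[symmetric])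
      show "integrable (P \<Otimes>\<^sub>M std_normal_vec J) (\<lambda>(\<omega>, z). ?F \<omega> z)"
        by (rule PN.integrable_const_bound[where B=1]) auto
    qed
    also have "\<dots> = complex_of_real (\<integral>z. exp (- (\<bar>c\<bar> * quad_form I C (\<lambda>i. \<Sum>k\<in>J. K k i * z k))) \<partial>std_normal_vec J)"
      unfolding swap centered_gaussian_char[OF x] minus_divide_left[symmetric] wq by simp
    finally have eq: "(\<integral>\<omega>. exp (- (\<bar>c\<bar> * (\<Sum>k\<in>J. (y k \<omega>)\<^sup>2))) \<partial>P)
        = (\<integral>z. exp (- (\<bar>c\<bar> * quad_form I C (\<lambda>i. \<Sum>k\<in>J. K k i * z k))) \<partial>std_normal_vec J)"
      by (simp only: of_real_eq_iff)
    have "(\<integral>\<^sup>+\<omega>. ennreal (exp (- (\<bar>c\<bar> * (\<Sum>k\<in>J. (y k \<omega>)\<^sup>2)))) \<partial>P)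
        = ennreal (\<integral>\<omega>. exp (- (\<bar>c\<bar> * (\<Sum>k\<in>J. (y k \<omega>)\<^sup>2))) \<partial>P)"
      by (intro nn_integral_eq_integral P.integrable_const_bound[where B=1]) (auto intro!: mult_nonneg_nonneg sum_nonneg)
    moreover have "(\<integral>\<^sup>+z. ennreal (exp (- (\<bar>c\<bar> * quad_form I C (\<lambda>i. \<Sum>k\<in>J. K k i * z k)))) \<partial>std_normal_vec J)
        = ennreal (\<integral>z. exp (- (\<bar>c\<bar> * quad_form I C (\<lambda>i. \<Sum>k\<in>J. K k i * z k))) \<partial>std_normal_vec J)"
      by (intro nn_integral_eq_integral N.integrable_const_bound[where B=1]) (auto intro!: mult_nonneg_nonneg q)
    ultimately show ?thesis
      unfolding y_def[symmetric] by (subst (1 2) c) (simp add: eq)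
  qed
qed

text \<open>With G = K^T K the form is |K x|^2, and the exchange of averages replaces it by the form
  of K C K^T in independent normals. Divided by A B this matrix is \<open>H\<close>: it lies between
  0 and the identity, and its trace is that of G C / (A B).\<close>

lemma centered_gaussian_quad_form_exp_le:
  assumes "prob_space P" and x: "centered_gaussian P I x C" and fin: "finite I"
    and G: "\<And>i j. i \<in> I \<Longrightarrow> j \<in> I \<Longrightarrow> G i j = G j i" "\<And>v. 0 \<le> quad_form I G v"
      "\<And>v. quad_form I G v \<le> A * sq_norm I v"
    and C: "\<And>i j. i \<in> I \<Longrightarrow> j \<in> I \<Longrightarrow> C i j = C j i" "\<And>v. quad_form I C v \<le> B * sq_norm I v"
    and pos: "0 < A" "0 < B" and "\<theta> < 1"
  shows "(\<integral>\<^sup>+\<omega>. ennreal (exp (\<theta> / (2 * (A * B)) * quad_form I G (\<lambda>i. x i \<omega>))) \<partial>P)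
       \<le> ennreal (exp (\<theta> / (2 * (A * B)) * (\<Sum>i\<in>I. \<Sum>j\<in>I. G i j * C i j) / (1 - \<theta>)))"
proof -
  obtain K where K: "\<And>i j. i \<in> I \<Longrightarrow> j \<in> I \<Longrightarrow> G i j = (\<Sum>k\<in>I. K k i * K k j)"
    using psd_gram[of I G, OF fin G(1,2)] by blast
  have GK: "quad_form I G v = (\<Sum>k\<in>I. (\<Sum>i\<in>I. K k i * v i)\<^sup>2)" for v
    unfolding quad_form_gram[symmetric] by (rule quad_form_cong) (simp_all add: K)
  define H where "H k l = (\<Sum>i\<in>I. \<Sum>j\<in>I. K k i * C i j * K l j) / (A * B)" for k l
  have HAB: "H k l * (A * B) = (\<Sum>i\<in>I. \<Sum>j\<in>I. K k i * C i j * K l j)" for k l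
    using pos by (simp add: H_def)
  have Hq: "quad_form I H z = quad_form I C (\<lambda>i. \<Sum>k\<in>I. K k i * z k) / (A * B)" for z
  proof -
    have "quad_form I C (\<lambda>i. \<Sum>k\<in>I. K k i * z k)
        = (\<Sum>i\<in>I. \<Sum>j\<in>I. \<Sum>k\<in>I. \<Sum>l\<in>I. K k i * C i j * K l j * z k * z l)"
      by (simp add: quad_form_def sum_product sum_distrib_left mult_ac)
    also have "\<dots> = (\<Sum>i\<in>I. \<Sum>k\<in>I. \<Sum>l\<in>I. \<Sum>j\<in>I. K k i * C i j * K l j * z k * z l)"
      by (rule sum.cong[OF refl], rule trans[OF sum.swap], rule sum.cong[OF refl], rule sum.swap)
    also have "\<dots> = (\<Sum>k\<in>I. \<Sum>l\<in>I. \<Sum>i\<in>I. \<Sum>j\<in>I. K k i * C i j * K l j * z k * z l)"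
      by (rule trans[OF sum.swap], rule sum.cong[OF refl], rule sum.swap)
    also have "\<dots> = (\<Sum>k\<in>I. \<Sum>l\<in>I. H k l * (A * B) * z k * z l)"
      unfolding HAB by (simp only: sum_distrib_right)
    also have "\<dots> = A * B * quad_form I H z"
      by (simp add: quad_form_def sum_distrib_left mult_ac)
    finally show ?thesis using pos by simp
  qed
  have trace: "(\<Sum>k\<in>I. H k k) = (\<Sum>i\<in>I. \<Sum>j\<in>I. G i j * C i j) / (A * B)"
  proof -
    have "(\<Sum>i\<in>I. \<Sum>j\<in>I. G i j * C i j) = (\<Sum>i\<in>I. \<Sum>j\<in>I. \<Sum>k\<in>I. K k i * C i j * K k j)"
      by (intro sum.cong refl) (simp add: K sum_distrib_left sum_distrib_right mult_ac)
    also have "\<dots> = (\<Sum>i\<in>I. \<Sum>k\<in>I. \<Sum>j\<in>I. K k i * C i j * K k j)"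
      by (rule sum.cong[OF refl], rule sum.swap)
    also have "\<dots> = (\<Sum>k\<in>I. \<Sum>i\<in>I. \<Sum>j\<in>I. K k i * C i j * K k j)"
      by (rule sum.swap)
    finally show ?thesis by (simp add: H_def sum_divide_distrib)
  qed
  have "(\<integral>\<^sup>+\<omega>. ennreal (exp (\<theta> / (2 * (A * B)) * quad_form I G (\<lambda>i. x i \<omega>))) \<partial>P)
      = (\<integral>\<^sup>+z. ennreal (exp (\<theta> / (2 * (A * B)) * quad_form I C (\<lambda>i. \<Sum>k\<in>I. K k i * z k))) \<partial>std_normal_vec I)"
    unfolding GK by (rule centered_gaussian_chaos[OF assms(1) x fin fin])
  also have "\<dots> = (\<integral>\<^sup>+z. ennreal (exp (\<theta> / 2 * quad_form I H z)) \<partial>std_normal_vec I)"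
    unfolding Hq by simp
  also have "\<dots> \<le> ennreal (exp (\<theta> * (\<Sum>i\<in>I. H i i) / (2 * (1 - \<theta>))))"
  proof (rule nn_integral_gaussian_chaos_le[OF fin \<open>\<theta> < 1\<close>])
    show "H k l = H l k" for k l
      unfolding H_def by (subst sum.swap) (auto intro!: sum.cong arg_cong2[where f="(/)"] simp: C(1))
    show "0 \<le> quad_form I H v" for v
      using x pos by (auto simp: Hq centered_gaussian_def)
    show "quad_form I H v \<le> sq_norm I v" for v
    proof -
      have "quad_form I C (\<lambda>i. \<Sum>k\<in>I. K k i * v k) \<le> B * sq_norm I (\<lambda>i. \<Sum>k\<in>I. K k i * v k)"
        by (rule C(2))
      also have "\<dots> \<le> B * (A * sq_norm I v)"
        using pos G(3) by (intro mult_left_mono gram_transpose_bound fin) (auto simp: GK)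
      finally show ?thesis using pos by (simp add: Hq pos_divide_le_eq mult_ac)
    qed
  qed
  also have "\<theta> * (\<Sum>i\<in>I. H i i) / (2 * (1 - \<theta>))
      = \<theta> / (2 * (A * B)) * (\<Sum>i\<in>I. \<Sum>j\<in>I. G i j * C i j) / (1 - \<theta>)"
    unfolding trace by simp
  finally show ?thesis .
qed

section \<open>Toeplitz forms\<close>

definition iexp2pi :: "int \<Rightarrow> real \<Rightarrow> complex" where
  "iexp2pi m f = exp (\<i> * of_real (2 * pi * f * of_int m))"

lemma norm_iexp2pi [simp]: "cmod (iexp2pi m f) = 1"
  by (simp add: iexp2pi_def)

lemma iexp2pi_measurable [measurable]: "iexp2pi m \<in> borel_measurable borel"
  unfolding iexp2pi_def by measurable

lemma iexp2pi_add: "iexp2pi (m + k) f = iexp2pi m f * iexp2pi k f"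
  by (simp add: iexp2pi_def exp_add[symmetric] ring_distribs)

lemma iexp2pi_0 [simp]: "iexp2pi 0 f = 1"
  by (simp add: iexp2pi_def)

lemma cnj_iexp2pi: "cnj (iexp2pi m f) = iexp2pi (- m) f"
  by (simp add: iexp2pi_def exp_cnj)

lemma iexp2pi_eq_cis: "iexp2pi m f = cis (2 * pi * f * of_int m)"
  by (simp add: iexp2pi_def cis_conv_exp)

lemma set_integrable_const_unit: "set_integrable lborel {0..<1::real} (\<lambda>_. b :: real)"
proof -
  have "integrable lborel (indicat_real {0..<1::real})"
    by (rule integrable_real_indicator) auto
  then show ?thesis by (simp add: set_integrable_def)
qed

lemma set_integral_const_unit: "(LBINT f:{0..<1::real}. b) = (b :: real)"
  by (simp add: set_lebesgue_integral_def)

lemma set_integrable_times_bounded: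
  fixes S :: "real \<Rightarrow> real" and h :: "real \<Rightarrow> complex"
  assumes S: "set_integrable lborel X S" and [measurable]: "h \<in> borel_measurable borel"
    and b: "\<And>f. cmod (h f) \<le> b"
  shows "set_integrable lborel X (\<lambda>f. of_real (S f) * h f)"
proof -
  have "0 \<le> b" using norm_ge_zero b by (rule order_trans)
  have [measurable]: "(\<lambda>f. indicator X f * S f) \<in> borel_measurable lborel"
    using S by (auto simp: set_integrable_def dest: borel_measurable_integrable)
  have eq: "indicator X f *\<^sub>R (of_real (S f) * h f) = of_real (indicator X f * S f) * h f" for f
    by (simp add: indicator_def)
  have "integrable lborel (\<lambda>f. b * (indicator X f * S f))"
    using S by (simp add: set_integrable_def)
  then show ?thesis
    unfolding set_integrable_def eq
  proof (rule Bochner_Integration.integrable_bound)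
    show "(\<lambda>f. of_real (indicator X f * S f) * h f) \<in> borel_measurable lborel" by measurable
    show "AE f in lborel. cmod (of_real (indicator X f * S f) * h f) \<le> norm (b * (indicator X f * S f))"
      using b \<open>0 \<le> b\<close> by (auto simp: norm_mult indicator_def abs_mult mult.commute mult_right_mono)
  qed
qed

text \<open>Inserting the integral formula for the coefficients turns the Toeplitz form into an
  average of a squared trigonometric polynomial with weight \<open>S\<close>, so that bounds on
  \<open>S\<close> become bounds on the form.\<close>

lemma toeplitz_form:
  assumes c: "has_dtft c S" and fin: "finite (I :: nat set)"
  shows "(\<Sum>n\<in>I. \<Sum>k\<in>I. of_real (c (int n - int k)) * (v n * cnj (v k)))
       = complex_of_real (LBINT f:{0..<1}. S f * (cmod (\<Sum>n\<in>I. v n * iexp2pi (int n) f))\<^sup>2)"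
proof -
  let ?X = "{0..<1::real}"
  have int: "set_integrable lborel ?X (\<lambda>f. of_real (S f) * iexp2pi m f)" for m
    using c by (intro set_integrable_times_bounded[where b=1]) (auto simp: has_dtft_def)
  have coef: "of_real (c m) = (LBINT f:?X. of_real (S f) * iexp2pi m f)" for m
    using c by (simp add: has_dtft_def iexp2pi_def)
  have sq: "(\<Sum>n\<in>I. \<Sum>k\<in>I. of_real (S f) * iexp2pi (int n - int k) f * (v n * cnj (v k)))
      = of_real (S f * (cmod (\<Sum>n\<in>I. v n * iexp2pi (int n) f))\<^sup>2)" for f
  proof -
    have "complex_of_real ((cmod (\<Sum>n\<in>I. v n * iexp2pi (int n) f))\<^sup>2)
        = (\<Sum>n\<in>I. v n * iexp2pi (int n) f) * (\<Sum>k\<in>I. cnj (v k) * iexp2pi (- int k) f)"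
      by (simp only: complex_norm_square cnj_sum complex_cnj_mult cnj_iexp2pi)
    also have "\<dots> = (\<Sum>n\<in>I. \<Sum>k\<in>I. iexp2pi (int n - int k) f * (v n * cnj (v k)))"
      by (simp add: sum_product mult_ac iexp2pi_add[symmetric])
    finally show ?thesis by (simp add: sum_distrib_left mult_ac)
  qed
  have "(\<Sum>n\<in>I. \<Sum>k\<in>I. of_real (c (int n - int k)) * (v n * cnj (v k)))
      = (\<Sum>n\<in>I. \<Sum>k\<in>I. LBINT f:?X. of_real (S f) * iexp2pi (int n - int k) f * (v n * cnj (v k)))"
    by (simp add: coef)
  also have "\<dots> = (LBINT f:?X. \<Sum>n\<in>I. \<Sum>k\<in>I. of_real (S f) * iexp2pi (int n - int k) f * (v n * cnj (v k)))"
    using int unfolding set_lebesgue_integral_def set_integrable_def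
    by (simp add: scaleR_sum_right Bochner_Integration.integral_sum integrable_mult_left
          Bochner_Integration.integrable_sum flip: mult_scaleR_left)
  also have "\<dots> = complex_of_real (LBINT f:?X. S f * (cmod (\<Sum>n\<in>I. v n * iexp2pi (int n) f))\<^sup>2)"
    unfolding sq by (rule set_integral_complex_of_real)
  finally show ?thesis .
qed

lemma has_dtft_delta: "has_dtft (\<lambda>m. if m = 0 then 1 else 0) (\<lambda>_. 1)"
  using LBINT_exp_2pi by (auto simp: has_dtft_def set_integrable_def)

text \<open>A discrete-time modulation by \<open>\<phi>\<close> only shifts the argument of \<open>S\<close>, so the bounds on \<open>S\<close> carry
  over to the modulated Toeplitz form.\<close>

lemma modulated_toeplitz_form:
  assumes c: "has_dtft c S" and fin: "finite I"
  shows "quad_form I (\<lambda>n k. c (int n - int k) * cos (2 * pi * \<phi> * (real n - real k))) w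
       = (LBINT f:{0..<1}. S f * (cmod (\<Sum>n\<in>I. of_real (w n) * iexp2pi (int n) \<phi> * iexp2pi (int n) f))\<^sup>2)"
proof -
  have "Re (of_real a * (of_real (w n) * iexp2pi (int n) \<phi> * cnj (of_real (w k) * iexp2pi (int k) \<phi>)))
      = a * cos (2 * pi * \<phi> * (real n - real k)) * w n * w k" for a n k
  proof -
    have "of_real a * (of_real (w n) * iexp2pi (int n) \<phi> * cnj (of_real (w k) * iexp2pi (int k) \<phi>))
        = of_real (a * w n * w k) * (iexp2pi (int n) \<phi> * iexp2pi (- int k) \<phi>)"
      by (simp add: cnj_iexp2pi)
    also have "\<dots> = of_real (a * w n * w k) * iexp2pi (int n - int k) \<phi>"
      using iexp2pi_add[of "int n" "- int k" \<phi>] by simp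
    also have "Re \<dots> = a * w n * w k * cos (2 * pi * \<phi> * (real n - real k))"
      by (simp add: iexp2pi_eq_cis)
    finally show ?thesis by (simp only: mult_ac)
  qed
  then show ?thesis
    using arg_cong[OF toeplitz_form[OF c fin, of "\<lambda>n. of_real (w n) * iexp2pi (int n) \<phi>"], of Re]
    by (simp only: quad_form_def Re_sum complex.sel Re_complex_of_real)
qed

text \<open>This is the Toeplitz identity for the unit impulse, whose transform is constantly 1:
  only the diagonal survives, where the modulating cosine is 1.\<close>

lemma parseval_trig_poly:
  assumes fin: "finite I"
  shows "(LBINT f:{0..<1}. (cmod (\<Sum>n\<in>I. of_real (w n) * iexp2pi (int n) \<phi> * iexp2pi (int n) f))\<^sup>2) = sq_norm I w"
proof -
  have "quad_form I (\<lambda>n k. (if int n - int k = 0 then 1 else 0) * cos (2 * pi * \<phi> * (real n - real k))) w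
      = (\<Sum>n\<in>I. \<Sum>k\<in>I. if k = n then (w n)\<^sup>2 else 0)"
    unfolding quad_form_def by (intro sum.cong refl) (auto simp: power2_eq_square)
  also have "\<dots> = sq_norm I w" using fin by (simp add: sq_norm_def)
  finally show ?thesis using modulated_toeplitz_form[OF has_dtft_delta fin, of \<phi> w] by simp
qed

text \<open>The upper bound compares \<open>S\<close> with the constant \<open>b\<close>, whose form
  is \<open>b\<close> times the squared norm by Parseval's identity.\<close>

lemma modulated_toeplitz_bounds:
  assumes c: "has_dtft c S" and fin: "finite I"
  shows "(\<And>f. f \<in> {0..<1} \<Longrightarrow> S f \<le> b) \<Longrightarrow>
      quad_form I (\<lambda>n k. c (int n - int k) * cos (2 * pi * \<phi> * (real n - real k))) w \<le> b * sq_norm I w"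
    and "(\<And>f. f \<in> {0..<1} \<Longrightarrow> 0 \<le> S f) \<Longrightarrow>
      0 \<le> quad_form I (\<lambda>n k. c (int n - int k) * cos (2 * pi * \<phi> * (real n - real k))) w"
proof -
  let ?p = "\<lambda>f. (cmod (\<Sum>n\<in>I. of_real (w n) * iexp2pi (int n) \<phi> * iexp2pi (int n) f))\<^sup>2"
  have bnd: "?p f \<le> (\<Sum>n\<in>I. \<bar>w n\<bar>)\<^sup>2" for f
    by (intro power_mono order_trans[OF norm_sum] sum_mono) (auto simp: norm_mult)
  have int: "set_integrable lborel {0..<1} (\<lambda>f. s f * ?p f)" if s: "set_integrable lborel {0..<1} s" for s
  proof -
    have "set_integrable lborel {0..<1} (\<lambda>f. complex_of_real (s f) * of_real (?p f))"
      using bnd by (intro set_integrable_times_bounded[OF s, where b="(\<Sum>n\<in>I. \<bar>w n\<bar>)\<^sup>2"])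
        (auto simp del: of_real_power)
    then have "set_integrable lborel {0..<1} (\<lambda>f. complex_of_real (s f * ?p f))" by simp
    from integrable_Re[OF this[unfolded set_integrable_def]] show ?thesis
      by (simp add: set_integrable_def del: of_real_mult of_real_power)
  qed
  have S: "set_integrable lborel {0..<1} S" using c by (simp add: has_dtft_def)
  have one: "set_integrable lborel {0..<1::real} (\<lambda>_. b)"
    by (rule set_integrable_const_unit)
  show "quad_form I (\<lambda>n k. c (int n - int k) * cos (2 * pi * \<phi> * (real n - real k))) w \<le> b * sq_norm I w"
    if "\<And>f. f \<in> {0..<1} \<Longrightarrow> S f \<le> b"
  proof -
    have "(LBINT f:{0..<1}. S f * ?p f) \<le> (LBINT f:{0..<1}. b * ?p f)"
      by (rule set_integral_mono[OF int[OF S] int[OF one]]) (use that in \<open>auto intro!: mult_right_mono\<close>)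
    then show ?thesis by (simp add: modulated_toeplitz_form[OF c fin] parseval_trig_poly[OF fin])
  qed
  show "0 \<le> quad_form I (\<lambda>n k. c (int n - int k) * cos (2 * pi * \<phi> * (real n - real k))) w"
    if "\<And>f. f \<in> {0..<1} \<Longrightarrow> 0 \<le> S f"
    unfolding modulated_toeplitz_form[OF c fin] set_lebesgue_integral_def
    by (intro integral_nonneg_AE) (use that in \<open>auto simp: indicator_def\<close>)
qed

section \<open>Uniqueness of Fourier coefficients\<close>

text \<open>Models the difference of two transforms of one sequence; the aim is that such a
  \<open>D\<close> vanishes almost everywhere on the unit interval.\<close>

definition trivial_dtft :: "(real \<Rightarrow> real) \<Rightarrow> bool" where
  "trivial_dtft D \<longleftrightarrow> set_integrable lborel {0..<1} D \<and>
     (\<forall>m. (LBINT f:{0..<1}. of_real (D f) * iexp2pi m f) = 0)"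

lemma set_integrable_times_bounded_real:
  fixes D h :: "real \<Rightarrow> real"
  assumes D: "set_integrable lborel X D" and [measurable]: "h \<in> borel_measurable borel"
    and b: "\<And>f. \<bar>h f\<bar> \<le> b"
  shows "set_integrable lborel X (\<lambda>f. D f * h f)"
proof -
  have "set_integrable lborel X (\<lambda>f. of_real (D f) * complex_of_real (h f))"
    using D b by (intro set_integrable_times_bounded) auto
  from integrable_Re[OF this[unfolded set_integrable_def]] show ?thesis
    by (simp add: set_integrable_def)
qed

text \<open>Multiplication by \<open>cos\<close> or \<open>sin\<close> shifts the coefficients by \<open>\<plusminus>1\<close>; being stated for every
  \<open>D\<close> makes the claim stable under products of polynomials.\<close>

lemma trivial_dtft_polynomial:
  assumes "real_polynomial_function p" "trivial_dtft D"
  shows "trivial_dtft (\<lambda>f. D f * p (iexp2pi 1 f))"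
  using assms
proof (induction arbitrary: D rule: real_polynomial_function.induct)
  case (linear h D)
  interpret h: bounded_linear h by fact
  have hz: "h z = Re z * h 1 + Im z * h \<i>" for z
  proof -
    have "h z = h (Re z *\<^sub>R 1 + Im z *\<^sub>R \<i>)"
      by (rule arg_cong[where f=h]) (simp add: complex_eq_iff)
    then show ?thesis by (simp only: h.add h.scaleR real_scaleR_def)
  qed
  have int: "set_integrable lborel {0..<1} D" using linear.prems by (simp add: trivial_dtft_def)
  have intm: "set_integrable lborel {0..<1} (\<lambda>f. of_real (D f) * iexp2pi m f)" for m
    using int by (intro set_integrable_times_bounded[where b=1]) auto
  have "set_integrable lborel {0..<1} (\<lambda>f. D f * h (iexp2pi 1 f))"
  proof (rule set_integrable_times_bounded_real[OF int])
    show "(\<lambda>f. h (iexp2pi 1 f)) \<in> borel_measurable borel"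
    proof -
      have [measurable]: "h \<in> borel_measurable borel"
        by (intro borel_measurable_continuous_onI linear_continuous_on linear.hyps)
      show ?thesis by measurable
    qed
    fix f
    have "\<bar>h (iexp2pi 1 f)\<bar> \<le> norm (iexp2pi 1 f) * onorm h"
      using onorm[OF linear.hyps, of "iexp2pi 1 f"] by (simp add: mult.commute)
    then show "\<bar>h (iexp2pi 1 f)\<bar> \<le> onorm h" by simp
  qed
  moreover have "(LBINT f:{0..<1}. of_real (D f * h (iexp2pi 1 f)) * iexp2pi m f) = 0" for m
  proof -
    \<comment> \<open>Euler's formula: on the unit circle a real linear function of z is a
      combination of z and its conjugate, that is, of the frequencies 1 and -1.\<close>
    let ?a = "(of_real (h 1) - \<i> * of_real (h \<i>)) / 2" and ?b = "(of_real (h 1) + \<i> * of_real (h \<i>)) / 2"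
    have "of_real (D f * h (iexp2pi 1 f)) * iexp2pi m f
        = ?a * (of_real (D f) * iexp2pi (m + 1) f) + ?b * (of_real (D f) * iexp2pi (m - 1) f)" for f
    proof -
      have "complex_of_real (h (iexp2pi 1 f)) = ?a * iexp2pi 1 f + ?b * iexp2pi (- 1) f"
        unfolding hz[of "iexp2pi 1 f"] by (simp add: iexp2pi_eq_cis complex_eq_iff field_simps)
      moreover have "iexp2pi (m + 1) f = iexp2pi 1 f * iexp2pi m f" "iexp2pi (m - 1) f = iexp2pi (-1) f * iexp2pi m f"
        using iexp2pi_add[of m 1 f] iexp2pi_add[of m "-1" f] by (simp_all add: mult.commute)
      ultimately show ?thesis by (simp add: algebra_simps)
    qed
    then show ?thesis
      using linear.prems intm by (simp add: trivial_dtft_def)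
  qed
  ultimately show ?case by (simp add: trivial_dtft_def)
next
  case (const c D)
  then show ?case
    by (simp add: trivial_dtft_def mult.assoc mult.left_commute[of _ "of_real c"] mult.commute[of _ "of_real c"])
next
  case (add p q D)
  have "set_integrable lborel {0..<1} (\<lambda>f. of_real (D f * r (iexp2pi 1 f)) * iexp2pi m f)"
    if "trivial_dtft (\<lambda>f. D f * r (iexp2pi 1 f))" for r m
    using that by (intro set_integrable_times_bounded[where b=1]) (auto simp: trivial_dtft_def)
  with add.IH[OF add.prems] show ?case
    by (simp add: trivial_dtft_def distrib_left distrib_right)
next
  case (mult p q D)
  from mult.IH(2)[OF mult.IH(1)[OF mult.prems]] show ?case by (simp add: mult.assoc)
qed

text \<open>Stone-Weierstrass on the unit circle: replacing \<phi> by a polynomial within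
  \<open>e\<close> changes the integral by at most \<open>e\<close> times the L1 norm of
  \<open>D\<close>, and the integral against a polynomial is 0.\<close>

lemma trivial_dtft_continuous:
  assumes D: "trivial_dtft D" and \<phi>: "continuous_on UNIV (\<phi> :: complex \<Rightarrow> real)"
  shows "(LBINT f:{0..<1}. D f * \<phi> (iexp2pi 1 f)) = 0"
proof -
  let ?X = "{0..<1::real}"
  have int: "set_integrable lborel ?X D" using D by (simp add: trivial_dtft_def)
  have [measurable]: "\<psi> \<in> borel_measurable borel" if "continuous_on UNIV \<psi>" for \<psi> :: "complex \<Rightarrow> real"
    using that by (rule borel_measurable_continuous_onI)
  obtain b where b: "\<bar>\<phi> z\<bar> \<le> b" if "cmod z = 1" for z
  proof -
    have "compact (\<phi> ` sphere 0 1)"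
      by (intro compact_continuous_image continuous_on_subset[OF \<phi>]) auto
    then obtain b where "\<forall>y\<in>\<phi> ` sphere 0 1. norm y \<le> b"
      using compact_imp_bounded bounded_iff by blast
    then show thesis by (intro that[of b]) (auto simp: dist_norm)
  qed
  have int\<phi>: "set_integrable lborel ?X (\<lambda>f. D f * \<phi> (iexp2pi 1 f))"
    using \<phi> by (intro set_integrable_times_bounded_real[OF int, where b=b]) (auto intro: b)
  define K where "K = (LBINT f:?X. \<bar>D f\<bar>)"
  have eK: "\<bar>LBINT f:?X. D f * \<phi> (iexp2pi 1 f)\<bar> \<le> e * K" if "0 < e" for e
  proof -
    obtain p where p: "real_polynomial_function p" "\<And>z. z \<in> sphere 0 1 \<Longrightarrow> \<bar>\<phi> z - p z\<bar> < e"
      using Stone_Weierstrass_real_polynomial_function[of "sphere 0 1" \<phi> e] continuous_on_subset[OF \<phi>] \<open>0 < e\<close>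
      by (auto simp: compact_sphere)
    have tp: "trivial_dtft (\<lambda>f. D f * p (iexp2pi 1 f))"
      by (rule trivial_dtft_polynomial[OF p(1) D])
    then have intp: "set_integrable lborel ?X (\<lambda>f. D f * p (iexp2pi 1 f))"
      and "(LBINT f:?X. of_real (D f * p (iexp2pi 1 f)) * iexp2pi 0 f) = 0"
      by (simp_all only: trivial_dtft_def)
    then have zero: "(LBINT f:?X. D f * p (iexp2pi 1 f)) = 0"
      by (simp add: set_integral_complex_of_real del: of_real_mult)
    have "(LBINT f:?X. D f * \<phi> (iexp2pi 1 f)) = (LBINT f:?X. D f * \<phi> (iexp2pi 1 f) - D f * p (iexp2pi 1 f))"
      using int\<phi> intp zero by simp
    also have "\<bar>\<dots>\<bar> \<le> (LBINT f:?X. e * \<bar>D f\<bar>)"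
      unfolding set_lebesgue_integral_def
    proof (rule order_trans[OF integral_abs_bound], rule integral_mono)
      show "integrable lborel (\<lambda>f. \<bar>indicator ?X f *\<^sub>R (D f * \<phi> (iexp2pi 1 f) - D f * p (iexp2pi 1 f))\<bar>)"
        using set_integral_diff(1)[OF int\<phi> intp] unfolding set_integrable_def by (rule integrable_abs)
      show "integrable lborel (\<lambda>f. indicator ?X f *\<^sub>R (e * \<bar>D f\<bar>))"
        using set_integrable_mult_right[OF set_integrable_abs[OF int], of e] by (simp add: set_integrable_def)
      fix f
      have "\<bar>D f * \<phi> (iexp2pi 1 f) - D f * p (iexp2pi 1 f)\<bar> = \<bar>D f\<bar> * \<bar>\<phi> (iexp2pi 1 f) - p (iexp2pi 1 f)\<bar>"
        by (simp add: right_diff_distrib[symmetric] abs_mult)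
      also have "\<dots> \<le> \<bar>D f\<bar> * e"
        using p(2)[of "iexp2pi 1 f"] by (intro mult_left_mono) (auto simp: dist_norm)
      finally show "\<bar>indicator ?X f *\<^sub>R (D f * \<phi> (iexp2pi 1 f) - D f * p (iexp2pi 1 f))\<bar>
          \<le> indicator ?X f *\<^sub>R (e * \<bar>D f\<bar>)"
        by (simp add: indicator_def mult.commute)
    qed
    also have "\<dots> = e * K" by (simp add: K_def)
    finally show ?thesis .
  qed
  have "0 \<le> K" unfolding K_def set_lebesgue_integral_def by (intro integral_nonneg_AE) auto
  then have "\<bar>LBINT f:?X. D f * \<phi> (iexp2pi 1 f)\<bar> \<le> e" if "0 < e" for e
  proof -
    \<comment> \<open>The divisor \<open>K + 1\<close> covers the case \<open>K = 0\<close>.\<close>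
    have "\<bar>LBINT f:?X. D f * \<phi> (iexp2pi 1 f)\<bar> \<le> e / (K + 1) * K"
      using that \<open>0 \<le> K\<close> by (intro eK) simp
    also have "\<dots> \<le> e" using that \<open>0 \<le> K\<close> by (simp add: field_simps)
    finally show ?thesis .
  qed
  then have "\<bar>LBINT f:?X. D f * \<phi> (iexp2pi 1 f)\<bar> \<le> 0" by (rule field_le_epsilon) simp
  then show ?thesis by simp
qed

text \<open>The indicator of an open set is the pointwise limit of continuous cut-offs built from
  the distance to the complement; dominated convergence with majorant |D| carries the result
  over.\<close>

lemma trivial_dtft_open:
  assumes D: "trivial_dtft D" and U: "open U"
  shows "(LBINT f:{0..<1}. D f * indicator U (iexp2pi 1 f)) = 0"
\<comment> \<open>The distance to the empty set is 0 by convention, so the cut-offs below would not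
  tend to the indicator of the whole plane.\<close>
proof (cases "U = UNIV")
  case True
  then show ?thesis using trivial_dtft_continuous[OF D, of "\<lambda>_. 1"] by simp
next
  case False
  let ?X = "{0..<1::real}"
  define \<phi> where "\<phi> n z = min 1 (real n * infdist z (- U))" for n z
  have cont: "continuous_on UNIV (\<phi> n)" for n
    unfolding \<phi>_def by (intro continuous_intros)
  then have [measurable]: "\<phi> n \<in> borel_measurable borel" for n
    by (rule borel_measurable_continuous_onI)
  have bnd: "\<bar>\<phi> n z\<bar> \<le> 1" for n z by (simp add: \<phi>_def infdist_nonneg)
  have lim: "(\<lambda>n. \<phi> n z) \<longlonglongrightarrow> indicator U z" for z
  proof (cases "z \<in> U")
    case True
    have d: "0 < infdist z (- U)"
      using True U False in_closed_iff_infdist_zero[of "- U" z] infdist_nonneg[of z "- U"]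
      by (auto simp: less_le)
    then obtain m where "1 \<le> real m * infdist z (- U)"
      using real_arch_simple[of "1 / infdist z (- U)"] by (auto simp: field_simps)
    then have "1 \<le> real n * infdist z (- U)" if "m \<le> n" for n
      using that d by (meson mult_right_mono of_nat_le_iff order.trans less_imp_le)
    then have "eventually (\<lambda>n. \<phi> n z = indicator U z) sequentially"
      using True by (auto simp: \<phi>_def intro!: eventually_sequentiallyI[of m] min_absorb1)
    then show ?thesis by (rule tendsto_eventually)
  next
    case False
    then show ?thesis by (simp add: \<phi>_def)
  qed
  have int: "set_integrable lborel ?X D" using D by (simp add: trivial_dtft_def)
  have [measurable]: "(\<lambda>f. indicator ?X f *\<^sub>R D f) \<in> borel_measurable lborel"
    using int by (auto simp: set_integrable_def dest: borel_measurable_integrable)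
  have [measurable]: "U \<in> sets borel" using U by simp
  have "(\<lambda>n. \<integral>f. (indicator ?X f *\<^sub>R D f) * \<phi> n (iexp2pi 1 f) \<partial>lborel)
      \<longlonglongrightarrow> (\<integral>f. (indicator ?X f *\<^sub>R D f) * indicator U (iexp2pi 1 f) \<partial>lborel)"
  proof (rule integral_dominated_convergence[where w="\<lambda>f. \<bar>indicator ?X f *\<^sub>R D f\<bar>"])
    show "integrable lborel (\<lambda>f. \<bar>indicator ?X f *\<^sub>R D f\<bar>)"
      using int by (simp only: set_integrable_def integrable_abs)
    show "AE f in lborel. (\<lambda>n. (indicator ?X f *\<^sub>R D f) * \<phi> n (iexp2pi 1 f))
        \<longlonglongrightarrow> (indicator ?X f *\<^sub>R D f) * indicator U (iexp2pi 1 f)"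
      by (intro AE_I2 tendsto_intros lim)
    show "AE f in lborel. norm ((indicator ?X f *\<^sub>R D f) * \<phi> n (iexp2pi 1 f)) \<le> \<bar>indicator ?X f *\<^sub>R D f\<bar>" for n
      using bnd[of n] by (intro AE_I2) (simp add: abs_mult mult_left_le)
  qed measurable
  moreover have "(\<integral>f. (indicator ?X f *\<^sub>R D f) * \<phi> n (iexp2pi 1 f) \<partial>lborel) = 0" for n
    using trivial_dtft_continuous[OF D cont, of n] by (simp add: set_lebesgue_integral_def mult.assoc)
  ultimately show ?thesis
    by (simp add: set_lebesgue_integral_def mult.assoc LIMSEQ_const_iff)
qed

text \<open>For nonnegative t, the half-line above t meets [0,1) in the preimage of an open set of
  the plane cut out by the argument, so \<open>D\<close> integrates to 0 over it. Hence the positive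
  and negative parts of \<open>D\<close> are densities of measures that agree on all half-lines, and
  the densities coincide almost everywhere.\<close>

lemma trivial_dtft_AE:
  assumes D: "trivial_dtft D"
  shows "AE f in lborel. f \<in> {0..<1} \<longrightarrow> D f = 0"
proof -
  let ?X = "{0..<1::real}"
  define d where "d f = indicator ?X f * D f" for f
  have int: "integrable lborel d"
    using D by (simp add: trivial_dtft_def set_integrable_def d_def[abs_def])
  then have [measurable]: "d \<in> borel_measurable lborel" by simp
  have tail: "(\<integral>f. d f * indicator {t<..} f \<partial>lborel) = 0" for t
  proof (cases "0 \<le> t")
    case True
    have "indicator {t<..} f = (indicator {z. 2 * pi * t < Arg2pi z} (iexp2pi 1 f) :: real)" if "f \<in> ?X" for f
    proof -
      have "Arg2pi (iexp2pi 1 f) = 2 * pi * f"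
        using that by (intro Arg2pi_unique[of 1]) (auto simp: iexp2pi_def)
      then show ?thesis by (auto simp: indicator_def)
    qed
    then have "d f * indicator {t<..} f = indicator ?X f *\<^sub>R (D f * indicator {z. 2 * pi * t < Arg2pi z} (iexp2pi 1 f))" for f
      by (cases "f \<in> ?X") (auto simp: d_def)
    then show ?thesis
      using trivial_dtft_open[OF D open_Arg2pi2pi_gt, of "2 * pi * t"] by (simp add: set_lebesgue_integral_def)
  next
    case False
    then have "d f * indicator {t<..} f = indicator ?X f *\<^sub>R D f" for f
      by (auto simp: d_def indicator_def)
    then show ?thesis
      using trivial_dtft_continuous[OF D, of "\<lambda>_. 1"] by (simp add: set_lebesgue_integral_def)
  qed
  define pos neg where "pos f = max 0 (d f)" and "neg f = max 0 (- d f)" for f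
  have ip: "integrable lborel pos" and "integrable lborel neg"
    using int by (auto simp: pos_def[abs_def] neg_def[abs_def])
  note [measurable] = borel_measurable_integrable[OF ip] borel_measurable_integrable[OF \<open>integrable lborel neg\<close>]
  have em: "emeasure (density lborel (\<lambda>f. ennreal (h f))) {t<..} = ennreal (\<integral>f. h f * indicator {t<..} f \<partial>lborel)"
    if "integrable lborel h" "\<And>f. 0 \<le> h f" for h :: "real \<Rightarrow> real" and t
  proof -
    have [measurable]: "h \<in> borel_measurable lborel" using that by simp
    have "emeasure (density lborel (\<lambda>f. ennreal (h f))) {t<..} = (\<integral>\<^sup>+f. ennreal (h f) * indicator {t<..} f \<partial>lborel)"
      by (rule emeasure_density) auto
    also have "\<dots> = (\<integral>\<^sup>+f. ennreal (h f * indicator {t<..} f) \<partial>lborel)"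
      by (intro nn_integral_cong) (auto simp: indicator_def)
    also have "\<dots> = ennreal (\<integral>f. h f * indicator {t<..} f \<partial>lborel)"
      using that by (intro nn_integral_eq_integral integrable_real_mult_indicator) auto
    finally show ?thesis .
  qed
  have "density lborel (\<lambda>f. ennreal (pos f)) = density lborel (\<lambda>f. ennreal (neg f))"
  proof (rule measure_eqI_lessThan)
    fix t
    show "emeasure (density lborel (\<lambda>f. ennreal (pos f))) {t<..} < \<infinity>"
      using em[OF ip] by (simp add: pos_def)
    have "(\<integral>f. pos f * indicator {t<..} f \<partial>lborel) - (\<integral>f. neg f * indicator {t<..} f \<partial>lborel)
        = (\<integral>f. pos f * indicator {t<..} f - neg f * indicator {t<..} f \<partial>lborel)"
      by (intro Bochner_Integration.integral_diff[symmetric] integrable_real_mult_indicator ip \<open>integrable lborel neg\<close>) auto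
    also have "\<dots> = (\<integral>f. d f * indicator {t<..} f \<partial>lborel)"
      by (intro Bochner_Integration.integral_cong) (auto simp: pos_def neg_def indicator_def)
    finally have "(\<integral>f. pos f * indicator {t<..} f \<partial>lborel) = (\<integral>f. neg f * indicator {t<..} f \<partial>lborel)"
      by (simp add: tail)
    then show "emeasure (density lborel (\<lambda>f. ennreal (pos f))) {t<..}
        = emeasure (density lborel (\<lambda>f. ennreal (neg f))) {t<..}"
      using em[OF ip] em[OF \<open>integrable lborel neg\<close>] by (simp add: pos_def neg_def)
  qed simp_all
  then have "AE f in lborel. ennreal (pos f) = ennreal (neg f)"
    by (subst (asm) sigma_finite_measure.density_unique_iff[OF sigma_finite_lborel]) auto
  then show ?thesis
    by eventually_elim (auto simp: pos_def neg_def d_def max_def split: if_splits)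
qed

text \<open>Links a given spectrum with the Fourier series of its coefficients, from which it may
  differ on a null set.\<close>

lemma has_dtft_unique_AE:
  assumes "has_dtft c S" "has_dtft c S'"
  shows "AE f in lborel. f \<in> {0..<1} \<longrightarrow> S f = S' f"
proof -
  have "trivial_dtft (\<lambda>f. S f - S' f)"
  proof -
    have int: "set_integrable lborel {0..<1} (\<lambda>f. of_real (h f) * iexp2pi m f)" if "has_dtft c h" for h m
      using that by (intro set_integrable_times_bounded[where b=1]) (auto simp: has_dtft_def)
    show ?thesis
      using assms int[OF assms(1)] int[OF assms(2)]
      by (simp add: trivial_dtft_def has_dtft_def iexp2pi_def left_diff_distrib)
  qed
  from trivial_dtft_AE[OF this] show ?thesis by eventually_elim auto
qed

section \<open>Laws of the observations\<close>

text \<open>A zero mean forces \<open>mu = 0\<close>, and then \<open>sg\<close>, being nonnegative,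
  is the root of the second moment.\<close>

lemma gaussian_rv_moments:
  assumes "prob_space P" "gaussian_rv P Y"
  shows "integrable P (\<lambda>\<omega>. (Y \<omega>)^k)"
    and "(LINT \<omega>|P. Y \<omega>) = 0 \<Longrightarrow>
      distr P borel Y = distr std_normal_distribution borel (\<lambda>z. sqrt (LINT \<omega>|P. (Y \<omega>)\<^sup>2) * z)"
proof -
  interpret P: prob_space P by fact
  interpret N: prob_space std_normal_distribution by (rule prob_space_normal_density) simp
  obtain mu sg where Y [measurable]: "Y \<in> borel_measurable P" and "0 \<le> sg"
    and law: "distr P borel Y = distr std_normal_distribution borel (\<lambda>z. mu + sg * z)"
    using assms(2) by (auto simp: gaussian_rv_def)
  have mom: "integrable std_normal_distribution (\<lambda>z. z^j)" for j
    by (rule integrable_std_normal_distribution_moment)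
  have "integrable std_normal_distribution (\<lambda>z. (mu + sg * z)^j)" for j
    unfolding binomial_ring
    by (intro Bochner_Integration.integrable_sum) (auto simp: power_mult_distrib intro!: mom)
  then have "integrable (distr P borel Y) (\<lambda>y. y^j)" for j
    unfolding law by (subst integrable_distr_eq) auto
  then show "integrable P (\<lambda>\<omega>. (Y \<omega>)^k)"
    by (subst (asm) integrable_distr_eq) auto
  have z1: "(LINT z|std_normal_distribution. z) = 0"
    using integral_std_normal_distribution_moment_odd[of 1] by simp
  have z2: "(LINT z|std_normal_distribution. z\<^sup>2) = 1"
    using std_normal_distribution_even_moments(1)[of 1] by (simp add: fact_numeral)
  assume "(LINT \<omega>|P. Y \<omega>) = 0"
  moreover have "(LINT \<omega>|P. Y \<omega>) = (LINT y|distr P borel Y. y)"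
    by (subst integral_distr) auto
  moreover have "\<dots> = mu"
  proof -
    have "integrable std_normal_distribution (\<lambda>z. z)" using mom[of 1] by simp
    then have "(LINT z|std_normal_distribution. mu + sg * z) = mu"
      using N.prob_space z1 by simp
    then show ?thesis unfolding law by (subst integral_distr) auto
  qed
  ultimately have "mu = 0" by simp
  have "(LINT \<omega>|P. (Y \<omega>)\<^sup>2) = (LINT y|distr P borel Y. y\<^sup>2)"
    by (subst integral_distr) auto
  also have "\<dots> = sg\<^sup>2"
  proof -
    have "(LINT z|std_normal_distribution. (mu + sg * z)\<^sup>2) = sg\<^sup>2"
      using z2 \<open>mu = 0\<close> by (simp add: power_mult_distrib)
    then show ?thesis unfolding law by (subst integral_distr) auto
  qed
  finally show "distr P borel Y = distr std_normal_distribution borel (\<lambda>z. sqrt (LINT \<omega>|P. (Y \<omega>)\<^sup>2) * z)"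
    using law \<open>mu = 0\<close> \<open>0 \<le> sg\<close> by simp
qed

lemma char_distr_scaled_std_normal:
  "char (distr std_normal_distribution borel (\<lambda>z. a * z)) u = of_real (exp (- (u * a)\<^sup>2 / 2))"
  using integral_std_normal_iexp[of "u * a"] by (simp add: char_def integral_distr mult.assoc)

lemma zm_stationary_gaussian_measurable:
  assumes "zm_stationary_gaussian P X r"
  shows "X m \<in> borel_measurable P" "gaussian_rv P (X m)"
proof -
  have "gaussian_rv P (\<lambda>\<omega>. \<Sum>k\<in>J. c k * X k \<omega>)" if "finite J" for J c
    using assms that by (simp add: zm_stationary_gaussian_def gaussian_process_def)
  from this[of "{m}" "\<lambda>_. 1"] show "gaussian_rv P (X m)" by simp
  then show "X m \<in> borel_measurable P" by (simp add: gaussian_rv_def)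
qed

text \<open>The autocorrelation depends on lags only, so the variance is the same for every starting
  time \<open>t\<close>, and a centred Gaussian law is determined by its variance.\<close>

lemma zm_stationary_gaussian_linear_combination:
  fixes t :: int
  assumes P: "prob_space P" and X: "zm_stationary_gaussian P X r" and "finite I"
  defines "q v \<equiv> quad_form I (\<lambda>n k. r (int n - int k)) v"
  shows "0 \<le> q v"
    and "distr P borel (\<lambda>\<omega>. \<Sum>n\<in>I. v n * X (t + int n) \<omega>)
       = distr std_normal_distribution borel (\<lambda>z. sqrt (q v) * z)"
proof -
  interpret P: prob_space P by fact
  note [measurable] = zm_stationary_gaussian_measurable(1)[OF X]
  let ?Y = "\<lambda>\<omega>. \<Sum>n\<in>I. v n * X (t + int n) \<omega>"
  have int1: "integrable P (X m)" and int2: "integrable P (\<lambda>\<omega>. (X m \<omega>)\<^sup>2)" for m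
    using gaussian_rv_moments(1)[OF P zm_stationary_gaussian_measurable(2)[OF X], of m 1]
      gaussian_rv_moments(1)[OF P zm_stationary_gaussian_measurable(2)[OF X], of m 2] by simp_all
  have intp: "integrable P (\<lambda>\<omega>. X m \<omega> * X k \<omega>)" for m k
  proof (rule Bochner_Integration.integrable_bound)
    show "integrable P (\<lambda>\<omega>. (X m \<omega>)\<^sup>2 + (X k \<omega>)\<^sup>2)"
      using int2 by simp
    have "\<bar>a * b\<bar> \<le> a\<^sup>2 + b\<^sup>2" for a b :: real
    proof -
      have "2 * (\<bar>a\<bar> * \<bar>b\<bar>) \<le> a\<^sup>2 + b\<^sup>2"
        using sum_squares_bound[of "\<bar>a\<bar>" "\<bar>b\<bar>"] by (simp add: mult.assoc)
      moreover have "0 \<le> \<bar>a\<bar> * \<bar>b\<bar>" by simp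
      ultimately show ?thesis unfolding abs_mult by linarith
    qed
    then show "AE \<omega> in P. norm (X m \<omega> * X k \<omega>) \<le> norm ((X m \<omega>)\<^sup>2 + (X k \<omega>)\<^sup>2)"
      by simp
  qed measurable
  have gauss: "gaussian_rv P ?Y"
  proof -
    \<comment> \<open>Gaussian processes are defined by sums over absolute times;
      \<open>nat (m - t)\<close> recovers the index \<open>n\<close> from
      \<open>m = t + int n\<close>.\<close>
    have "gaussian_rv P (\<lambda>\<omega>. \<Sum>m\<in>(\<lambda>n. t + int n) ` I. v (nat (m - t)) * X m \<omega>)"
    proof -
      have "gaussian_rv P (\<lambda>\<omega>. \<Sum>m\<in>J. c m * X m \<omega>)" if "finite J" for J c
        using X that by (simp add: zm_stationary_gaussian_def gaussian_process_def)
      then show ?thesis using \<open>finite I\<close> by simp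
    qed
    then show ?thesis by (simp add: sum.reindex inj_on_def)
  qed
  have mean: "(LINT \<omega>|P. ?Y \<omega>) = 0"
    using X int1 by (simp add: zm_stationary_gaussian_def)
  have "(LINT \<omega>|P. (?Y \<omega>)\<^sup>2) = (LINT \<omega>|P. (\<Sum>n\<in>I. \<Sum>k\<in>I. v n * v k * (X (t + int n) \<omega> * X (t + int k) \<omega>)))"
    by (intro Bochner_Integration.integral_cong refl) (simp add: power2_eq_square sum_product mult_ac)
  also have "\<dots> = (\<Sum>n\<in>I. \<Sum>k\<in>I. v n * v k * (LINT \<omega>|P. X (t + int n) \<omega> * X (t + int k) \<omega>))"
    using intp by simp
  also have "\<dots> = q v"
  proof -
    have "(LINT \<omega>|P. X (t + int n) \<omega> * X (t + int k) \<omega>) = r (int n - int k)" for n k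
    proof -
      have "(LINT \<omega>|P. X (t + int k + (int n - int k)) \<omega> * X (t + int k) \<omega>) = r (int n - int k)"
        using X by (simp only: zm_stationary_gaussian_def)
      then show ?thesis by simp
    qed
    then show ?thesis by (simp add: q_def quad_form_def mult_ac)
  qed
  finally have var: "(LINT \<omega>|P. (?Y \<omega>)\<^sup>2) = q v" .
  have "0 \<le> (LINT \<omega>|P. (?Y \<omega>)\<^sup>2)" by (intro integral_nonneg_AE) auto
  then show "0 \<le> q v" unfolding var .
  show "distr P borel ?Y = distr std_normal_distribution borel (\<lambda>z. sqrt (q v) * z)"
    using gaussian_rv_moments(2)[OF P gauss mean] unfolding var .
qed

lemma process_measurable:
  assumes "\<And>m. Y m \<in> borel_measurable P"
  shows "(\<lambda>\<omega> m. Y m \<omega>) \<in> P \<rightarrow>\<^sub>M Pi\<^sub>M UNIV (\<lambda>_. borel)"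
  by (rule measurable_PiM_single') (simp_all add: assms PiE_def extensional_def)

text \<open>A linear combination of the observations is a measurable functional of the whole path,
  so its law can be computed from signal plus noise instead of the realization. The independent
  Gaussian summands are added through characteristic functions, which also covers zero variance,
  where there is no density.\<close>

lemma noisy_realization_centered_gaussian:
  fixes t :: int
  assumes P: "prob_space P" and X: "zm_stationary_gaussian P X r" and W: "white_gaussian_noise P W (\<sigma>\<^sup>2)"
    and indep: "indep_processes P X W" and Y: "realization P (\<lambda>m \<omega>. X m \<omega> + W m \<omega>) Y" and "finite I"
    and x: "\<And>n \<omega>. n \<in> I \<Longrightarrow> \<omega> \<in> space P \<Longrightarrow> x n \<omega> = Y (t + int n) \<omega>"
  shows "centered_gaussian P I x (\<lambda>n k. r (int n - int k) + (if n = k then \<sigma>\<^sup>2 else 0))"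
  unfolding centered_gaussian_def
proof (intro conjI ballI allI)
  interpret P: prob_space P by fact
  have W': "zm_stationary_gaussian P W (\<lambda>m. if m = 0 then \<sigma>\<^sup>2 else 0)"
    using W by (simp add: white_gaussian_noise_def)
  note [measurable] = zm_stationary_gaussian_measurable(1)[OF X] zm_stationary_gaussian_measurable(1)[OF W']
  have Ym [measurable]: "Y m \<in> borel_measurable P" for m
    using Y by (simp add: realization_def)
  show "x n \<in> borel_measurable P" if "n \<in> I" for n
    by (subst measurable_cong[OF x[OF that]]) (simp_all add: Ym)
  fix v
  let ?C = "\<lambda>n k. r (int n - int k) + (if n = k then \<sigma>\<^sup>2 else 0)"
  let ?qX = "quad_form I (\<lambda>n k. r (int n - int k)) v"
  let ?qW = "quad_form I (\<lambda>n k. if int n - int k = 0 then \<sigma>\<^sup>2 else 0) v"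
  have q: "quad_form I ?C v = ?qX + ?qW"
    unfolding quad_form_def sum.distrib[symmetric] by (intro sum.cong refl) (auto simp: distrib_right)
  note LX = zm_stationary_gaussian_linear_combination[OF P X \<open>finite I\<close>, of v]
  note LW = zm_stationary_gaussian_linear_combination[OF P W' \<open>finite I\<close>, of v]
  show nonneg: "0 \<le> quad_form I ?C v" unfolding q using LX(1) LW(1) by simp
  define \<Phi> where "\<Phi> y = (\<Sum>n\<in>I. v n * y (t + int n))" for y :: "int \<Rightarrow> real"
  have \<Phi> [measurable]: "\<Phi> \<in> borel_measurable (Pi\<^sub>M UNIV (\<lambda>_. borel))"
    unfolding \<Phi>_def by measurable
  have "distr P borel (\<lambda>\<omega>. \<Sum>n\<in>I. v n * x n \<omega>) = distr P borel (\<lambda>\<omega>. \<Phi> (\<lambda>m. Y m \<omega>))"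
    by (intro distr_cong refl) (simp add: \<Phi>_def x)
  also have "\<dots> = distr (process_law P Y) borel \<Phi>"
    unfolding process_law_def by (subst distr_distr[OF \<Phi> process_measurable]) (auto simp: comp_def)
  also have "process_law P Y = process_law P (\<lambda>m \<omega>. X m \<omega> + W m \<omega>)"
    using Y by (simp add: realization_def)
  also have "distr (process_law P (\<lambda>m \<omega>. X m \<omega> + W m \<omega>)) borel \<Phi> = distr P borel (\<lambda>\<omega>. \<Phi> (\<lambda>m. X m \<omega> + W m \<omega>))"
    unfolding process_law_def by (subst distr_distr[OF \<Phi> process_measurable]) (auto simp: comp_def)
  also have "\<dots> = distr P borel (\<lambda>\<omega>. \<Phi> (\<lambda>m. X m \<omega>) + \<Phi> (\<lambda>m. W m \<omega>))"
    by (simp add: \<Phi>_def distrib_left sum.distrib)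
  also have "\<dots> = distr std_normal_distribution borel (\<lambda>z. sqrt (quad_form I ?C v) * z)"
  proof (rule Levy_uniqueness)
    show "real_distribution (distr P borel (\<lambda>\<omega>. \<Phi> (\<lambda>m. X m \<omega>) + \<Phi> (\<lambda>m. W m \<omega>)))"
      unfolding \<Phi>_def by (rule P.real_distribution_distr) measurable
    show "real_distribution (distr std_normal_distribution borel (\<lambda>z. sqrt (quad_form I ?C v) * z))"
      by (intro prob_space.real_distribution_distr prob_space_normal_density) auto
    have ind: "P.indep_var borel (\<lambda>\<omega>. \<Phi> (\<lambda>m. X m \<omega>)) borel (\<lambda>\<omega>. \<Phi> (\<lambda>m. W m \<omega>))"
      using P.indep_var_compose[OF indep[unfolded indep_processes_def] \<Phi> \<Phi>] by (simp add: comp_def)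
    show "char (distr P borel (\<lambda>\<omega>. \<Phi> (\<lambda>m. X m \<omega>) + \<Phi> (\<lambda>m. W m \<omega>)))
        = char (distr std_normal_distribution borel (\<lambda>z. sqrt (quad_form I ?C v) * z))"
    proof
      fix u
      have "char (distr P borel (\<lambda>\<omega>. \<Phi> (\<lambda>m. X m \<omega>) + \<Phi> (\<lambda>m. W m \<omega>))) u
          = of_real (exp (- (u * sqrt ?qX)\<^sup>2 / 2)) * of_real (exp (- (u * sqrt ?qW)\<^sup>2 / 2))"
        unfolding P.char_distr_add[OF ind] unfolding \<Phi>_def LX(2) LW(2) char_distr_scaled_std_normal ..
      also have "\<dots> = of_real (exp (- (u * sqrt ?qX)\<^sup>2 / 2 + - (u * sqrt ?qW)\<^sup>2 / 2))"
        by (simp only: exp_add of_real_mult)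
      also have "- (u * sqrt ?qX)\<^sup>2 / 2 + - (u * sqrt ?qW)\<^sup>2 / 2 = - (u * sqrt (quad_form I ?C v))\<^sup>2 / 2"
        unfolding q power_mult_distrib real_sqrt_pow2[OF nonneg[unfolded q]] real_sqrt_pow2[OF LX(1)] real_sqrt_pow2[OF LW(1)]
        by (simp add: distrib_left add_divide_distrib)
      finally show "char (distr P borel (\<lambda>\<omega>. \<Phi> (\<lambda>m. X m \<omega>) + \<Phi> (\<lambda>m. W m \<omega>))) u
          = char (distr std_normal_distribution borel (\<lambda>z. sqrt (quad_form I ?C v) * z)) u"
        by (simp add: char_distr_scaled_std_normal)
    qed
  qed
  finally show "distr P borel (\<lambda>\<omega>. \<Sum>n\<in>I. v n * x n \<omega>)
      = distr std_normal_distribution borel (\<lambda>z. sqrt (quad_form I ?C v) * z)" .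
qed

section \<open>Blackman-Tukey estimates\<close>

text \<open>Jensen's inequality from the tangent of the exponential at the mean \<open>b\<close>;
  the right-hand side is an extended integral and may be infinite.\<close>

lemma exp_set_integral_le:
  assumes y: "set_integrable lborel {0..<1} y"
  shows "ennreal (exp (LBINT f:{0..<1::real}. y f))
       \<le> (\<integral>\<^sup>+f. ennreal (exp (y f)) * indicator {0..<1} f \<partial>lborel)"
proof -
  let ?X = "{0..<1::real}"
  define b where "b = (LBINT f:?X. y f)"
  define h where "h f = indicator ?X f *\<^sub>R (exp b * (1 - b) + exp b * y f)" for f
  have inth: "set_integrable lborel ?X (\<lambda>f. exp b * (1 - b) + exp b * y f)"
    using y set_integrable_const_unit by (intro set_integral_add(1) set_integrable_mult_right) auto
  then have int: "integrable lborel h" by (simp add: set_integrable_def h_def[abs_def])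
  have one: "(LBINT f:?X. a) = a" for a :: real
    by (simp add: set_lebesgue_integral_def)
  have "exp b = (LBINT f:?X. exp b * (1 - b) + exp b * y f)"
    using y set_integrable_const_unit
    by (simp add: one b_def[symmetric] algebra_simps)
  then have "exp b = integral\<^sup>L lborel h"
    by (simp add: set_lebesgue_integral_def h_def[abs_def])
  also have "\<dots> \<le> enn2real (\<integral>\<^sup>+f. ennreal (h f) \<partial>lborel)"
    using real_lebesgue_integral_def[OF int] by simp
  finally have "ennreal (exp b) \<le> ennreal (enn2real (\<integral>\<^sup>+f. ennreal (h f) \<partial>lborel))"
    by (rule ennreal_leI)
  also have "\<dots> = (\<integral>\<^sup>+f. ennreal (h f) \<partial>lborel)"
    using integrableD(2)[OF int] by (simp add: top.not_eq_extremum)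
  also have "\<dots> \<le> (\<integral>\<^sup>+f. ennreal (exp (y f)) * indicator ?X f \<partial>lborel)"
  proof (rule nn_integral_mono)
    fix f
    have "exp b * (1 - b) + exp b * y f = exp b * (1 + (y f - b))" by (simp add: algebra_simps)
    also have "\<dots> \<le> exp b * exp (y f - b)" by (intro mult_left_mono exp_ge_add_one_self) auto
    also have "\<dots> = exp (y f)" by (simp add: exp_add[symmetric])
    finally show "ennreal (h f) \<le> ennreal (exp (y f)) * indicator ?X f"
      by (auto simp: h_def indicator_def intro!: ennreal_leI)
  qed
  finally show ?thesis by (simp add: b_def)
qed

text \<open>Factoring G = K^T K writes the trace of G C as the sum of the form of \<open>C\<close>
  over the rows of K. Each value is at most \<open>B\<close> times the squared norm of the row, and
  these squared norms add up to the trace of G.\<close>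

lemma psd_trace_le:
  assumes fin: "finite I" and G: "\<And>i j. i \<in> I \<Longrightarrow> j \<in> I \<Longrightarrow> G i j = G j i" "\<And>v. 0 \<le> quad_form I G v"
    and C: "\<And>v. quad_form I C v \<le> B * sq_norm I v"
  shows "(\<Sum>i\<in>I. \<Sum>j\<in>I. G i j * C i j) \<le> B * (\<Sum>i\<in>I. G i i)"
proof -
  obtain K where K: "\<And>i j. i \<in> I \<Longrightarrow> j \<in> I \<Longrightarrow> G i j = (\<Sum>k\<in>I. K k i * K k j)"
    using psd_gram[of I G, OF fin G] by blast
  have "(\<Sum>i\<in>I. \<Sum>j\<in>I. G i j * C i j) = (\<Sum>i\<in>I. \<Sum>j\<in>I. \<Sum>k\<in>I. C i j * K k i * K k j)"
    by (intro sum.cong refl) (simp add: K sum_distrib_left sum_distrib_right mult_ac)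
  also have "\<dots> = (\<Sum>i\<in>I. \<Sum>k\<in>I. \<Sum>j\<in>I. C i j * K k i * K k j)"
    by (rule sum.cong[OF refl], rule sum.swap)
  also have "\<dots> = (\<Sum>k\<in>I. quad_form I C (K k))"
    unfolding quad_form_def by (rule sum.swap)
  also have "\<dots> \<le> (\<Sum>k\<in>I. B * sq_norm I (K k))"
    by (intro sum_mono C)
  also have "\<dots> = B * (\<Sum>k\<in>I. \<Sum>i\<in>I. K k i * K k i)"
    by (simp add: sq_norm_def sum_distrib_left power2_eq_square)
  also have "(\<Sum>k\<in>I. \<Sum>i\<in>I. K k i * K k i) = (\<Sum>i\<in>I. G i i)"
    by (subst sum.swap) (simp add: K)
  finally show ?thesis .
qed

text \<open>Conjugating the coefficient integral of a real \<open>S\<close> reverses the lag, and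
  \<open>c\<close> is real.\<close>

lemma has_dtft_even:
  assumes "has_dtft c S"
  shows "c (- m) = c m"
proof -
  have c: "of_real (c m) = (LBINT f:{0..<1}. of_real (S f) * iexp2pi m f)" for m
    using assms by (simp add: has_dtft_def iexp2pi_def)
  have "complex_of_real (c (- m)) = cnj (LBINT f:{0..<1}. of_real (S f) * iexp2pi m f)"
    unfolding c set_lebesgue_integral_def
    by (subst Bochner_Integration.integral_cnj[symmetric], intro Bochner_Integration.integral_cong refl) (simp add: cnj_iexp2pi)
  also have "\<dots> = of_real (c m)" unfolding c[symmetric] by simp
  finally show ?thesis by (simp only: of_real_eq_iff)
qed

section \<open>Window matrix, noisy covariance and mean of the estimate\<close>

definition window_matrix :: "(int \<Rightarrow> real) \<Rightarrow> real \<Rightarrow> nat \<Rightarrow> nat \<Rightarrow> real" where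
  "window_matrix g f n k = g (int n - int k) * cos (2 * pi * f * (real n - real k))"

definition noisy_acf :: "(int \<Rightarrow> real) \<Rightarrow> real \<Rightarrow> nat \<Rightarrow> nat \<Rightarrow> real" where
  "noisy_acf r v n k = r (int n - int k) + (if n = k then v else 0)"

text \<open>This is tr (G C) / M, the expectation of the estimate in closed form; it serves as the
  centre of concentration without an expectation integral being evaluated.\<close>

definition mean_psd_est :: "nat \<Rightarrow> (int \<Rightarrow> real) \<Rightarrow> (int \<Rightarrow> real) \<Rightarrow> real \<Rightarrow> real \<Rightarrow> real" where
  "mean_psd_est M g r v f =
     (\<Sum>n\<in>{1..M}. \<Sum>k\<in>{1..M}. window_matrix g f n k * noisy_acf r v n k) / real M"

lemma window_matrix_sym: "has_dtft g gf \<Longrightarrow> window_matrix g f n k = window_matrix g f k n"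
  using has_dtft_even[of g gf "int n - int k"] cos_minus[of "2 * pi * f * (real n - real k)"]
  by (simp add: window_matrix_def mult_minus_right[symmetric] del: cos_minus)

lemma noisy_acf_sym: "has_dtft r s \<Longrightarrow> noisy_acf r v n k = noisy_acf r v k n"
  using has_dtft_even[of r s "int n - int k"] by (auto simp: noisy_acf_def)

lemma window_matrix_bounds:
  assumes "has_dtft g gf" "\<And>f. f \<in> {0..<1} \<Longrightarrow> 0 \<le> gf f \<and> gf f \<le> A" "finite I"
  shows "0 \<le> quad_form I (window_matrix g f) w" "quad_form I (window_matrix g f) w \<le> A * sq_norm I w"
  using modulated_toeplitz_bounds(1)[OF assms(1,3), where b=A and \<phi>=f and w=w]
    modulated_toeplitz_bounds(2)[OF assms(1,3), where \<phi>=f and w=w] assms(2)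
  by (simp_all add: window_matrix_def[abs_def])

lemma noisy_acf_bound:
  assumes "has_dtft r s" "\<And>f. f \<in> {0..<1} \<Longrightarrow> s f \<le> B" "finite I"
  shows "quad_form I (noisy_acf r v) w \<le> (B + v) * sq_norm I w"
proof -
  have "quad_form I (noisy_acf r v) w
      = quad_form I (\<lambda>n k. r (int n - int k)) w + (\<Sum>n\<in>I. \<Sum>k\<in>I. if k = n then v * (w n)\<^sup>2 else 0)"
    unfolding quad_form_def sum.distrib[symmetric]
    by (intro sum.cong refl) (auto simp: noisy_acf_def distrib_right power2_eq_square)
  also have "(\<Sum>n\<in>I. \<Sum>k\<in>I. if k = n then v * (w n)\<^sup>2 else 0) = v * sq_norm I w"
    using assms(3) by (simp add: sq_norm_def sum_distrib_left)
  also have "quad_form I (\<lambda>n k. r (int n - int k)) w \<le> B * sq_norm I w"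
    using modulated_toeplitz_bounds(1)[OF assms(1,3), where b=B and \<phi>=0 and w=w] assms(2) by simp
  finally show ?thesis by (simp add: distrib_right)
qed

text \<open>The Toeplitz bound for a single point. Applied to the window, \<open>g 0 = 1\<close>
  gives \<open>1 \<le> A\<close>.\<close>

lemma dtft_zero_le_sup:
  assumes "has_dtft c S" "\<And>f. f \<in> {0..<1} \<Longrightarrow> S f \<le> b"
  shows "c 0 \<le> b"
  using modulated_toeplitz_bounds(1)[OF assms(1), where b=b and I="{0::nat}" and w="\<lambda>_. 1" and \<phi>=0] assms(2)
  by (simp add: quad_form_def sq_norm_def)

text \<open>The bound for quadratic forms is applied at \<theta> = u and \<theta> = - u, with c =
  \<open>A * (B + v)\<close>. Centering at the trace \<tau> of G C leaves the exponent \<theta>^2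
  \<tau> / (2 c (1 - \<theta>)), which is at most \<theta>^2 M because \<tau> \<le> c M and 1 -
  \<theta> \<ge> 1/2. The factor 2 collects both signs.\<close>

lemma psd_est_exponential_moment:
  assumes P: "prob_space P" and x: "centered_gaussian P {1..M} x (noisy_acf r v)"
    and r: "has_dtft r s" "\<And>f. f \<in> {0..<1} \<Longrightarrow> s f \<le> B"
    and g: "has_dtft g gf" "\<And>f. f \<in> {0..<1} \<Longrightarrow> 0 \<le> gf f \<and> gf f \<le> A" "g 0 = 1"
    and Bv: "0 < B + v" and M: "1 \<le> M" and u: "0 \<le> u" "u \<le> 1 / 2"
  defines "Y f \<omega> \<equiv> quad_form {1..M} (window_matrix g f) (\<lambda>n. x n \<omega>) / real M - mean_psd_est M g r v f"
  shows "(\<integral>\<^sup>+\<omega>. ennreal (exp (u * real M / (2 * (A * (B + v))) * \<bar>Y f \<omega>\<bar>)) \<partial>P)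
       \<le> ennreal (2 * exp (u\<^sup>2 * real M))"
proof -
  have A: "1 \<le> A" using dtft_zero_le_sup[OF g(1), of A] g(2,3) by simp
  define c where "c = A * (B + v)"
  have c: "0 < c" "B + v \<le> c" using A Bv by (auto simp: c_def mult_le_cancel_right1)
  let ?G = "window_matrix g f" and ?C = "noisy_acf r v" and ?I = "{1..M}"
  define \<tau> where "\<tau> = (\<Sum>n\<in>?I. \<Sum>k\<in>?I. ?G n k * ?C n k)"
  define Q where "Q \<omega> = quad_form ?I ?G (\<lambda>n. x n \<omega>)" for \<omega>
  have [measurable]: "\<And>n. n \<in> ?I \<Longrightarrow> x n \<in> borel_measurable P"
    using x by (simp add: centered_gaussian_def)
  have [measurable]: "Q \<in> borel_measurable P"
    unfolding Q_def quad_form_def by measurable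
  have MY: "real M * Y f \<omega> = Q \<omega> - \<tau>" for \<omega>
    using M by (simp add: Y_def Q_def \<tau>_def mean_psd_est_def right_diff_distrib)
  have "\<tau> \<le> (B + v) * (\<Sum>n\<in>?I. ?G n n)"
    unfolding \<tau>_def using window_matrix_sym[OF g(1)] window_matrix_bounds(1)[OF g(1,2)] noisy_acf_bound[OF r]
    by (intro psd_trace_le) auto
  \<comment> \<open>The diagonal of the window matrix is \<open>g 0 = 1\<close>, so its trace is
    \<open>M\<close>.\<close>
  also have "\<dots> \<le> c * real M" using c g(3) by (simp add: window_matrix_def mult_right_mono)
  finally have \<tau>: "\<tau> \<le> c * real M" .
  have mgf: "(\<integral>\<^sup>+\<omega>. ennreal (exp (\<theta> / (2 * c) * (Q \<omega> - \<tau>))) \<partial>P) \<le> ennreal (exp (\<theta>\<^sup>2 * real M))"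
    if \<theta>: "\<theta> \<le> 1 / 2" for \<theta>
  proof -
    let ?a = "\<theta> / (2 * c)"
    have "(\<integral>\<^sup>+\<omega>. ennreal (exp (?a * (Q \<omega> - \<tau>))) \<partial>P)
        = (\<integral>\<^sup>+\<omega>. ennreal (exp (- ?a * \<tau>)) * ennreal (exp (?a * Q \<omega>)) \<partial>P)"
      by (intro nn_integral_cong) (simp add: ennreal_mult[symmetric] exp_add[symmetric] right_diff_distrib)
    also have "\<dots> = ennreal (exp (- ?a * \<tau>)) * (\<integral>\<^sup>+\<omega>. ennreal (exp (?a * Q \<omega>)) \<partial>P)"
      by (rule nn_integral_cmult) measurable
    also have "\<dots> \<le> ennreal (exp (- ?a * \<tau>)) * ennreal (exp (?a * \<tau> / (1 - \<theta>)))"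
      unfolding Q_def \<tau>_def c_def
      using window_matrix_sym[OF g(1)] window_matrix_bounds[OF g(1,2)] noisy_acf_sym[OF r(1)] noisy_acf_bound[OF r] A Bv \<theta>
      by (intro mult_left_mono centered_gaussian_quad_form_exp_le[OF P x]) auto
    also have "\<dots> = ennreal (exp (\<theta>\<^sup>2 * (\<tau> / (2 * c * (1 - \<theta>)))))"
      using \<theta> c(1) by (simp add: ennreal_mult[symmetric] exp_add[symmetric] field_simps power2_eq_square)
    also have "\<dots> \<le> ennreal (exp (\<theta>\<^sup>2 * real M))"
    proof (intro ennreal_leI, subst exp_le_cancel_iff, rule mult_left_mono)
      have "\<tau> \<le> c * real M * 1" using \<tau> by simp
      also have "\<dots> \<le> c * real M * (2 * (1 - \<theta>))" using \<theta> c(1) by (intro mult_left_mono) auto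
      finally show "\<tau> / (2 * c * (1 - \<theta>)) \<le> real M"
        using \<theta> c(1) by (simp add: pos_divide_le_eq mult_ac)
    qed simp
    finally show ?thesis .
  qed
  have abs: "u * real M / (2 * c) * \<bar>Y f \<omega>\<bar> = \<bar>u / (2 * c) * (Q \<omega> - \<tau>)\<bar>" for \<omega>
    using u(1) c(1) by (simp add: MY[symmetric] abs_mult)
  have "(\<integral>\<^sup>+\<omega>. ennreal (exp (u * real M / (2 * c) * \<bar>Y f \<omega>\<bar>)) \<partial>P)
      \<le> (\<integral>\<^sup>+\<omega>. ennreal (exp (u / (2 * c) * (Q \<omega> - \<tau>))) + ennreal (exp (- u / (2 * c) * (Q \<omega> - \<tau>))) \<partial>P)"
  proof (rule nn_integral_mono)
    fix \<omega>
    define y where "y = u / (2 * c) * (Q \<omega> - \<tau>)"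
    have "exp \<bar>y\<bar> \<le> exp y + exp (- y)" by (simp add: abs_if)
    then have "ennreal (exp \<bar>y\<bar>) \<le> ennreal (exp y) + ennreal (exp (- y))"
      by (simp add: ennreal_plus[symmetric] ennreal_leI del: ennreal_plus)
    moreover have "- u / (2 * c) * (Q \<omega> - \<tau>) = - y" by (simp add: y_def)
    ultimately show "ennreal (exp (u * real M / (2 * c) * \<bar>Y f \<omega>\<bar>))
        \<le> ennreal (exp (u / (2 * c) * (Q \<omega> - \<tau>))) + ennreal (exp (- u / (2 * c) * (Q \<omega> - \<tau>)))"
      unfolding abs by (simp only: y_def[symmetric])
  qed
  also have "\<dots> = (\<integral>\<^sup>+\<omega>. ennreal (exp (u / (2 * c) * (Q \<omega> - \<tau>))) \<partial>P)
                + (\<integral>\<^sup>+\<omega>. ennreal (exp (- u / (2 * c) * (Q \<omega> - \<tau>))) \<partial>P)"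
    by (rule nn_integral_add) measurable
  also have "\<dots> \<le> ennreal (exp (u\<^sup>2 * real M)) + ennreal (exp ((- u)\<^sup>2 * real M))"
    using u by (intro add_mono mgf) auto
  also have "\<dots> = ennreal (2 * exp (u\<^sup>2 * real M))"
    by (simp add: ennreal_plus[symmetric] del: ennreal_plus)
  finally show ?thesis by (simp add: c_def)
qed

lemma psd_est_concentration:
  assumes P: "prob_space P" and x: "centered_gaussian P {1..M} x (noisy_acf r v)"
    and r: "has_dtft r s" "\<And>f. f \<in> {0..<1} \<Longrightarrow> s f \<le> B"
    and g: "has_dtft g gf" "\<And>f. f \<in> {0..<1} \<Longrightarrow> 0 \<le> gf f \<and> gf f \<le> A" "g 0 = 1"
    and Bv: "0 < B + v" and M: "1 \<le> M"
  defines "u \<equiv> sqrt (2 * ln (real M) / real M)"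
  defines "Z \<omega> \<equiv> (LBINT f:{0..<1}.
      \<bar>quad_form {1..M} (window_matrix g f) (\<lambda>n. x n \<omega>) / real M - mean_psd_est M g r v f\<bar>)"
  assumes u: "u \<le> 1 / 2"
  shows "Z \<in> borel_measurable P"
    and "measure P {\<omega> \<in> space P. 4 * A * (B + v) * u \<le> Z \<omega>} \<le> 2 / (real M)\<^sup>2"
proof -
  interpret P: prob_space P by fact
  interpret LP: pair_sigma_finite lborel P ..
  let ?X = "{0..<1::real}"
  define Y where "Y f \<omega> = quad_form {1..M} (window_matrix g f) (\<lambda>n. x n \<omega>) / real M - mean_psd_est M g r v f" for f \<omega>
  have [measurable]: "\<And>n. n \<in> {1..M} \<Longrightarrow> x n \<in> borel_measurable P"
    using x by (simp add: centered_gaussian_def)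
  have Ym [measurable]: "(\<lambda>(\<omega>, f). Y f \<omega>) \<in> borel_measurable (P \<Otimes>\<^sub>M lborel)"
    unfolding Y_def quad_form_def mean_psd_est_def window_matrix_def by measurable
  have Z: "Z \<omega> = (LBINT f:?X. \<bar>Y f \<omega>\<bar>)" for \<omega>
    by (simp add: Z_def Y_def)
  show Zm [measurable]: "Z \<in> borel_measurable P"
    unfolding Z[abs_def] set_lebesgue_integral_def by measurable
  show "measure P {\<omega> \<in> space P. 4 * A * (B + v) * u \<le> Z \<omega>} \<le> 2 / (real M)\<^sup>2"
  \<comment> \<open>For \<open>M = 1\<close> the logarithm and hence \<open>u\<close> vanish, so no
    positive exponent is available; but then the claimed bound is 2.\<close>
  proof (cases "M = 1")
    case True
    show ?thesis by (rule order_trans[OF P.prob_le_1]) (use True in simp)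
  next
    case False
    then have M2: "2 \<le> M" using M by simp
    then have u0: "0 < u" by (simp add: u_def)
    have uM: "u\<^sup>2 * real M = 2 * ln (real M)" using M2 by (simp add: u_def)
    have A: "1 \<le> A" using dtft_zero_le_sup[OF g(1), of A] g(2,3) by simp
    define c where "c = A * (B + v)"
    have c: "0 < c" using A Bv by (simp add: c_def)
    \<comment> \<open>With this scale, \<open>a\<close> times the threshold \<open>4 * c * u\<close>
      equals 2 u^2 M = 4 ln M.\<close>
    define a where "a = u * real M / (2 * c)"
    have a: "0 < a" using u0 M2 c by (simp add: a_def)
    have int: "set_integrable lborel ?X (\<lambda>f. a * \<bar>Y f \<omega>\<bar>)" for \<omega>
    proof (rule set_integrable_subset)
      show "set_integrable lborel {0..1} (\<lambda>f. a * \<bar>Y f \<omega>\<bar>)"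
        unfolding Y_def quad_form_def mean_psd_est_def window_matrix_def
        using M by (intro borel_integrable_atLeastAtMost') (auto intro!: continuous_intros)
    qed auto
    have "emeasure P {\<omega> \<in> space P. 4 * A * (B + v) * u \<le> Z \<omega>}
        \<le> ennreal (exp (- a * (4 * A * (B + v) * u))) * (\<integral>\<^sup>+\<omega>. ennreal (exp (a * Z \<omega>)) * indicator (space P) \<omega> \<partial>P)"
      using a by (intro Chernoff_ineq_nn_integral_ge) auto
    also have "(\<integral>\<^sup>+\<omega>. ennreal (exp (a * Z \<omega>)) * indicator (space P) \<omega> \<partial>P)
        \<le> (\<integral>\<^sup>+\<omega>. \<integral>\<^sup>+f. ennreal (exp (a * \<bar>Y f \<omega>\<bar>)) * indicator ?X f \<partial>lborel \<partial>P)"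
    proof (rule nn_integral_mono)
      fix \<omega> assume "\<omega> \<in> space P"
      then show "ennreal (exp (a * Z \<omega>)) * indicator (space P) \<omega>
          \<le> (\<integral>\<^sup>+f. ennreal (exp (a * \<bar>Y f \<omega>\<bar>)) * indicator ?X f \<partial>lborel)"
        using exp_set_integral_le[OF int, of \<omega>] by (simp add: Z)
    qed
    \<comment> \<open>After the exchange the moment bound is used at one fixed frequency at a time;
      no bound uniform over frequencies enters.\<close>
    also have "\<dots> = (\<integral>\<^sup>+f. \<integral>\<^sup>+\<omega>. ennreal (exp (a * \<bar>Y f \<omega>\<bar>)) * indicator ?X f \<partial>P \<partial>lborel)"
      by (rule LP.Fubini') measurable
    also have "\<dots> \<le> (\<integral>\<^sup>+f. ennreal (2 * exp (u\<^sup>2 * real M)) * indicator ?X f \<partial>lborel)"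
    proof (rule nn_integral_mono)
      fix f :: real
      have "(\<integral>\<^sup>+\<omega>. ennreal (exp (a * \<bar>Y f \<omega>\<bar>)) \<partial>P) \<le> ennreal (2 * exp (u\<^sup>2 * real M))"
        using psd_est_exponential_moment[OF P x r g Bv M, of u f] u u0 by (simp add: a_def c_def Y_def)
      then show "(\<integral>\<^sup>+\<omega>. ennreal (exp (a * \<bar>Y f \<omega>\<bar>)) * indicator ?X f \<partial>P)
          \<le> ennreal (2 * exp (u\<^sup>2 * real M)) * indicator ?X f"
        by (auto simp: indicator_def)
    qed
    also have "\<dots> = ennreal (2 * exp (u\<^sup>2 * real M))"
      by (simp add: nn_integral_cmult)
    finally have "emeasure P {\<omega> \<in> space P. 4 * A * (B + v) * u \<le> Z \<omega>}
        \<le> ennreal (exp (- a * (4 * A * (B + v) * u))) * ennreal (2 * exp (u\<^sup>2 * real M))"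
      by (simp add: mult_left_mono)
    also have "- a * (4 * A * (B + v) * u) = - (2 * (u\<^sup>2 * real M))"
      using c by (simp add: a_def c_def power2_eq_square field_simps)
    also have "ennreal (exp (- (2 * (u\<^sup>2 * real M)))) * ennreal (2 * exp (u\<^sup>2 * real M)) = ennreal (2 * exp (- (u\<^sup>2 * real M)))"
      by (simp add: ennreal_mult[symmetric] exp_add[symmetric] mult.left_commute)
    also have "exp (- (u\<^sup>2 * real M)) = 1 / (real M)\<^sup>2"
      using M2 unfolding uM by (simp add: exp_minus exp_double inverse_eq_divide)
    finally show ?thesis
      by (simp add: P.emeasure_eq_measure)
  qed
qed

text \<open>Pairs of indices are grouped by their lag. The identity serves twice: with the data for
  the estimate, and with the constant sequence 1 for its mean.\<close>

lemma sum_by_lag: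
  fixes w :: "int \<Rightarrow> complex"
  assumes M: "1 \<le> M"
  shows "(\<Sum>m = - int M + 1..int M - 1. w m * of_real (acf_est M x m))
       = (\<Sum>n\<in>{1..M}. \<Sum>k\<in>{1..M}. w (int n - int k) * of_real (x n * x k)) / of_nat M"
proof -
  let ?S = "{1..M} \<times> {1..M}" and ?T = "{- int M + 1..int M - 1}"
  let ?l = "\<lambda>p::nat \<times> nat. int (fst p) - int (snd p)"
  let ?h = "\<lambda>p. w (?l p) * of_real (x (fst p) * x (snd p))"
  have lag: "(\<Sum>p | p \<in> ?S \<and> ?l p = m. ?h p) = of_nat M * (w m * of_real (acf_est M x m))" if "m \<in> ?T" for m
  proof -
    have "(\<Sum>p | p \<in> ?S \<and> ?l p = m. ?h p)
        = (\<Sum>i = 1..M - nat \<bar>m\<bar>. w m * of_real (x (i + nat \<bar>m\<bar>) * x i))"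
      by (rule sum.reindex_bij_witness[where
            i = "\<lambda>i. if 0 \<le> m then (i + nat m, i) else (i, i + nat (- m))"
          and j = "\<lambda>p. if 0 \<le> m then snd p else fst p"])
        (use that in \<open>auto simp: nat_diff_distrib mult.commute split: if_splits\<close>)
    also have "\<dots> = of_nat M * (w m * of_real (acf_est M x m))"
      using M by (simp add: acf_est_def sum_distrib_left)
    finally show ?thesis .
  qed
  have "(\<Sum>n\<in>{1..M}. \<Sum>k\<in>{1..M}. w (int n - int k) * of_real (x n * x k)) = (\<Sum>p\<in>?S. ?h p)"
    by (simp add: sum.cartesian_product case_prod_beta)
  also have "\<dots> = (\<Sum>m\<in>?T. \<Sum>p | p \<in> ?S \<and> ?l p = m. ?h p)"
    by (rule sum.group[symmetric]) auto
  also have "\<dots> = (\<Sum>m\<in>?T. of_nat M * (w m * of_real (acf_est M x m)))"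
    by (rule sum.cong[OF refl lag])
  also have "\<dots> = of_nat M * (\<Sum>m\<in>?T. w m * of_real (acf_est M x m))"
    by (rule sum_distrib_left[symmetric])
  finally show ?thesis using M by simp
qed

lemma Re_iexp2pi_lag: "Re (iexp2pi (- (int n - int k)) f) = cos (2 * pi * f * (real n - real k))"
  and Im_iexp2pi_lag: "Im (iexp2pi (- (int n - int k)) f) = - sin (2 * pi * f * (real n - real k))"
  by (simp_all only: cnj_iexp2pi[symmetric]) (simp_all add: iexp2pi_eq_cis)

text \<open>The imaginary part of the double sum is antisymmetric in the two indices, since the
  window is even and the sine odd, and therefore cancels.\<close>

lemma psd_est_eq_quad_form:
  assumes M: "1 \<le> M" and g: "has_dtft g gf"
  shows "psd_est M g x f = of_real (quad_form {1..M} (window_matrix g f) x / real M)"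
proof -
  let ?S = "\<Sum>n\<in>{1..M}. \<Sum>k\<in>{1..M}. of_real (g (int n - int k)) * iexp2pi (- (int n - int k)) f * of_real (x n * x k)"
  have "psd_est M g x f = ?S / of_nat M"
    unfolding psd_est_def
    by (subst sum_by_lag[OF M, of "\<lambda>m. of_real (g m) * iexp2pi (- m) f", symmetric])
      (simp add: iexp2pi_def mult_ac)
  moreover have "Re ?S = quad_form {1..M} (window_matrix g f) x"
    unfolding Re_sum quad_form_def
    by (intro sum.cong refl) (simp only: Re_iexp2pi_lag window_matrix_def times_complex.sel complex.sel
        Re_complex_of_real Im_complex_of_real mult_zero_left mult_zero_right diff_0_right mult.assoc)
  moreover have "Im ?S = 0"
  proof -
    let ?a = "\<lambda>n k. g (int n - int k) * - sin (2 * pi * f * (real n - real k)) * (x n * x k)"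
    have im: "Im ?S = (\<Sum>n\<in>{1..M}. \<Sum>k\<in>{1..M}. ?a n k)"
      unfolding Im_sum
      by (intro sum.cong refl) (simp only: Im_iexp2pi_lag times_complex.sel complex.sel
          Re_complex_of_real Im_complex_of_real mult_zero_left mult_zero_right add_0_left add_0_right)
    have anti: "?a n k = - ?a k n" for n k
    proof -
      have "g (int n - int k) = g (int k - int n)" using has_dtft_even[OF g, of "int n - int k"] by simp
      moreover have "sin (2 * pi * f * (real n - real k)) = - sin (2 * pi * f * (real k - real n))"
        by (subst sin_minus[symmetric]) (simp only: mult_minus_right[symmetric] minus_diff_eq)
      ultimately show ?thesis by simp
    qed
    have "(\<Sum>n\<in>{1..M}. \<Sum>k\<in>{1..M}. ?a n k) = (\<Sum>n\<in>{1..M}. \<Sum>k\<in>{1..M}. - ?a k n)"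
      by (intro sum.cong refl anti)
    also have "\<dots> = - (\<Sum>n\<in>{1..M}. \<Sum>k\<in>{1..M}. ?a n k)"
      unfolding sum_negf by (subst sum.swap) (rule refl)
    finally have "(\<Sum>n\<in>{1..M}. \<Sum>k\<in>{1..M}. ?a n k) = 0" by linarith
    then show ?thesis unfolding im .
  qed
  ultimately show ?thesis
    by (simp add: complex_eq_iff Re_divide_of_nat Im_divide_of_nat)
qed

section \<open>Bias of the mean estimate\<close>

definition fourier_series :: "(int \<Rightarrow> real) \<Rightarrow> real \<Rightarrow> real" where
  "fourier_series r f = Re (\<Sum>\<^sub>\<infinity>m. of_real (r m) * iexp2pi (- m) f)"

lemma fourier_series_summable:
  assumes "(\<lambda>m. \<bar>r m\<bar>) summable_on UNIV"
  shows "(\<lambda>m. of_real (r m) * iexp2pi (- m) f) summable_on UNIV"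
  by (rule abs_summable_summable) (use assms in \<open>simp add: norm_mult\<close>)

text \<open>For even \<open>r\<close> conjugation only permutes the terms, so the series is already
  real and the real part in \<open>fourier_series\<close> loses nothing.\<close>

lemma has_dtft_fourier_series:
  assumes sm: "(\<lambda>m. \<bar>r m\<bar>) summable_on UNIV" and even: "\<And>m. r (- m) = r m"
  shows "has_dtft r (fourier_series r)"
proof (rule has_dtft_of_series[OF sm])
  fix f
  let ?a = "\<lambda>m. of_real (r m) * iexp2pi (- m) f"
  have "cnj (\<Sum>\<^sub>\<infinity>m. ?a m) = (\<Sum>\<^sub>\<infinity>m. cnj (?a m))"
    by (rule infsum_cnj[symmetric])
  also have "\<dots> = (\<Sum>\<^sub>\<infinity>m. ?a (- m))"
    by (simp add: cnj_iexp2pi even)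
  also have "\<dots> = (\<Sum>\<^sub>\<infinity>m. ?a m)"
    by (rule infsum_reindex_bij_betw[where g=uminus and f="?a"]) (auto intro!: bij_betwI[where g=uminus])
  finally have "Im (\<Sum>\<^sub>\<infinity>m. ?a m) = 0" by (simp add: complex_eq_iff)
  then show "complex_of_real (fourier_series r f)
      = (\<Sum>\<^sub>\<infinity>m. of_real (r m) * exp (- \<i> * of_real (2 * pi * f * of_int m)))"
    by (simp add: fourier_series_def complex_eq_iff iexp2pi_def)
qed

text \<open>Summed by lags, the constant sequence yields the triangular weights 1 - |m| / M, so the
  coefficients of the difference are \<open>bias_weight M g m * r m\<close>. At lag 0 the weight is
  0 because \<open>g 0 = 1\<close>, so the noise level \<open>v\<close> is reproduced
  exactly.\<close>

lemma mean_psd_est_bias: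
  assumes M: "1 \<le> M" and g0: "g 0 = 1" and sm: "(\<lambda>m. \<bar>r m\<bar>) summable_on UNIV"
  shows "\<bar>fourier_series r f + v - mean_psd_est M g r v f\<bar> \<le> bias_bound M g r"
proof -
  let ?T = "{- int M + 1..int M - 1}"
  have T: "m \<in> {1 - int M..int M - 1} \<longleftrightarrow> \<bar>m\<bar> < int M" for m by auto
  define e where "e m = iexp2pi (- m) f" for m
  define b where "b m = of_real (g m * (r m + (if m = 0 then v else 0))) * e m" for m
  define h where "h = bias_weight M g"
  have acf1: "acf_est M (\<lambda>_. 1) m = 1 - of_int \<bar>m\<bar> / real M" if "m \<in> ?T" for m
  proof -
    have "real (M - nat \<bar>m\<bar>) = real M - of_int \<bar>m\<bar>"
      using that by (subst of_nat_diff) auto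
    then show ?thesis using M by (simp add: acf_est_def diff_divide_distrib)
  qed
  have mean: "mean_psd_est M g r v f = Re (\<Sum>m\<in>?T. b m * of_real (acf_est M (\<lambda>_. 1) m))"
  proof -
    have "Re (b (int n - int k)) = window_matrix g f n k * noisy_acf r v n k" for n k
      by (simp add: b_def e_def window_matrix_def noisy_acf_def Re_iexp2pi_lag del: minus_diff_eq)
    then show ?thesis
      unfolding sum_by_lag[OF M] by (simp add: mean_psd_est_def Re_divide_of_nat)
  qed
  let ?d = "\<lambda>m. of_real (h m * r m) * e m"
  \<comment> \<open>The weight is 1 outside the finite range \<open>?T\<close>, hence bounded, and
    the weighted series inherits summability.\<close>
  have hb: "\<bar>h m\<bar> \<le> 1 + (\<Sum>k\<in>?T. \<bar>h k\<bar>)" for m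
  proof (cases "m \<in> ?T")
    case True
    then have "\<bar>h m\<bar> \<le> (\<Sum>k\<in>?T. \<bar>h k\<bar>)" by (intro member_le_sum) auto
    then show ?thesis by simp
  next
    case False
    then have "h m = 1" by (auto simp: h_def bias_weight_def)
    then show ?thesis by (simp add: sum_nonneg)
  qed
  have smh: "(\<lambda>m. \<bar>h m\<bar> * \<bar>r m\<bar>) summable_on UNIV"
  proof (rule summable_on_comparison_test)
    show "(\<lambda>m. (1 + (\<Sum>k\<in>?T. \<bar>h k\<bar>)) * \<bar>r m\<bar>) summable_on UNIV"
      by (rule summable_on_cmult_right[OF sm])
    show "\<bar>h m\<bar> * \<bar>r m\<bar> \<le> (1 + (\<Sum>k\<in>?T. \<bar>h k\<bar>)) * \<bar>r m\<bar>" for m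
      by (intro mult_right_mono hb) simp
  qed auto
  have h1: "((\<lambda>m. of_real (r m) * e m) has_sum (\<Sum>\<^sub>\<infinity>m. of_real (r m) * e m)) UNIV"
    unfolding e_def by (rule has_sum_infsum[OF fourier_series_summable[OF sm]])
  have h2: "((\<lambda>m. if m \<in> ?T then of_real (r m) * e m * of_real (1 - h m) else 0)
      has_sum (\<Sum>m\<in>?T. of_real (r m) * e m * of_real (1 - h m))) UNIV"
  proof -
    have "((\<lambda>m. if m \<in> ?T then of_real (r m) * e m * of_real (1 - h m) else 0) has_sum S) UNIV
        \<longleftrightarrow> ((\<lambda>m. of_real (r m) * e m * of_real (1 - h m)) has_sum S) ?T" for S
      by (rule has_sum_cong_neutral) auto
    then show ?thesis by (simp only: has_sum_finite finite_atLeastAtMost_int)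
  qed
  have hs: "(?d has_sum ((\<Sum>\<^sub>\<infinity>m. of_real (r m) * e m) - (\<Sum>m\<in>?T. of_real (r m) * e m * of_real (1 - h m)))) UNIV"
  proof -
    have "((\<lambda>m. of_real (r m) * e m + - (if m \<in> ?T then of_real (r m) * e m * of_real (1 - h m) else 0))
        has_sum ((\<Sum>\<^sub>\<infinity>m. of_real (r m) * e m) + - (\<Sum>m\<in>?T. of_real (r m) * e m * of_real (1 - h m)))) UNIV"
      using h2 by (intro has_sum_add h1 has_sum_uminus[THEN iffD2]) (simp only: minus_minus)
    moreover have "of_real (r m) * e m + - (if m \<in> ?T then of_real (r m) * e m * of_real (1 - h m) else 0) = ?d m" for m
      by (auto simp: T h_def bias_weight_def algebra_simps simp del: atLeastAtMost_iff)
    ultimately show ?thesis by simp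
  qed
  have fin: "(\<Sum>m\<in>?T. b m * of_real (acf_est M (\<lambda>_. 1) m)) = (\<Sum>m\<in>?T. of_real (r m) * e m * of_real (1 - h m)) + of_real v"
  proof -
    have "b m * of_real (acf_est M (\<lambda>_. 1) m) = of_real (r m) * e m * of_real (1 - h m) + (if m = 0 then of_real v else 0)"
      if "m \<in> ?T" for m
    proof -
      have "1 - h m = g m * acf_est M (\<lambda>_. 1) m"
        using that acf1[OF that] by (simp add: T h_def bias_weight_def del: atLeastAtMost_iff)
      moreover have "b m * of_real (acf_est M (\<lambda>_. 1) m)
          = of_real ((g m * acf_est M (\<lambda>_. 1) m) * (r m + (if m = 0 then v else 0))) * e m"
        by (simp add: b_def mult_ac)
      ultimately have "b m * of_real (acf_est M (\<lambda>_. 1) m)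
          = of_real ((1 - h m) * (r m + (if m = 0 then v else 0))) * e m" by simp
      moreover have "h 0 = 0" using M g0 by (simp add: h_def bias_weight_def)
      moreover have "e 0 = 1" by (simp add: e_def)
      ultimately show ?thesis by (cases "m = 0") (simp_all add: mult_ac)
    qed
    then show ?thesis using M by (simp add: sum.distrib)
  qed
  have "fourier_series r f + v - mean_psd_est M g r v f
      = Re ((\<Sum>\<^sub>\<infinity>m. of_real (r m) * e m) - (\<Sum>m\<in>?T. of_real (r m) * e m * of_real (1 - h m)))"
    unfolding mean fin by (simp add: fourier_series_def e_def)
  also have "\<bar>\<dots>\<bar> \<le> cmod ((\<Sum>\<^sub>\<infinity>m. of_real (r m) * e m) - (\<Sum>m\<in>?T. of_real (r m) * e m * of_real (1 - h m)))"
    by (rule abs_Re_le_cmod)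
  also have "\<dots> \<le> bias_bound M g r"
  proof (rule norm_has_sum_bound[OF _ hs])
    have "norm (?d m) = \<bar>h m\<bar> * \<bar>r m\<bar>" for m by (simp add: norm_mult e_def abs_mult)
    then show "((\<lambda>m. norm (?d m)) has_sum bias_bound M g r) UNIV"
      using has_sum_infsum[OF smh] by (simp add: bias_bound_def h_def)
  qed
  finally show ?thesis .
qed

lemma bias_bound_nonneg: "0 \<le> bias_bound M g r"
  unfolding bias_bound_def by (rule infsum_nonneg) simp

section \<open>Separation of the observations\<close>

lemma psd_est_set_integrable:
  assumes "1 \<le> M"
  shows "set_integrable lborel {0..<1} (\<lambda>f. quad_form {1..M} (window_matrix g f) x / real M)"
    and "set_integrable lborel {0..<1} (mean_psd_est M g r v)"
proof -
  have "set_integrable lborel {0..<1} h" if "continuous_on {0..1} h" for h :: "real \<Rightarrow> real"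
    by (rule set_integrable_subset[OF borel_integrable_atLeastAtMost'[OF that]]) auto
  note int = this
  show "set_integrable lborel {0..<1} (\<lambda>f. quad_form {1..M} (window_matrix g f) x / real M)"
    unfolding quad_form_def window_matrix_def
    by (rule int) (use assms in \<open>auto intro!: continuous_intros\<close>)
  show "set_integrable lborel {0..<1} (mean_psd_est M g r v)"
    unfolding mean_psd_est_def[abs_def] window_matrix_def
    by (rule int) (use assms in \<open>auto intro!: continuous_intros\<close>)
qed

lemma obs_dist_eq:
  assumes "1 \<le> M" "has_dtft g gf"
  shows "obs_dist M g x y = 1 / 2 * (LBINT f:{0..<1}.
    \<bar>quad_form {1..M} (window_matrix g f) x / real M - quad_form {1..M} (window_matrix g f) y / real M\<bar>)"
  unfolding obs_dist_def psd_est_eq_quad_form[OF assms] of_real_diff[symmetric] norm_of_real ..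

lemma obs_dist_le:
  assumes "1 \<le> M" "has_dtft g gf"
  shows "obs_dist M g x y \<le> 1 / 2 *
     ((LBINT f:{0..<1}. \<bar>quad_form {1..M} (window_matrix g f) x / real M - mean_psd_est M g r v f\<bar>)
    + (LBINT f:{0..<1}. \<bar>quad_form {1..M} (window_matrix g f) y / real M - mean_psd_est M g r v f\<bar>))"
proof -
  note int = psd_est_set_integrable[OF assms(1), of g]
  let ?p = "\<lambda>x f. quad_form {1..M} (window_matrix g f) x / real M" and ?m = "mean_psd_est M g r v"
  have i: "set_integrable lborel {0..<1} (\<lambda>f. \<bar>?p x f - ?m f\<bar>)" for x
    by (intro set_integrable_abs set_integral_diff(1) int)
  have "(LBINT f:{0..<1}. \<bar>?p x f - ?p y f\<bar>) \<le> (LBINT f:{0..<1}. \<bar>?p x f - ?m f\<bar> + \<bar>?p y f - ?m f\<bar>)"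
    by (intro set_integral_mono set_integrable_abs set_integral_diff(1) set_integral_add(1) int i) auto
  also have "\<dots> = (LBINT f:{0..<1}. \<bar>?p x f - ?m f\<bar>) + (LBINT f:{0..<1}. \<bar>?p y f - ?m f\<bar>)"
    by (rule set_integral_add(2)[OF i i])
  finally show ?thesis unfolding obs_dist_eq[OF assms] by simp
qed

text \<open>Triangle inequality from one spectrum through its mean estimate and the two estimates to
  the other mean and spectrum. The noise level \<open>v\<close> shifts both spectra alike and
  cancels; two biases of at most \<open>mu\<close> become \<open>mu\<close> after halving.\<close>

lemma process_dist_le:
  assumes M: "1 \<le> M" and g: "has_dtft g gf" "g 0 = 1"
    and r: "has_dtft r s" "(\<lambda>m. \<bar>r m\<bar>) summable_on UNIV" "bias_bound M g r \<le> mu"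
    and r': "has_dtft r' s'" "(\<lambda>m. \<bar>r' m\<bar>) summable_on UNIV" "bias_bound M g r' \<le> mu"
  shows "process_dist s s' \<le> mu + obs_dist M g x y + 1 / 2 *
     ((LBINT f:{0..<1}. \<bar>quad_form {1..M} (window_matrix g f) x / real M - mean_psd_est M g r v f\<bar>)
    + (LBINT f:{0..<1}. \<bar>quad_form {1..M} (window_matrix g f) y / real M - mean_psd_est M g r' v f\<bar>))"
proof -
  note int = psd_est_set_integrable[OF M, of g]
  let ?X = "{0..<1::real}"
  let ?p = "\<lambda>x f. quad_form {1..M} (window_matrix g f) x / real M" and ?m = "\<lambda>r. mean_psd_est M g r v"
  have i: "set_integrable lborel ?X (\<lambda>f. \<bar>?p x f - ?m r f\<bar>)" for x r
    by (intro set_integrable_abs set_integral_diff(1) int)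
  have j: "set_integrable lborel ?X (\<lambda>f. \<bar>?p x f - ?p y f\<bar>)"
    by (intro set_integrable_abs set_integral_diff(1) int)
  have k: "set_integrable lborel ?X (\<lambda>_. 2 * mu)"
    by (rule set_integrable_const_unit)
  have bias: "AE f in lborel. f \<in> ?X \<longrightarrow> \<bar>s f + v - ?m r f\<bar> \<le> mu"
    if "has_dtft r s" "(\<lambda>m. \<bar>r m\<bar>) summable_on UNIV" "bias_bound M g r \<le> mu" for r s
    using has_dtft_unique_AE[OF that(1) has_dtft_fourier_series[OF that(2) has_dtft_even[OF that(1)]]]
  proof eventually_elim
    case (elim f)
    then show ?case
      using mean_psd_est_bias[where f=f and v=v and g=g and r=r, OF M g(2) that(2)] that(3) by simp
  qed
  have "(LBINT f:?X. \<bar>s f - s' f\<bar>)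
      \<le> (LBINT f:?X. 2 * mu + \<bar>?p x f - ?p y f\<bar> + \<bar>?p x f - ?m r f\<bar> + \<bar>?p y f - ?m r' f\<bar>)"
  proof (rule set_integral_mono_AE)
    show "set_integrable lborel ?X (\<lambda>f. \<bar>s f - s' f\<bar>)"
      using r(1) r'(1) by (intro set_integrable_abs set_integral_diff(1)) (auto simp: has_dtft_def)
    show "set_integrable lborel ?X (\<lambda>f. 2 * mu + \<bar>?p x f - ?p y f\<bar> + \<bar>?p x f - ?m r f\<bar> + \<bar>?p y f - ?m r' f\<bar>)"
      by (intro set_integral_add(1) i j k)
    show "AE f\<in>?X in lborel. \<bar>s f - s' f\<bar>
        \<le> 2 * mu + \<bar>?p x f - ?p y f\<bar> + \<bar>?p x f - ?m r f\<bar> + \<bar>?p y f - ?m r' f\<bar>"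
      using bias[OF r] bias[OF r'] by eventually_elim auto
  qed
  also have "\<dots> = (LBINT f:?X. 2 * mu) + (LBINT f:?X. \<bar>?p x f - ?p y f\<bar>)
      + (LBINT f:?X. \<bar>?p x f - ?m r f\<bar>) + (LBINT f:?X. \<bar>?p y f - ?m r' f\<bar>)"
    using i j k by (simp add: set_integral_add)
  also have "(LBINT f:?X. 2 * mu) = 2 * mu"
    by (rule set_integral_const_unit)
  finally show ?thesis
    unfolding obs_dist_eq[OF M g(1)] process_dist_def by argo
qed

text \<open>Both values are at most \<open>B\<close>, so |s f - s' f| \<le> 2 B - s f - s' f, and
  the normalization makes the right-hand side integrate to 2 B - 2.\<close>

lemma process_dist_le_sup:
  assumes s: "set_integrable lborel {0..<1} s" "(LBINT f:{0..<1}. s f) = 1" "\<And>f. f \<in> {0..<1} \<Longrightarrow> s f \<le> B"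
    and s': "set_integrable lborel {0..<1} s'" "(LBINT f:{0..<1}. s' f) = 1" "\<And>f. f \<in> {0..<1} \<Longrightarrow> s' f \<le> B"
  shows "process_dist s s' \<le> B - 1"
proof -
  have k: "set_integrable lborel {0..<1::real} (\<lambda>_. 2 * B)" by (rule set_integrable_const_unit)
  have "(LBINT f:{0..<1}. \<bar>s f - s' f\<bar>) \<le> (LBINT f:{0..<1}. 2 * B - s f - s' f)"
  proof (rule set_integral_mono)
    fix f :: real assume "f \<in> {0..<1}"
    then show "\<bar>s f - s' f\<bar> \<le> 2 * B - s f - s' f" using s(3)[of f] s'(3)[of f] by simp
  qed (intro set_integrable_abs set_integral_diff(1) s(1) s'(1) k)+
  also have "\<dots> = 2 * B - 1 - 1"
    using s(1,2) s'(1,2) k set_integral_diff(1)[OF k s(1)]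
    by (simp add: set_integral_const_unit del: set_integral_mult_right)
  finally show ?thesis by (simp add: process_dist_def)
qed

section \<open>Combinatorics of the neighbour graph\<close>

lemma nn_adjacency_nonzero: "nn_adjacency D T i j \<noteq> 0 \<longleftrightarrow> j \<in> T i \<or> i \<in> T j"
  by (auto simp: nn_adjacency_def nn_weight_def add_pos_pos less_imp_neq[symmetric])

text \<open>Pigeonhole: the cluster of \<open>i\<close> has at least \<open>q\<close> other members,
  so a neighbour set of size \<open>q\<close> containing an outsider \<open>j\<close> omits some
  member \<open>p\<close>, although \<open>p\<close> is strictly closer. An edge may stem from the
  neighbour set of either endpoint, so the argument is used at both.\<close>

lemma nearest_neighbours_no_false_connections:
  assumes nn: "nearest_neighbours N q D T" and lab: "lab \<in> {1..N} \<rightarrow> {1..L}"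
    and q: "\<And>l. l \<in> {1..L} \<Longrightarrow> int q \<le> int (card (cluster N lab l)) - 1"
    and sep: "\<And>i j p. i \<in> {1..N} \<Longrightarrow> j \<in> {1..N} \<Longrightarrow> p \<in> {1..N} \<Longrightarrow>
        lab j \<noteq> lab i \<Longrightarrow> lab p = lab i \<Longrightarrow> D i p < D i j"
  shows "no_false_connections N L lab (nn_adjacency D T)"
proof -
  have T: "T i \<subseteq> {1..N} - {i}" "card (T i) = q"
    and le: "\<And>j p. j \<in> T i \<Longrightarrow> p \<in> {1..N} - (T i \<union> {i}) \<Longrightarrow> D i j \<le> D i p" if "i \<in> {1..N}" for i
    using nn that by (auto simp: nearest_neighbours_def)
  have same: "lab j = lab i" if i: "i \<in> {1..N}" and j: "j \<in> T i" for i j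
  proof (rule ccontr)
    assume ne: "lab j \<noteq> lab i"
    let ?C = "cluster N lab (lab i)"
    have fin: "finite (T i)" using T(1)[OF i] by (rule finite_subset) simp
    have "i \<in> ?C" "finite ?C" using i by (auto simp: cluster_def)
    have "lab i \<in> {1..L}" using lab i by blast
    then have "q \<le> card (?C - {i})"
      using q[of "lab i"] \<open>i \<in> ?C\<close> \<open>finite ?C\<close> by (simp add: card_Diff_singleton)
    have "\<not> ?C - {i} \<subseteq> T i"
    proof
      assume "?C - {i} \<subseteq> T i"
      then have "?C - {i} \<subseteq> T i - {j}" using ne by (auto simp: cluster_def)
      then have "card (?C - {i}) \<le> card (T i - {j})" using fin by (intro card_mono) auto
      also have "\<dots> < card (T i)" using j fin by (intro card_Diff1_less)
      finally show False using \<open>q \<le> card (?C - {i})\<close> T(2)[OF i] by simp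
    qed
    then obtain p where p: "p \<in> ?C" "p \<noteq> i" "p \<notin> T i" by blast
    then have "D i j \<le> D i p" using le[OF i j, of p] by (auto simp: cluster_def)
    moreover have "D i p < D i j"
      using sep[OF i _ _ ne] T(1)[OF i] j p by (auto simp: cluster_def)
    ultimately show False by simp
  qed
  show ?thesis
    unfolding no_false_connections_def
  proof (intro ballI impI)
    fix l i j
    assume i: "i \<in> cluster N lab l" and j: "j \<in> {1..N}" and "nn_adjacency D T i j \<noteq> 0"
    then have "j \<in> T i \<or> i \<in> T j" by (simp add: nn_adjacency_nonzero)
    moreover have "i \<in> {1..N}" "lab i = l" using i by (auto simp: cluster_def)
    ultimately show "j \<in> cluster N lab l - {i}"
      using same[of i j] same[of j i] T(1)[of i] T(1)[of j] j by (auto simp: cluster_def)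
  qed
qed

text \<open>Only the finitely many restrictions of \<open>T\<close> to \<open>{1..N}\<close> matter, which makes the event of the
  theorem measurable.\<close>

lemma all_nearest_neighbours_iff:
  "(\<forall>T. nearest_neighbours N q D T \<longrightarrow> no_false_connections N L lab (nn_adjacency D T))
   \<longleftrightarrow> (\<forall>T\<in>{1..N} \<rightarrow>\<^sub>E Pow {1..N}. nearest_neighbours N q D T \<longrightarrow>
          no_false_connections N L lab (nn_adjacency (\<lambda>_ _. 0) T))" (is "?lhs \<longleftrightarrow> ?rhs")
proof -
  \<comment> \<open>Edge weights are exponentials, hence positive: which edges are present depends
    on \<open>T\<close> alone.\<close>
  have D: "no_false_connections N L lab (nn_adjacency D T)
      \<longleftrightarrow> no_false_connections N L lab (nn_adjacency (\<lambda>_ _. 0) T)" for T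
    by (simp add: no_false_connections_def nn_adjacency_nonzero)
  have "nearest_neighbours N q D (restrict T {1..N}) \<longleftrightarrow> nearest_neighbours N q D T" for T
    by (simp add: nearest_neighbours_def)
  moreover have "no_false_connections N L lab (nn_adjacency D (restrict T {1..N}))
      \<longleftrightarrow> no_false_connections N L lab (nn_adjacency D T)" for T
    by (auto simp: no_false_connections_def nn_adjacency_nonzero cluster_def)
  moreover have "restrict T {1..N} \<in> {1..N} \<rightarrow>\<^sub>E Pow {1..N}" if "nearest_neighbours N q D T" for T
    using that by (auto simp: nearest_neighbours_def)
  ultimately show ?thesis unfolding D[symmetric] by metis
qed

lemma obs_dist_measurable:
  assumes "1 \<le> M" "has_dtft g gf"
    and [measurable]: "\<And>n. n \<in> {1..M} \<Longrightarrow> x n \<in> borel_measurable P" "\<And>n. n \<in> {1..M} \<Longrightarrow> y n \<in> borel_measurable P"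
  shows "(\<lambda>\<omega>. obs_dist M g (\<lambda>n. x n \<omega>) (\<lambda>n. y n \<omega>)) \<in> borel_measurable P"
  unfolding obs_dist_eq[OF assms(1,2)] set_lebesgue_integral_def quad_form_def window_matrix_def
  by measurable

theorem theorem1:
  fixes P :: "'a measure"
    and X W :: "nat \<Rightarrow> int \<Rightarrow> 'a \<Rightarrow> real"
    and r :: "nat \<Rightarrow> int \<Rightarrow> real" and s :: "nat \<Rightarrow> real \<Rightarrow> real"
    and x :: "nat \<Rightarrow> nat \<Rightarrow> 'a \<Rightarrow> real"
    and lab :: "nat \<Rightarrow> nat"
    and g :: "int \<Rightarrow> real" and gf :: "real \<Rightarrow> real"
    and A B \<sigma> mu_max :: real
    and L N M q :: nat
  assumes "prob_space P"
    and "M \<ge> 1" and "L < N"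
    \<comment> \<open>generative models\<close>
    and "\<And>l. l \<in> {1..L} \<Longrightarrow> zm_stationary_gaussian P (X l) (r l)"
    and "\<And>l. l \<in> {1..L} \<Longrightarrow> (\<lambda>m. \<bar>r l m\<bar>) summable_on UNIV"
    and "\<And>l. l \<in> {1..L} \<Longrightarrow> has_dtft (r l) (s l)"
    and "\<And>l. l \<in> {1..L} \<Longrightarrow> (LBINT f:{0..<1}. s l f) = 1"
    and "\<And>l. l \<in> {1..L} \<Longrightarrow> white_gaussian_noise P (W l) (\<sigma>\<^sup>2)"
    and "\<And>l. l \<in> {1..L} \<Longrightarrow> indep_processes P (X l) (W l)"
    \<comment> \<open>observations; \<open>lab i\<close> is the model that generates \<open>x i\<close>\<close>
    and "lab \<in> {1..N} \<rightarrow> {1..L}"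
    and "\<And>l. l \<in> {1..L} \<Longrightarrow>
           observations_of P (\<lambda>m \<omega>. X l m \<omega> + W l m \<omega>) M (cluster N lab l) x"
    \<comment> \<open>window function\<close>
    and "\<And>m. g (- m) = g m" and "g 0 = 1" and "has_dtft g gf"
    and "\<And>f. f \<in> {0..<1} \<Longrightarrow> 0 \<le> gf f \<and> gf f \<le> A"
    \<comment> \<open>constants\<close>
    and "ereal B = (MAX l\<in>{1..L}. SUP f\<in>{0..<1}. ereal (s l f))"
    and "mu_max = (MAX l\<in>{1..L}. bias_bound M g (r l))"
    \<comment> \<open>number of neighbours and separation of the models\<close>
    and "\<And>l. l \<in> {1..L} \<Longrightarrow> int q \<le> int (card (cluster N lab l)) - 1"
    and "\<And>k l. k \<in> {1..L} \<Longrightarrow> l \<in> {1..L} \<Longrightarrow> k \<noteq> l \<Longrightarrow>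
           process_dist (s k) (s l) >
             8 * A * (B + \<sigma>\<^sup>2) * sqrt (2 * ln (real M) / real M) + 2 * mu_max"
  shows "measure P {\<omega> \<in> space P.
           let D = (\<lambda>i j. obs_dist M g (\<lambda>n. x i n \<omega>) (\<lambda>n. x j n \<omega>))
           in \<forall>T. nearest_neighbours N q D T \<longrightarrow>
                no_false_connections N L lab (nn_adjacency D T)}
         \<ge> 1 - 2 * real N / (real M)\<^sup>2"
proof -
  interpret P: prob_space P by fact
  let ?v = "\<sigma>\<^sup>2"
  let ?D = "\<lambda>\<omega> i j. obs_dist M g (\<lambda>n. x i n \<omega>) (\<lambda>n. x j n \<omega>)"
  let ?E = "{\<omega> \<in> space P. \<forall>T. nearest_neighbours N q (?D \<omega>) T \<longrightarrow>
      no_false_connections N L lab (nn_adjacency (?D \<omega>) T)}"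
  note M = assms(2) and lab = assms(10) and g0 = assms(13) and g = assms(14) and gf = assms(15)
  have labL: "lab i \<in> {1..L}" if "i \<in> {1..N}" for i using lab that by blast
  have L: "1 \<le> L" using labL[of 1] \<open>L < N\<close> by auto
  have sB: "s l f \<le> B" if "l \<in> {1..L}" "f \<in> {0..<1}" for l f
  proof -
    have "ereal (s l f) \<le> (SUP f\<in>{0..<1}. ereal (s l f))" using that(2) by (rule SUP_upper)
    also have "\<dots> \<le> (MAX l\<in>{1..L}. SUP f\<in>{0..<1}. ereal (s l f))"
      using that(1) by (intro Max_ge) auto
    finally have "ereal (s l f) \<le> ereal B" unfolding assms(16) .
    then show ?thesis by simp
  qed
  have mu: "bias_bound M g (r l) \<le> mu_max" if "l \<in> {1..L}" for l
    unfolding assms(17) using that by (intro Max_ge) auto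
  have mu0: "0 \<le> mu_max" using mu[of 1] L bias_bound_nonneg[of M g "r 1"] by simp
  have sint: "set_integrable lborel {0..<1} (s l)" if "l \<in> {1..L}" for l
    using assms(6)[OF that] by (simp add: has_dtft_def)
  have A: "1 \<le> A" using dtft_zero_le_sup[OF g, of A] gf g0 by simp
  have pd: "process_dist (s k) (s l) \<le> B - 1" if "k \<in> {1..L}" "l \<in> {1..L}" for k l
    using that by (intro process_dist_le_sup sint assms(7) sB)
  \<comment> \<open>The distance of a spectrum to itself is 0, so the bound \<open>pd\<close> reads
    0 \<le> B - 1.\<close>
  have B: "1 \<le> B"
  proof -
    have "process_dist (s 1) (s 1) \<le> B - 1" by (rule pd) (use L in auto)
    then show ?thesis by (simp add: process_dist_def set_lebesgue_integral_def)
  qed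
  have Bv: "0 < B + ?v" using B zero_le_power2[of \<sigma>] by linarith
  have gauss: "centered_gaussian P {1..M} (x i) (noisy_acf (r (lab i)) ?v)" if i: "i \<in> {1..N}" for i
  proof -
    let ?l = "lab i"
    have "i \<in> cluster N lab ?l" using i by (simp add: cluster_def)
    moreover obtain Y t where "\<forall>i\<in>cluster N lab ?l. realization P (\<lambda>m \<omega>. X ?l m \<omega> + W ?l m \<omega>) (Y i)"
      and "\<forall>i\<in>cluster N lab ?l. \<forall>n\<in>{1..M}. \<forall>\<omega>\<in>space P. x i n \<omega> = Y i (t i + int n) \<omega>"
      using assms(11)[OF labL[OF i]] unfolding observations_of_def
      by (elim exE conjE) (rule that; assumption)
    ultimately have Y: "realization P (\<lambda>m \<omega>. X ?l m \<omega> + W ?l m \<omega>) (Y i)"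
      and xi: "\<And>n \<omega>. n \<in> {1..M} \<Longrightarrow> \<omega> \<in> space P \<Longrightarrow> x i n \<omega> = Y i (t i + int n) \<omega>"
      by auto
    show ?thesis
      unfolding noisy_acf_def[abs_def]
      by (rule noisy_realization_centered_gaussian[OF assms(1) assms(4)[OF labL[OF i]] assms(8)[OF labL[OF i]]
            assms(9)[OF labL[OF i]] Y, where t="t i"]) (simp_all add: xi)
  qed
  have xm: "x i n \<in> borel_measurable P" if "i \<in> {1..N}" "n \<in> {1..M}" for i n
    using gauss[OF that(1)] that(2) by (simp add: centered_gaussian_def)
  have Dm: "(\<lambda>\<omega>. ?D \<omega> i j) \<in> borel_measurable P" if "i \<in> {1..N}" "j \<in> {1..N}" for i j
    using that by (intro obs_dist_measurable[OF M g] xm)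
  have E: "?E \<in> sets P"
  proof -
    have "Measurable.pred P (\<lambda>\<omega>. nearest_neighbours N q (?D \<omega>) T)" if T: "T \<in> {1..N} \<rightarrow>\<^sub>E Pow {1..N}" for T
      unfolding nearest_neighbours_def
    proof (intro pred_intros_finite pred_intros_logic)
      fix i assume i: "i \<in> {1..N}"
      then have sub: "T i \<subseteq> {1..N}" using T by blast
      then show "finite (T i)" by (rule finite_subset) simp
      fix j p assume "j \<in> T i" "p \<in> {1..N} - (T i \<union> {i})"
      then show "Measurable.pred P (\<lambda>\<omega>. ?D \<omega> i j \<le> ?D \<omega> i p)"
        using i sub by (intro borel_measurable_pred_less borel_measurable_le[unfolded pred_def[symmetric]] Dm) auto
    qed auto
    then have "Measurable.pred P (\<lambda>\<omega>. \<forall>T\<in>{1..N} \<rightarrow>\<^sub>E Pow {1..N}. nearest_neighbours N q (?D \<omega>) T \<longrightarrow>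
          no_false_connections N L lab (nn_adjacency (\<lambda>_ _. 0) T))"
      by (intro pred_intros_finite pred_intros_logic finite_PiE) auto
    then show ?thesis unfolding all_nearest_neighbours_iff pred_def .
  qed
  have "1 - 2 * real N / (real M)\<^sup>2 \<le> measure P ?E"
  proof (cases "\<exists>k\<in>{1..L}. \<exists>l\<in>{1..L}. k \<noteq> l")
    \<comment> \<open>With a single model the separation hypothesis is vacuous and gives no control
      of u, but then all labels agree and no edge can be false.\<close>
    case False
    have "no_false_connections N L lab (nn_adjacency (?D \<omega>) T)" if "nearest_neighbours N q (?D \<omega>) T" for \<omega> T
      by (rule nearest_neighbours_no_false_connections[OF that lab assms(18)]) (use False labL in blast)+
    then have "?E = space P" by blast
    then show ?thesis by (simp add: P.prob_space)
  next
    case True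
    define u where "u = sqrt (2 * ln (real M) / real M)"
    have u0: "0 \<le> u" using M by (simp add: u_def)
    \<comment> \<open>Separation and the distance bound \<open>B - 1\<close> give 8 A (B +
      \<sigma>^2) u < B; as A (B + \<sigma>^2) is at least \<open>B\<close>, even 8 u < 1
      holds.\<close>
    have u: "u \<le> 1 / 2"
    proof -
      obtain k l where "k \<in> {1..L}" "l \<in> {1..L}" "k \<noteq> l" using True by blast
      then have "8 * A * (B + ?v) * u + 2 * mu_max < B - 1"
        using assms(19)[of k l] pd[of k l] by (simp add: u_def)
      then have "8 * A * (B + ?v) * u < B" using mu0 by simp
      moreover have "B * u \<le> A * (B + ?v) * u"
      proof (rule mult_right_mono)
        have "1 * B \<le> A * (B + ?v)" using A B by (intro mult_mono) auto
        then show "B \<le> A * (B + ?v)" by simp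
      qed (rule u0)
      ultimately have "B * (8 * u) < B * 1" by simp
      then show ?thesis using B by (simp only: mult_less_cancel_left_pos)
    qed
    define Z where "Z i \<omega> = (LBINT f:{0..<1}. \<bar>quad_form {1..M} (window_matrix g f) (\<lambda>n. x i n \<omega>) / real M
        - mean_psd_est M g (r (lab i)) ?v f\<bar>)" for i \<omega>
    define bad where "bad i = {\<omega> \<in> space P. 4 * A * (B + ?v) * u \<le> Z i \<omega>}" for i
    have Zm: "Z i \<in> borel_measurable P" and Pbad: "measure P (bad i) \<le> 2 / (real M)\<^sup>2" if "i \<in> {1..N}" for i
      using psd_est_concentration[OF assms(1) gauss[OF that] assms(6)[OF labL[OF that]] sB[OF labL[OF that]]
          g gf g0 Bv M] u
      unfolding bad_def Z_def[abs_def] u_def by auto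
    have badm: "bad i \<in> sets P" if "i \<in> {1..N}" for i
      unfolding bad_def using Zm[OF that] by measurable
    have good: "space P - (\<Union>i\<in>{1..N}. bad i) \<subseteq> ?E"
    proof (intro subsetI CollectI conjI allI impI)
      fix \<omega> T assume \<omega>: "\<omega> \<in> space P - (\<Union>i\<in>{1..N}. bad i)" and nn: "nearest_neighbours N q (?D \<omega>) T"
      have Zi: "Z i \<omega> < 4 * A * (B + ?v) * u" if "i \<in> {1..N}" for i
        using \<omega> that by (auto simp: bad_def not_le)
      show "no_false_connections N L lab (nn_adjacency (?D \<omega>) T)"
      proof (rule nearest_neighbours_no_false_connections[OF nn lab assms(18)])
        fix i j p assume ijp: "i \<in> {1..N}" "j \<in> {1..N}" "p \<in> {1..N}" and ne: "lab j \<noteq> lab i" and eq: "lab p = lab i"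
        \<comment> \<open>Since \<open>i\<close> and \<open>p\<close> stem from the same model, both
          estimates concentrate around the same mean and no bias enters.\<close>
        have "?D \<omega> i p \<le> 1 / 2 * (Z i \<omega> + Z p \<omega>)"
          unfolding Z_def eq by (rule obs_dist_le[OF M g])
        moreover have "process_dist (s (lab i)) (s (lab j)) \<le> mu_max + ?D \<omega> i j + 1 / 2 * (Z i \<omega> + Z j \<omega>)"
          unfolding Z_def using labL[OF ijp(1)] labL[OF ijp(2)]
          by (intro process_dist_le[OF M g g0] assms(5,6) mu)
        moreover have "8 * A * (B + ?v) * u + 2 * mu_max < process_dist (s (lab i)) (s (lab j))"
          using assms(19)[OF labL[OF ijp(1)] labL[OF ijp(2)]] ne by (simp add: u_def)
        ultimately show "?D \<omega> i p < ?D \<omega> i j"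
          using Zi[OF ijp(1)] Zi[OF ijp(2)] Zi[OF ijp(3)] mu0 by argo
      qed
    qed auto
    have "measure P (\<Union>i\<in>{1..N}. bad i) \<le> (\<Sum>i\<in>{1..N}. measure P (bad i))"
      by (rule P.finite_measure_subadditive_finite) (use badm in auto)
    also have "\<dots> \<le> (\<Sum>i\<in>{1..N}. 2 / (real M)\<^sup>2)" by (intro sum_mono Pbad)
    finally have "measure P (\<Union>i\<in>{1..N}. bad i) \<le> 2 * real N / (real M)\<^sup>2" by (simp add: mult.commute)
    moreover have "measure P (space P - (\<Union>i\<in>{1..N}. bad i)) = 1 - measure P (\<Union>i\<in>{1..N}. bad i)"
      using badm by (intro P.prob_compl sets.finite_UN) auto
    moreover have "measure P (space P - (\<Union>i\<in>{1..N}. bad i)) \<le> measure P ?E"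
      by (rule P.finite_measure_mono[OF good E])
    ultimately show ?thesis by simp
  qed
  then show ?thesis by (simp only: Let_def)
qed

end
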